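(* No $K$-trivial set is weakly ML-cuppable. That is, if $A \subseteq \omega$ is $K$-trivial and $X$ is a Martin-L\"of random set with $A \oplus X \ge_T \emptyset'$, then $X \ge_T \emptyset'$.
   Context: $K$ denotes prefix-free Kolmogorov complexity, and $K(n)$ means $K(1^n)$. A set $A$ is $K$-trivial if there is a constant $c$ such that $K(A\upharpoonright n) \le K(n) + c$ for all $n$. A set $R$ is Martin-L\"of random if there is a constant $c$ such that $K(R \upharpoonright n) > n - c$ for all $n$. A set $A$ is weakly ML-cuppable if there is a Martin-L\"of random set $X$ with $X \not\ge_T \emptyset'$ (an incomplete Martin-L\"of random) such that $A \oplus X \ge_T \emptyset'$. *)

theory Defs
  imports "HOL-Library.Nat_Bijection" "HOL-Library.Sublist" "HOL-Library.Extended_Nat"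
begin

section \<open>Oracle computability\<close>

text \<open>
  Programs for the functions that are partial recursive in an oracle. All functions are unary;
  several arguments are packed with \<^const>\<open>prod_encode\<close>.
\<close>

datatype prog =
    Zero | Succ | ProjL | ProjR | Query
  | Tup prog prog | Comp prog prog | PrimRec prog prog | Mu prog

text \<open>
  The value \<^const>\<open>None\<close> means divergence. In particular \<open>Mu f\<close> maps \<open>a\<close> to the least \<open>n\<close> with
  \<open>f (a, n) = 0\<close> provided that \<open>f (a, m)\<close> converges for all \<open>m < n\<close>.
\<close>

primrec eval :: "nat set \<Rightarrow> prog \<Rightarrow> nat \<Rightarrow> nat option" where
  "eval A Zero = (\<lambda>x. Some 0)"
| "eval A Succ = (\<lambda>x. Some (Suc x))"
| "eval A ProjL = (\<lambda>x. Some (fst (prod_decode x)))"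
| "eval A ProjR = (\<lambda>x. Some (snd (prod_decode x)))"
| "eval A Query = (\<lambda>x. Some (of_bool (x \<in> A)))"
| "eval A (Tup f g) = (\<lambda>x.
     Option.bind (eval A f x) (\<lambda>a. Option.bind (eval A g x) (\<lambda>b. Some (prod_encode (a, b)))))"
| "eval A (Comp f g) = (\<lambda>x. Option.bind (eval A g x) (eval A f))"
| "eval A (PrimRec f g) = (\<lambda>x. case prod_decode x of (a, n) \<Rightarrow>
     rec_nat (eval A f a)
       (\<lambda>k r. Option.bind r (\<lambda>y. eval A g (prod_encode (a, prod_encode (k, y))))) n)"
| "eval A (Mu f) = (\<lambda>a.
     let P = (\<lambda>n. eval A f (prod_encode (a, n)) = Some 0 \<and>
                  (\<forall>m<n. eval A f (prod_encode (a, m)) \<noteq> None))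
     in if \<exists>n. P n then Some (LEAST n. P n) else None)"

definition turing_le :: "nat set \<Rightarrow> nat set \<Rightarrow> bool" (infix "\<le>\<^sub>T" 50) where
  "A \<le>\<^sub>T B \<longleftrightarrow> (\<exists>p. \<forall>n. eval B p n = Some (of_bool (n \<in> A)))"

definition join :: "nat set \<Rightarrow> nat set \<Rightarrow> nat set" (infixr "\<oplus>\<^sub>T" 65) where
  "A \<oplus>\<^sub>T B = {2 * n | n. n \<in> A} \<union> {2 * n + 1 | n. n \<in> B}"

text \<open>A bijective Goedel numbering of programs.\<close>

primrec goedel :: "prog \<Rightarrow> nat" where
  "goedel Zero = 0"
| "goedel Succ = 1"
| "goedel ProjL = 2"
| "goedel ProjR = 3"
| "goedel Query = 4"
| "goedel (Tup f g) = 4 * prod_encode (goedel f, goedel g) + 5"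
| "goedel (Comp f g) = 4 * prod_encode (goedel f, goedel g) + 6"
| "goedel (PrimRec f g) = 4 * prod_encode (goedel f, goedel g) + 7"
| "goedel (Mu f) = 4 * goedel f + 8"

text \<open>
  The set \<open>\<emptyset>'\<close> of all \<open>e\<close> such that the \<open>e\<close>-th program, run with the empty oracle, halts on
  input \<open>e\<close>.
\<close>

definition halting :: "nat set" where
  "halting = {goedel p | p. eval {} p (goedel p) \<noteq> None}"

section \<open>Prefix-free complexity\<close>

text \<open>Bijective base-2 numeration, the least significant digit first.\<close>

primrec str_encode :: "bool list \<Rightarrow> nat" where
  "str_encode [] = 0"
| "str_encode (b # s) = 2 * str_encode s + (if b then 2 else 1)"

definition prefix_free_machine :: "(bool list \<Rightarrow> bool list option) \<Rightarrow> bool" where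
  "prefix_free_machine M \<longleftrightarrow>
     (\<exists>p. \<forall>s. eval {} p (str_encode s) = map_option str_encode (M s)) \<and>
     (\<forall>s\<in>dom M. \<forall>t\<in>dom M. prefix s t \<longrightarrow> s = t)"

text \<open>The complexity is \<open>\<infinity>\<close> for strings outside the range of the machine.\<close>

definition complexity :: "(bool list \<Rightarrow> bool list option) \<Rightarrow> bool list \<Rightarrow> enat" where
  "complexity M t = Inf {enat (length s) | s. M s = Some t}"

text \<open>
  Prefix-free Kolmogorov complexity \<open>K\<close> is \<open>complexity U\<close> for an optimal prefix-free machine \<open>U\<close>;
  it depends on the choice of \<open>U\<close> only up to an additive constant.
\<close>

definition optimal_machine :: "(bool list \<Rightarrow> bool list option) \<Rightarrow> bool" where
  "optimal_machine U \<longleftrightarrow> prefix_free_machine U \<and>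
     (\<forall>M. prefix_free_machine M \<longrightarrow>
        (\<exists>c::nat. \<forall>t. complexity U t \<le> complexity M t + enat c))"

definition initial_segment :: "nat set \<Rightarrow> nat \<Rightarrow> bool list" (infix "\<restriction>" 80) where
  "A \<restriction> n = map (\<lambda>i. i \<in> A) [0..<n]"

definition K_trivial :: "(bool list \<Rightarrow> bool list option) \<Rightarrow> nat set \<Rightarrow> bool" where
  "K_trivial U A \<longleftrightarrow>
     (\<exists>c::nat. \<forall>n. complexity U (A \<restriction> n) \<le> complexity U (replicate n True) + enat c)"

text \<open>The inequality \<open>K (R \<restriction> n) > n - c\<close>, free of truncated subtraction.\<close>

definition martin_loef_random :: "(bool list \<Rightarrow> bool list option) \<Rightarrow> nat set \<Rightarrow> bool" where
  "martin_loef_random U R \<longleftrightarrow> (\<exists>c::nat. \<forall>n. complexity U (R \<restriction> n) + enat c > enat n)"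

definition weakly_ML_cuppable :: "(bool list \<Rightarrow> bool list option) \<Rightarrow> nat set \<Rightarrow> bool" where
  "weakly_ML_cuppable U A \<longleftrightarrow>
     (\<exists>X. martin_loef_random U X \<and> \<not> halting \<le>\<^sub>T X \<and> halting \<le>\<^sub>T A \<oplus>\<^sub>T X)"

end

theory Submission
  imports Defs Complex_Main
begin

text \<open>
  The covering lemma: if \<open>A\<close> is K-trivial and a c.e. family of requests \<open>(\<tau>, r)\<close> has total weight \<open>\<Sum> 2\<^sup>-\<^sup>r \<le> 1\<close> along every
  set, then some c.e. subfamily of finite total weight contains all requests with \<open>\<tau>\<close> an initial segment of
  \<open>A\<close>. Otherwise a nested procedure (the decanter method) spends little weight on descriptions but makes the optimal machine
  describe, on each of many levels, new strings of the same weight, so that its domain gets measure above 1.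

  Suppose \<open>X\<close> is random, \<open>A \<oplus> X\<close> computes \<open>\<emptyset>'\<close> and \<open>X\<close> does not. Declare a bit \<open>(e, t, \<sigma>)\<close> killed if the oracles \<open>r\<close>
  above \<open>\<sigma>\<close> for which program \<open>e\<close> with oracle \<open>A \<oplus> r\<close> answers 0 on this bit have relative measure above \<open>1 - 2\<^sup>-\<^sup>t\<close>. By the
  covering lemma \<open>A \<oplus> X\<close> decides which bits are killed; let \<open>e\<close> be such a decision program. The oracles that make \<open>e\<close> err
  on a killed bit do not include \<open>X\<close>, and by the covering lemma they are, up to finitely many strings, part of a c.e. open
  set missing \<open>X\<close>. As \<open>X\<close> is random and incomplete, the density of this set at \<open>X\<close> is bounded away from 1 (Day and
  Miller), so for some \<open>t\<close> no bit \<open>(e, t, \<sigma>)\<close> with \<open>\<sigma>\<close> an initial segment of \<open>X\<close> is killed. Iterating \<open>\<sigma> \<mapsto> r\<close>, where \<open>r\<close> is a minimal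
  extension on which \<open>e\<close> answers 0 on \<open>(e, t, \<sigma>)\<close>, yields a tree with infinitely many initial segments of \<open>X\<close> whose generations
  shrink by the factor \<open>1 - 2\<^sup>-\<^sup>t\<close>. Its total weight is finite, so the covering lemma turns it into a Solovay test that
  captures \<open>X\<close>.
\<close>

text \<open>The obstacle is that \<open>A\<close> enters as an oracle, while randomness and
  incompleteness of \<open>X\<close> are plain notions: tests built from \<open>A\<close> have to
  become tests without oracle. The covering lemma does this at a price: weights must be bounded
  along every set and not just along \<open>A\<close>. Kills, errors and children are defined so
  that these bounds hold for any oracle. The killed bits form a self-defeating task. A kill happens
  when most oracles deny it, so each kill makes most oracles wrong, and each bit that survives
  confines the denials to relative measure at most \<open>1 - (1/2) ^ t\<close>. As the program is a
  component of the bit, the single set \<open>killed A\<close> challenges all programs at once, and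
  the program that decides it can be inserted afterwards, without the recursion theorem. That
  \<open>A\<close> and the halting set decide \<open>killed A\<close> is not obvious, since kills
  are c.e. only in \<open>A\<close>. The covering lemma leaves finitely many candidate strings per
  bit; the halting set tells when a list of candidates is complete, and \<open>A\<close> selects
  among them.\<close>

text \<open>
  Recoding by \<open>enc \<circ> dec\<close> sends junk codes to genuine ones; requiring it to be computable lets programs
  on codes ignore junk. All programs have to work uniformly in the oracle.
\<close>

class enc =
  fixes enc :: "'a \<Rightarrow> nat" and dec :: "nat \<Rightarrow> 'a"
  assumes dec_enc [simp]: "dec (enc x) = x"
    and enc_dec_program: "\<exists>p. \<forall>Z n. eval Z p n = Some (enc (dec n))"

lemma enc_inject [simp]: "enc x = enc y \<longleftrightarrow> x = y"
  by (metis dec_enc)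

section \<open>Computable functions between encoded types\<close>

definition computable :: "('a::enc \<Rightarrow> 'b::enc) \<Rightarrow> bool" where
  "computable f \<longleftrightarrow> (\<exists>p. \<forall>Z x. eval Z p (enc x) = Some (enc (f x)))"

named_theorems computable_intros

text \<open>Pairing the two projections re-encodes what \<open>prod_decode\<close> takes apart,
  which gives the identity.\<close>

abbreviation (input) Id_prog :: prog where "Id_prog \<equiv> Tup ProjL ProjR"

lemma eval_Id_prog: "eval Z Id_prog n = Some n"
  by simp

primrec Const_prog :: "nat \<Rightarrow> prog" where
  "Const_prog 0 = Zero"
| "Const_prog (Suc n) = Comp Succ (Const_prog n)"

lemma eval_Const_prog [simp]: "eval Z (Const_prog n) x = Some n"
  by (induction n) auto

lemma computable_id [computable_intros]: "computable (\<lambda>x. x)"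
  unfolding computable_def using eval_Id_prog by blast

lemma computable_const [computable_intros]: "computable (\<lambda>x. c)"
  unfolding computable_def using eval_Const_prog by blast

lemma computable_compose:
  assumes "computable f" "computable g" shows "computable (\<lambda>x. f (g x))"
proof -
  obtain p q where "\<forall>Z x. eval Z p (enc x) = Some (enc (f x))" "\<forall>Z x. eval Z q (enc x) = Some (enc (g x))"
    using assms unfolding computable_def by blast
  then have "\<forall>Z x. eval Z (Comp p q) (enc x) = Some (enc (f (g x)))" by simp
  then show ?thesis unfolding computable_def by blast
qed

instantiation nat :: enc begin
definition enc_nat :: "nat \<Rightarrow> nat" where [simp]: "enc_nat n = n"
definition dec_nat :: "nat \<Rightarrow> nat" where [simp]: "dec_nat n = n"
instance by standard (use eval_Id_prog in \<open>auto simp del: eval.simps\<close>)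
end

instantiation prod :: (enc, enc) enc begin
definition enc_prod :: "'a \<times> 'b \<Rightarrow> nat" where "enc_prod x = prod_encode (enc (fst x), enc (snd x))"
definition dec_prod :: "nat \<Rightarrow> 'a \<times> 'b" where "dec_prod n = map_prod dec dec (prod_decode n)"
instance
proof
  fix x :: "'a \<times> 'b"
  show "dec (enc x) = x" by (simp add: enc_prod_def dec_prod_def)
  obtain p q where p: "\<forall>Z n. eval Z p n = Some (enc (dec n :: 'a))"
    and q: "\<forall>Z n. eval Z q n = Some (enc (dec n :: 'b))"
    using enc_dec_program by meson
  have "\<forall>Z n. eval Z (Tup (Comp p ProjL) (Comp q ProjR)) n = Some (enc (dec n :: 'a \<times> 'b))"
    by (simp add: p q enc_prod_def dec_prod_def)
  then show "\<exists>p. \<forall>Z n. eval Z p n = Some (enc (dec n :: 'a \<times> 'b))" by blast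
qed
end

lemma enc_Pair [simp]: "enc (a, b) = prod_encode (enc a, enc b)"
  by (simp add: enc_prod_def)

lemma computable_Pair [computable_intros]:
  assumes "computable f" "computable g" shows "computable (\<lambda>x. (f x, g x))"
proof -
  obtain p q where "\<forall>Z x. eval Z p (enc x) = Some (enc (f x))" "\<forall>Z x. eval Z q (enc x) = Some (enc (g x))"
    using assms unfolding computable_def by blast
  then have "\<forall>Z x. eval Z (Tup p q) (enc x) = Some (enc (f x, g x))" by simp
  then show ?thesis unfolding computable_def by blast
qed

lemma computable_fst [computable_intros]: "computable f \<Longrightarrow> computable (\<lambda>x. fst (f x))"
  by (rule computable_compose[of fst f])
    (auto simp: computable_def enc_prod_def intro!: exI[of _ ProjL])

lemma computable_snd [computable_intros]: "computable f \<Longrightarrow> computable (\<lambda>x. snd (f x))"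
  by (rule computable_compose[of snd f])
    (auto simp: computable_def enc_prod_def intro!: exI[of _ ProjR])

lemma computable_compose2:
  assumes "computable (\<lambda>p. b (fst p) (snd p))" "computable f" "computable g"
  shows "computable (\<lambda>x. b (f x) (g x))"
  using computable_compose[OF assms(1) computable_Pair[OF assms(2,3)]] by simp

lemma computable_compose3:
  assumes "computable (\<lambda>p. b (fst p) (fst (snd p)) (snd (snd p)))"
    and "computable f" "computable g" "computable h"
  shows "computable (\<lambda>x. b (f x) (g x) (h x))"
  using computable_compose[OF assms(1) computable_Pair[OF assms(2) computable_Pair[OF assms(3,4)]]]
  by simp

text \<open>The argument \<open>x\<close> is passed along as the parameter of
  \<open>PrimRec\<close>, so bound, start value and step may all depend on it. The closure
  properties for arithmetic and lists below are reductions to this rule.\<close>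

lemma computable_rec_nat [computable_intros]:
  assumes "computable n" "computable a"
    and "computable (\<lambda>p. b (fst p) (fst (snd p)) (snd (snd p)))"
  shows "computable (\<lambda>x. rec_nat (a x) (b x) (n x))"
proof -
  obtain pn pa pb where pn: "\<forall>Z x. eval Z pn (enc x) = Some (enc (n x))"
    and pa: "\<forall>Z x. eval Z pa (enc x) = Some (enc (a x))"
    and pb: "\<forall>Z p. eval Z pb (enc p) = Some (enc (b (fst p) (fst (snd p)) (snd (snd p))))"
    using assms unfolding computable_def by blast
  have "rec_nat (eval Z pa (enc x))
       (\<lambda>k r. Option.bind r (\<lambda>y. eval Z pb (prod_encode (enc x, prod_encode (k, y))))) m
     = Some (enc (rec_nat (a x) (b x) m))" for Z x m
  proof (induction m)
    case (Suc m)
    then show ?case using pb[rule_format, of Z "(x, m, rec_nat (a x) (b x) m)"] by simp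
  qed (simp add: pa)
  then have "\<forall>Z x. eval Z (Comp (PrimRec pa pb) (Tup Id_prog pn)) (enc x)
      = Some (enc (rec_nat (a x) (b x) (n x)))"
    using pn by simp
  then show ?thesis unfolding computable_def by blast
qed

lemma computable_Suc [computable_intros]: "computable f \<Longrightarrow> computable (\<lambda>x. Suc (f x))"
  by (rule computable_compose[of Suc f]) (auto simp: computable_def intro!: exI[of _ Succ])

lemma computable_plus [computable_intros]:
  assumes "computable f" "computable g" shows "computable (\<lambda>x. f x + g x :: nat)"
proof -
  have "(a :: nat) + b = rec_nat a (\<lambda>_ r. Suc r) b" for a b by (induction b) auto
  \<comment> \<open>Inside the step function the argument is only a component of a tuple; the
    assumptions are therefore used in composed form.\<close>
  then show ?thesis by (simp only:) (intro computable_intros assms[THEN computable_compose])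
qed

lemma computable_times [computable_intros]:
  assumes "computable f" "computable g" shows "computable (\<lambda>x. f x * g x :: nat)"
proof -
  have "(a :: nat) * b = rec_nat 0 (\<lambda>_ r. r + a) b" for a b by (induction b) auto
  then show ?thesis by (simp only:) (intro computable_intros assms[THEN computable_compose])
qed

lemma computable_power [computable_intros]:
  assumes "computable f" "computable g" shows "computable (\<lambda>x. f x ^ g x :: nat)"
proof -
  have "(a :: nat) ^ b = rec_nat 1 (\<lambda>_ r. r * a) b" for a b by (induction b) auto
  then show ?thesis by (simp only:) (intro computable_intros assms[THEN computable_compose])
qed

lemma computable_minus [computable_intros]:
  assumes "computable f" "computable g" shows "computable (\<lambda>x. f x - g x :: nat)"
proof -
  \<comment> \<open>The predecessor is the recursion that returns its own counter; subtraction
    iterates it.\<close>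
  have p: "a - 1 = rec_nat 0 (\<lambda>k _. k) a" for a by (induction a) auto
  have "a - b = rec_nat a (\<lambda>_ r. rec_nat 0 (\<lambda>k _. k) r) b" for a b :: nat
  proof (induction b)
    case (Suc b)
    have "a - Suc b = (a - b) - 1" by simp
    then show ?case using Suc p by simp
  qed auto
  then show ?thesis by (simp only:) (intro computable_intros assms[THEN computable_compose])
qed

instantiation bool :: enc begin
definition enc_bool :: "bool \<Rightarrow> nat" where "enc_bool b = of_bool b"
definition dec_bool :: "nat \<Rightarrow> bool" where "dec_bool n \<longleftrightarrow> n \<noteq> 0"
instance
proof
  fix x :: bool show "dec (enc x) = x" by (simp add: enc_bool_def dec_bool_def)
  have "computable (\<lambda>n :: nat. rec_nat 0 (\<lambda>_ _. 1) n :: nat)" by (intro computable_intros)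
  moreover have "rec_nat 0 (\<lambda>_ _. 1) n = enc (dec n :: bool)" for n
    by (cases n) (auto simp: enc_bool_def dec_bool_def)
  ultimately show "\<exists>p. \<forall>Z n. eval Z p n = Some (enc (dec n :: bool))"
    by (simp add: computable_def)
qed
end

lemma computable_enc [computable_intros]: "computable f \<Longrightarrow> computable (\<lambda>x. enc (f x))"
  unfolding computable_def by simp

lemma computable_of_enc: "computable (\<lambda>x. enc (f x)) \<Longrightarrow> computable f"
  unfolding computable_def by simp

lemma computable_dec [computable_intros]: "computable f \<Longrightarrow> computable (\<lambda>x. dec (f x))"
  by (rule computable_compose[of dec f]) (use enc_dec_program in \<open>auto simp: computable_def\<close>)

lemma computable_if [computable_intros]:
  assumes "computable c" "computable f" "computable g"
  shows "computable (\<lambda>x. if c x then f x else g x)"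
proof -
  have "(if b then u else v) = rec_nat v (\<lambda>_ _. u) (enc b)" for b and u v :: 'b
    by (simp add: enc_bool_def)
  then show ?thesis by (simp only:) (intro computable_intros assms[THEN computable_compose])
qed

lemma computable_not [computable_intros]:
  assumes "computable P" shows "computable (\<lambda>x. \<not> P x)"
proof -
  have "(\<not> b) = (if b then False else True)" for b by simp
  then show ?thesis by (simp only:) (intro computable_intros assms[THEN computable_compose])
qed

lemma computable_conj [computable_intros]:
  assumes "computable P" "computable Q" shows "computable (\<lambda>x. P x \<and> Q x)"
proof -
  have "(b \<and> c) = (if b then c else False)" for b c by simp
  then show ?thesis by (simp only:) (intro computable_intros assms[THEN computable_compose])
qed

lemma computable_disj [computable_intros]:
  assumes "computable P" "computable Q" shows "computable (\<lambda>x. P x \<or> Q x)"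
proof -
  have "(b \<or> c) = (if b then True else c)" for b c by simp
  then show ?thesis by (simp only:) (intro computable_intros assms[THEN computable_compose])
qed

lemma computable_imp [computable_intros]:
  assumes "computable P" "computable Q" shows "computable (\<lambda>x. P x \<longrightarrow> Q x)"
  unfolding imp_conv_disj by (intro computable_intros assms[THEN computable_compose])

lemma computable_le [computable_intros]:
  assumes "computable f" "computable g" shows "computable (\<lambda>x. f x \<le> (g x :: nat))"
proof -
  have "a \<le> b \<longleftrightarrow> \<not> dec (a - b)" for a b :: nat by (auto simp: dec_bool_def)
  then show ?thesis by (simp only:) (intro computable_intros assms[THEN computable_compose])
qed

lemma computable_less [computable_intros]:
  assumes "computable f" "computable g" shows "computable (\<lambda>x. f x < (g x :: nat))"
  unfolding less_eq_Suc_le by (intro computable_intros assms[THEN computable_compose])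

lemma computable_eq [computable_intros]:
  fixes f g :: "'a::enc \<Rightarrow> 'b::enc"
  assumes "computable f" "computable g" shows "computable (\<lambda>x. f x = g x)"
proof -
  have "a = b \<longleftrightarrow> enc a \<le> enc b \<and> enc b \<le> enc a" for a b :: 'b
    by (metis antisym enc_inject order_refl)
  then show ?thesis by (simp only:) (intro computable_intros assms[THEN computable_compose])
qed

lemma computable_bex_less [computable_intros]:
  fixes n :: "'a::enc \<Rightarrow> nat"
  assumes "computable (\<lambda>p. P (fst p) (snd p))" "computable n"
  shows "computable (\<lambda>x. \<exists>k<n x. P x k)"
proof -
  have "(\<exists>k<m. P x k) = rec_nat False (\<lambda>k r. r \<or> P x k) m" for x and m :: nat
    by (induction m) (auto simp: less_Suc_eq)
  then show ?thesis
    by (simp only:)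
      (intro computable_intros assms(2)[THEN computable_compose] assms(1)[THEN computable_compose2])
qed

lemma computable_ball_less [computable_intros]:
  fixes n :: "'a::enc \<Rightarrow> nat"
  assumes "computable (\<lambda>p. P (fst p) (snd p))" "computable n"
  shows "computable (\<lambda>x. \<forall>k<n x. P x k)"
proof -
  have "(\<forall>k<n x. P x k) = (\<not> (\<exists>k<n x. \<not> P x k))" for x by blast
  then show ?thesis
    by (simp only:)
      (intro computable_intros assms(2)[THEN computable_compose] assms(1)[THEN computable_compose2])
qed

lemma computable_mod2 [computable_intros]:
  assumes "computable f" shows "computable (\<lambda>x. f x mod 2 :: nat)"
proof -
  have "n mod 2 = rec_nat 0 (\<lambda>_ r. 1 - r) n" for n :: nat
    by (induction n) (auto simp: mod_Suc)
  then show ?thesis by (simp only:) (intro computable_intros assms[THEN computable_compose])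
qed

lemma computable_div2 [computable_intros]:
  assumes "computable f" shows "computable (\<lambda>x. f x div 2 :: nat)"
proof -
  have "n div 2 = rec_nat 0 (\<lambda>k r. r + k mod 2) n" for n :: nat
  proof (induction n)
    case (Suc n)
    have "Suc n div 2 = n div 2 + n mod 2" by presburger
    then show ?case using Suc by simp
  qed auto
  then show ?thesis by (simp only:) (intro computable_intros assms[THEN computable_compose])
qed

lemma computable_prod_encode [computable_intros]:
  "computable f \<Longrightarrow> computable (\<lambda>x. prod_encode (f x))"
  by (rule computable_compose[of prod_encode f])
    (use eval_Id_prog in \<open>auto simp: computable_def enc_prod_def simp del: eval.simps\<close>)

lemma computable_prod_decode [computable_intros]:
  "computable f \<Longrightarrow> computable (\<lambda>x. prod_decode (f x))"
  by (rule computable_compose[of prod_decode f])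
    (use eval_Id_prog in \<open>auto simp: computable_def enc_prod_def simp del: eval.simps\<close>)

section \<open>Encodings of options and lists, and computable list functions\<close>

instantiation option :: (enc) enc begin
definition enc_option :: "'a option \<Rightarrow> nat" where
  "enc_option x = (case x of None \<Rightarrow> 0 | Some y \<Rightarrow> Suc (enc y))"
definition dec_option :: "nat \<Rightarrow> 'a option" where
  "dec_option n = (case n of 0 \<Rightarrow> None | Suc m \<Rightarrow> Some (dec m))"
instance
proof
  fix x :: "'a option"
  show "dec (enc x) = x" by (cases x) (simp_all add: enc_option_def dec_option_def)
  have "computable (\<lambda>n. rec_nat 0 (\<lambda>k _. Suc (enc (dec k :: 'a))) n)" by (intro computable_intros)
  moreover have "rec_nat 0 (\<lambda>k _. Suc (enc (dec k :: 'a))) n = enc (dec n :: 'a option)" for n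
    by (cases n) (auto simp: enc_option_def dec_option_def)
  ultimately show "\<exists>p. \<forall>Z n. eval Z p n = Some (enc (dec n :: 'a option))"
    by (simp add: computable_def)
qed
end

lemma computable_Some [computable_intros]: "computable f \<Longrightarrow> computable (\<lambda>x. Some (f x))"
  by (rule computable_of_enc) (simp add: enc_option_def computable_intros)

lemma computable_case_option [computable_intros]:
  assumes "computable z" "computable a" "computable (\<lambda>p. b (fst p) (snd p))"
  shows "computable (\<lambda>x. case z x of None \<Rightarrow> a x | Some y \<Rightarrow> b x y)"
proof -
  have *: "(case z x of None \<Rightarrow> a x | Some y \<Rightarrow> b x y)
      = rec_nat (a x) (\<lambda>k _. b x (dec k)) (enc (z x))" for x
    by (cases "z x") (auto simp: enc_option_def)
  show ?thesis unfolding *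
    by (intro computable_intros assms(1,2)[THEN computable_compose] assms(3)[THEN computable_compose2])
qed

text \<open>Lists become an instance of \<open>enc\<close> only after recoding of list codes is
  known to be computable, so this works on raw codes: one step moves the head of \<open>n\<close>,
  transformed by \<open>c\<close>, onto \<open>acc\<close>.\<close>

primrec map_step :: "(nat \<Rightarrow> nat) \<Rightarrow> nat \<times> nat \<Rightarrow> nat \<times> nat" where
  "map_step c (n, acc) = (case n of 0 \<Rightarrow> (0, acc) | Suc m \<Rightarrow>
     (snd (prod_decode m), Suc (prod_encode (c (fst (prod_decode m)), acc))))"

text \<open>A list is no longer than its code, so \<open>n\<close> rounds exhaust it.\<close>

definition rev_map_code :: "(nat \<Rightarrow> nat) \<Rightarrow> nat \<Rightarrow> nat" where
  "rev_map_code c n = snd (rec_nat (n, 0) (\<lambda>_. map_step c) n)"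

lemma length_le_list_encode: "length xs \<le> list_encode xs"
proof (induction xs)
  case (Cons x xs)
  then show ?case using le_prod_encode_2[of "list_encode xs" x] by simp
qed simp

lemma rec_map_step:
  "rec_nat (list_encode xs, list_encode ys) (\<lambda>_. map_step c) m
    = (list_encode (drop m xs), list_encode (rev (map c (take m xs)) @ ys))"
proof (induction m)
  case (Suc m)
  show ?case
  proof (cases "drop m xs")
    case Nil
    then have "length xs \<le> m" by simp
    then show ?thesis using Suc by simp
  next
    case (Cons z zs)
    then have m: "m < length xs" by (metis drop_eq_Nil list.discI not_le)
    then have "z = xs ! m" "drop (Suc m) xs = zs"
      using Cons by (auto simp: Cons_nth_drop_Suc[symmetric])
    then show ?thesis using Suc Cons m by (simp add: take_Suc_conv_app_nth)
  qed
qed simp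

lemma rev_map_code: "rev_map_code c n = list_encode (rev (map c (list_decode n)))"
proof -
  have "rec_nat (list_encode (list_decode n), list_encode []) (\<lambda>_. map_step c) n
    = (list_encode (drop n (list_decode n)), list_encode (rev (map c (take n (list_decode n))) @ []))"
    by (rule rec_map_step)
  moreover have "length (list_decode n) \<le> n"
    using length_le_list_encode[of "list_decode n"] by simp
  ultimately show ?thesis by (simp add: rev_map_code_def)
qed

lemma computable_case_nat:
  assumes "computable n" "computable a" "computable (\<lambda>p. b (fst p) (snd p))"
  shows "computable (\<lambda>x. case n x of 0 \<Rightarrow> a x | Suc m \<Rightarrow> b x m)"
proof -
  have "(case n x of 0 \<Rightarrow> a x | Suc m \<Rightarrow> b x m) = rec_nat (a x) (\<lambda>k _. b x k) (n x)" for x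
    by (cases "n x") auto
  then show ?thesis
    by (simp only:) (intro computable_intros assms(1,2)[THEN computable_compose]
      assms(3)[THEN computable_compose2])
qed

lemma computable_rev_map_code:
  assumes "computable c" shows "computable (rev_map_code c)"
proof -
  have *: "map_step c st = (case fst st of 0 \<Rightarrow> (0, snd st) | Suc m \<Rightarrow>
     (snd (prod_decode m), Suc (prod_encode (c (fst (prod_decode m)), snd st))))" for st
    by (cases st) (simp split: nat.split)
  show ?thesis
    unfolding rev_map_code_def *
    by (intro computable_intros computable_case_nat assms[THEN computable_compose])
qed

instantiation list :: (enc) enc begin
definition enc_list :: "'a list \<Rightarrow> nat" where "enc_list xs = list_encode (map enc xs)"
definition dec_list :: "nat \<Rightarrow> 'a list" where "dec_list n = map dec (list_decode n)"
instance
proof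
  fix x :: "'a list"
  show "dec (enc x) = x" by (simp add: enc_list_def dec_list_def o_def)
  \<comment> \<open>The first pass recodes the entries but reverses the list; the second pass
    restores the order.\<close>
  have "computable (\<lambda>n. rev_map_code (\<lambda>k. k) (rev_map_code (\<lambda>k. enc (dec k :: 'a)) n))"
    by (intro computable_rev_map_code[THEN computable_compose] computable_intros)
  then show "\<exists>p. \<forall>Z n. eval Z p n = Some (enc (dec n :: 'a list))"
    by (simp add: computable_def rev_map_code rev_map enc_list_def dec_list_def o_def)
qed
end

lemma enc_Cons: "enc (x # xs) = Suc (prod_encode (enc x, enc xs))"
  and enc_Nil: "enc [] = 0"
  by (simp_all add: enc_list_def)

lemma length_le_enc: "length xs \<le> enc xs"
  using length_le_list_encode[of "map enc xs"] by (simp add: enc_list_def)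

lemma computable_Cons [computable_intros]:
  "computable f \<Longrightarrow> computable g \<Longrightarrow> computable (\<lambda>x. f x # g x)"
  by (rule computable_of_enc) (simp add: enc_Cons computable_intros)

lemma computable_case_list [computable_intros]:
  assumes "computable z" "computable a" "computable (\<lambda>p. b (fst p) (fst (snd p)) (snd (snd p)))"
  shows "computable (\<lambda>x. case z x of [] \<Rightarrow> a x | y # ys \<Rightarrow> b x y ys)"
proof -
  have *: "(case z x of [] \<Rightarrow> a x | y # ys \<Rightarrow> b x y ys)
     = (case enc (z x) of 0 \<Rightarrow> a x | Suc m \<Rightarrow>
          b x (dec (fst (prod_decode m))) (dec (snd (prod_decode m))))" for x
    by (cases "z x") (auto simp: enc_Cons enc_Nil)
  show ?thesis unfolding *
    by (intro computable_intros computable_case_nat assms(1,2)[THEN computable_compose]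
        assms(3)[THEN computable_compose3])
qed

lemma rec_nat_foldl:
  "rec_nat (s, xs) (\<lambda>_ st. case snd st of [] \<Rightarrow> st | y # ys \<Rightarrow> (f (fst st) y, ys)) m
    = (foldl f s (take m xs), drop m xs)"
proof (induction m)
  case (Suc m)
  show ?case
  proof (cases "drop m xs")
    case Nil
    then show ?thesis using Suc by simp
  next
    case (Cons z zs)
    then have m: "m < length xs" by (metis drop_eq_Nil list.discI not_le)
    then have "z = xs ! m" "drop (Suc m) xs = zs"
      using Cons by (auto simp: Cons_nth_drop_Suc[symmetric])
    then show ?thesis using Suc Cons m by (simp add: take_Suc_conv_app_nth)
  qed
qed simp

lemma computable_foldl [computable_intros]:
  assumes "computable (\<lambda>p. f (fst p) (fst (snd p)) (snd (snd p)))" "computable s" "computable xs"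
  shows "computable (\<lambda>x. foldl (f x) (s x) (xs x))"
proof -
  \<comment> \<open>The code of the list bounds its length, and rounds after the list is used up
    leave the state unchanged.\<close>
  have *: "foldl (f x) (s x) (xs x) = fst (rec_nat (s x, xs x)
     (\<lambda>_ st. case snd st of [] \<Rightarrow> st | y # ys \<Rightarrow> (f x (fst st) y, ys)) (enc (xs x)))" for x
    by (simp add: rec_nat_foldl length_le_enc)
  show ?thesis unfolding *
    by (intro computable_intros assms(2,3)[THEN computable_compose] assms(1)[THEN computable_compose3])
qed

lemma computable_rev [computable_intros]:
  assumes "computable xs" shows "computable (\<lambda>x. rev (xs x))"
proof -
  have *: "rev zs = foldl (\<lambda>acc y. y # acc) [] zs" for zs :: "'z list"
    by (induction zs rule: rev_induct) auto
  show ?thesis unfolding * by (intro computable_intros assms)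
qed

lemma computable_foldr [computable_intros]:
  assumes "computable (\<lambda>p. f (fst p) (fst (snd p)) (snd (snd p)))" "computable s" "computable xs"
  shows "computable (\<lambda>x. foldr (f x) (xs x) (s x))"
  unfolding foldr_conv_foldl
  by (intro computable_intros assms(2,3)[THEN computable_compose] assms(1)[THEN computable_compose3])

lemma computable_append [computable_intros]:
  assumes "computable f" "computable g" shows "computable (\<lambda>x. f x @ g x)"
proof -
  have *: "xs @ ys = foldr Cons xs ys" for xs ys :: "'z list"
    by (induction xs) auto
  show ?thesis unfolding * by (intro computable_intros assms[THEN computable_compose])
qed

lemma computable_map [computable_intros]:
  assumes "computable (\<lambda>p. f (fst p) (snd p))" "computable xs"
  shows "computable (\<lambda>x. map (f x) (xs x))"
proof -
  have *: "map h zs = foldr (\<lambda>y acc. h y # acc) zs []" for h and zs :: "'z list"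
    by (induction zs) auto
  show ?thesis unfolding *
    by (intro computable_intros assms(2)[THEN computable_compose] assms(1)[THEN computable_compose2])
qed

lemma computable_filter [computable_intros]:
  assumes "computable (\<lambda>p. f (fst p) (snd p))" "computable xs"
  shows "computable (\<lambda>x. filter (f x) (xs x))"
proof -
  have *: "filter h zs = foldr (\<lambda>y acc. if h y then y # acc else acc) zs []" for h and zs :: "'z list"
    by (induction zs) auto
  show ?thesis unfolding *
    by (intro computable_intros assms(2)[THEN computable_compose] assms(1)[THEN computable_compose2])
qed

lemma computable_length [computable_intros]:
  assumes "computable xs" shows "computable (\<lambda>x. length (xs x))"
proof -
  have *: "length zs = foldr (\<lambda>y acc. Suc acc) zs 0" for zs :: "'z list"
    by (induction zs) auto
  show ?thesis unfolding * by (intro computable_intros assms[THEN computable_compose])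
qed

lemma computable_sum_list [computable_intros]:
  assumes "computable xs" shows "computable (\<lambda>x. sum_list (xs x) :: nat)"
proof -
  have *: "sum_list zs = foldr (\<lambda>y acc. y + acc) zs 0" for zs :: "nat list"
    by (induction zs) auto
  show ?thesis unfolding * by (intro computable_intros assms[THEN computable_compose])
qed

lemma computable_ball_set [computable_intros]:
  assumes "computable (\<lambda>p. f (fst p) (snd p))" "computable xs"
  shows "computable (\<lambda>x. \<forall>y\<in>set (xs x). f x y)"
proof -
  have *: "(\<forall>y\<in>set zs. h y) = foldr (\<lambda>y acc. h y \<and> acc) zs True" for h and zs :: "'z list"
    by (induction zs) auto
  show ?thesis unfolding *
    by (intro computable_intros assms(2)[THEN computable_compose] assms(1)[THEN computable_compose2])
qed

lemma computable_bex_set [computable_intros]: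
  assumes "computable (\<lambda>p. f (fst p) (snd p))" "computable xs"
  shows "computable (\<lambda>x. \<exists>y\<in>set (xs x). f x y)"
proof -
  have *: "(\<exists>y\<in>set zs. h y) = foldr (\<lambda>y acc. h y \<or> acc) zs False" for h and zs :: "'z list"
    by (induction zs) auto
  show ?thesis unfolding *
    by (intro computable_intros assms(2)[THEN computable_compose] assms(1)[THEN computable_compose2])
qed

lemma computable_member [computable_intros]:
  assumes "computable f" "computable xs"
  shows "computable (\<lambda>x. f x \<in> set (xs x))"
proof -
  have *: "(f x \<in> set (xs x)) = (\<exists>y\<in>set (xs x). y = f x)" for x by blast
  show ?thesis unfolding * by (intro computable_intros assms[THEN computable_compose])
qed

lemma computable_tl [computable_intros]:
  assumes "computable xs" shows "computable (\<lambda>x. tl (xs x))"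
proof -
  have *: "tl zs = (case zs of [] \<Rightarrow> [] | y # ys \<Rightarrow> ys)" for zs :: "'z list"
    by (cases zs) auto
  show ?thesis unfolding * by (intro computable_intros assms[THEN computable_compose])
qed

lemma computable_drop [computable_intros]:
  assumes "computable n" "computable xs" shows "computable (\<lambda>x. drop (n x) (xs x))"
proof -
  have *: "drop n zs = rec_nat zs (\<lambda>_ r. tl r) n" for n and zs :: "'z list"
    by (induction n) (simp_all add: drop_Suc tl_drop[symmetric])
  show ?thesis unfolding * by (intro computable_intros assms[THEN computable_compose])
qed

lemma computable_take [computable_intros]:
  assumes "computable n" "computable xs" shows "computable (\<lambda>x. take (n x) (xs x))"
proof -
  have *: "take n zs = rev (drop (length zs - n) (rev zs))" for n and zs :: "'z list"
    by (cases "n \<le> length zs") (simp_all add: rev_drop)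
  show ?thesis unfolding * by (intro computable_intros assms[THEN computable_compose])
qed

lemma computable_prefix [computable_intros]:
  assumes "computable f" "computable g" shows "computable (\<lambda>x. prefix (f x) (g x))"
proof -
  have *: "prefix xs ys \<longleftrightarrow> take (length xs) ys = xs" for xs ys :: "'z list"
    by (metis append_eq_conv_conj prefix_def take_is_prefix)
  show ?thesis unfolding * by (intro computable_intros assms[THEN computable_compose])
qed

lemma computable_upt [computable_intros]:
  assumes "computable n" shows "computable (\<lambda>x. [0..<n x])"
proof -
  have *: "[0..<n] = rec_nat [] (\<lambda>k r. r @ [k]) n" for n
    by (induction n) auto
  show ?thesis unfolding * by (intro computable_intros assms[THEN computable_compose])
qed

lemma computable_replicate [computable_intros]:
  assumes "computable n" "computable a" shows "computable (\<lambda>x. replicate (n x) (a x))"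
proof -
  have *: "replicate n z = rec_nat [] (\<lambda>_ r. z # r) n" for n and z :: 'c
    by (induction n) auto
  show ?thesis unfolding * by (intro computable_intros assms[THEN computable_compose])
qed

text \<open>Filtering this list is how measure at a finite level is counted by a program.\<close>

primrec strings :: "nat \<Rightarrow> bool list list" where
  "strings 0 = [[]]"
| "strings (Suc n) = map (Cons False) (strings n) @ map (Cons True) (strings n)"

lemma set_strings: "set (strings n) = {s. length s = n}"
proof (induction n)
  case (Suc n)
  have "s \<in> set (strings (Suc n)) \<longleftrightarrow> length s = Suc n" for s
    by (cases s) (auto simp: Suc image_iff)
  then show ?case by blast
qed auto

lemma distinct_strings: "distinct (strings n)"
  by (induction n) (auto simp: distinct_map)

lemma computable_strings [computable_intros]:
  assumes "computable n" shows "computable (\<lambda>x. strings (n x))"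
proof -
  have *: "strings n = rec_nat [[]] (\<lambda>_ r. map (Cons False) r @ map (Cons True) r) n" for n
    by (induction n) auto
  show ?thesis unfolding * by (intro computable_intros assms[THEN computable_compose])
qed

lemma computable_str_encode [computable_intros]:
  assumes "computable s" shows "computable (\<lambda>x. str_encode (s x))"
proof -
  have *: "str_encode s = foldr (\<lambda>b r. 2 * r + (if b then 2 else 1)) s 0" for s
    by (induction s) auto
  show ?thesis unfolding * by (intro computable_intros assms[THEN computable_compose])
qed

subsection \<open>Computably enumerable predicates\<close>

definition ce :: "('a::enc \<Rightarrow> bool) \<Rightarrow> bool" where
  "ce P \<longleftrightarrow> (\<exists>D. computable D \<and> (\<forall>x. P x \<longleftrightarrow> (\<exists>n::nat. D (x, n))))"

lemma ceI:
  assumes "computable (\<lambda>p. D (fst p) (snd p))" "\<And>x. P x \<longleftrightarrow> (\<exists>n::nat. D x n)"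
  shows "ce P"
  unfolding ce_def using assms by (intro exI[of _ "\<lambda>p. D (fst p) (snd p)"]) auto

lemma ceE:
  assumes "ce P"
  obtains D where "computable (\<lambda>p. D (fst p) (snd p))" "\<And>x. P x \<longleftrightarrow> (\<exists>n::nat. D x n)"
proof -
  from assms obtain D where "computable D" "\<forall>x. P x \<longleftrightarrow> (\<exists>n::nat. D (x, n))"
    unfolding ce_def by blast
  then show ?thesis by (intro that[of "\<lambda>x n. D (x, n)"]) auto
qed

lemma ce_computable: "computable P \<Longrightarrow> ce P"
  by (rule ceI[of "\<lambda>x n. P x"]) (simp_all add: computable_compose computable_fst computable_id)

lemma ce_compose:
  assumes "ce P" "computable f" shows "ce (\<lambda>x. P (f x))"
proof -
  from assms obtain D where D: "computable (\<lambda>p. D (fst p) (snd p))" "\<And>x. P x \<longleftrightarrow> (\<exists>n::nat. D x n)"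
    by (elim ceE) blast
  show ?thesis
    by (rule ceI[of "\<lambda>x n. D (f x) n"])
      (auto simp: D(2) intro!: D(1)[THEN computable_compose2] computable_intros assms(2)[THEN computable_compose])
qed

lemma ce_ex:
  assumes "ce (\<lambda>p. P (fst p) (snd p))" shows "ce (\<lambda>x. \<exists>y. P x y)"
proof -
  from assms obtain D where D: "computable (\<lambda>p. D (fst p) (snd p))"
    "\<And>p. P (fst p) (snd p) \<longleftrightarrow> (\<exists>n::nat. D p n)"
    by (elim ceE) blast
  \<comment> \<open>One number codes the witness together with the stage that certifies it; since
    \<open>dec\<close> is total, every number yields a candidate.\<close>
  have "(\<exists>y. P x y) \<longleftrightarrow> (\<exists>n. D (x, dec (fst (prod_decode n))) (snd (prod_decode n)))" for x
  proof
    assume "\<exists>y. P x y"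
    then obtain y n where "D (x, y) n" using D(2)[of "(x, _)"] by auto
    then show "\<exists>n. D (x, dec (fst (prod_decode n))) (snd (prod_decode n))"
      by (intro exI[of _ "prod_encode (enc y, n)"]) simp
  qed (use D(2)[of "(x, _)"] in auto)
  then show ?thesis
    by (intro ceI[of "\<lambda>x n. D (x, dec (fst (prod_decode n))) (snd (prod_decode n))"])
      (intro D(1)[THEN computable_compose2] computable_intros)
qed

lemma ce_conj:
  assumes "ce P" "ce Q" shows "ce (\<lambda>x. P x \<and> Q x)"
proof -
  from assms obtain D E where D: "computable (\<lambda>p. D (fst p) (snd p))" "\<And>x. P x \<longleftrightarrow> (\<exists>n::nat. D x n)"
    and E: "computable (\<lambda>p. E (fst p) (snd p))" "\<And>x. Q x \<longleftrightarrow> (\<exists>n::nat. E x n)"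
    by (elim ceE) blast
  have "P x \<and> Q x \<longleftrightarrow> (\<exists>n. D x (fst (prod_decode n)) \<and> E x (snd (prod_decode n)))" for x
    unfolding D(2) E(2) by (metis fst_conv snd_conv prod_encode_inverse)
  then show ?thesis
    by (intro ceI[of "\<lambda>x n. D x (fst (prod_decode n)) \<and> E x (snd (prod_decode n))"])
      (intro D(1)[THEN computable_compose2] E(1)[THEN computable_compose2] computable_intros)
qed

lemma ce_disj:
  assumes "ce P" "ce Q" shows "ce (\<lambda>x. P x \<or> Q x)"
proof -
  from assms obtain D E where D: "computable (\<lambda>p. D (fst p) (snd p))" "\<And>x. P x \<longleftrightarrow> (\<exists>n::nat. D x n)"
    and E: "computable (\<lambda>p. E (fst p) (snd p))" "\<And>x. Q x \<longleftrightarrow> (\<exists>n::nat. E x n)"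
    by (elim ceE) blast
  show ?thesis
    by (intro ceI[of "\<lambda>x n. D x n \<or> E x n"])
      (auto simp: D(2) E(2) intro!: D(1) E(1) computable_intros)
qed

text \<open>Finitely many searches that all succeed do so below a common bound, which turns the
  quantifier prefix into one search.\<close>

lemma ce_ball_less:
  assumes "ce (\<lambda>p. P (fst p) (snd p))" "computable (m :: _ \<Rightarrow> nat)"
  shows "ce (\<lambda>x. \<forall>k<m x. P x k)"
proof -
  from assms obtain D where D: "computable (\<lambda>p. D (fst p) (snd p))"
    "\<And>p. P (fst p) (snd p) \<longleftrightarrow> (\<exists>n::nat. D p n)"
    by (elim ceE) blast
  have "(\<forall>k<m x. P x k) \<longleftrightarrow> (\<exists>b. \<forall>k<m x. \<exists>n<b. D (x, k) n)" for x
  proof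
    assume "\<forall>k<m x. P x k"
    then have "\<forall>k. \<exists>n. k < m x \<longrightarrow> D (x, k) n" using D(2)[of "(x, _)"] by auto
    then obtain f where f: "\<And>k. k < m x \<Longrightarrow> D (x, k) (f k)" by metis
    show "\<exists>b. \<forall>k<m x. \<exists>n<b. D (x, k) n"
    proof (intro exI allI impI)
      fix k assume "k < m x"
      then show "f k < Suc (Max (f ` {..<m x})) \<and> D (x, k) (f k)"
        using f by (auto simp: less_Suc_eq_le)
    qed
  qed (use D(2)[of "(x, _)"] in auto)
  then show ?thesis
    by (intro ceI[of "\<lambda>x b. \<forall>k<m x. \<exists>n<b. D (x, k) n"])
      (intro D(1)[THEN computable_compose2] computable_intros assms(2)[THEN computable_compose])
qed

lemma ce_ball_set:
  assumes "ce (\<lambda>p. P (fst p) (snd p))" "computable xs"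
  shows "ce (\<lambda>x. \<forall>y\<in>set (xs x). P x y)"
proof -
  from assms obtain D where D: "computable (\<lambda>p. D (fst p) (snd p))"
    "\<And>p. P (fst p) (snd p) \<longleftrightarrow> (\<exists>n::nat. D p n)"
    by (elim ceE) blast
  have "(\<forall>y\<in>set (xs x). P x y) \<longleftrightarrow> (\<exists>b. \<forall>y\<in>set (xs x). \<exists>n<b. D (x, y) n)" for x
  proof
    assume "\<forall>y\<in>set (xs x). P x y"
    then have "\<forall>y. \<exists>n. y \<in> set (xs x) \<longrightarrow> D (x, y) n" using D(2)[of "(x, _)"] by auto
    then obtain f where f: "\<And>y. y \<in> set (xs x) \<Longrightarrow> D (x, y) (f y)" by metis
    show "\<exists>b. \<forall>y\<in>set (xs x). \<exists>n<b. D (x, y) n"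
    proof (intro exI ballI)
      fix y assume "y \<in> set (xs x)"
      then show "f y < Suc (Max (f ` set (xs x))) \<and> D (x, y) (f y)"
        using f by (auto simp: less_Suc_eq_le)
    qed
  qed (use D(2)[of "(x, _)"] in auto)
  then show ?thesis
    by (intro ceI[of "\<lambda>x b. \<forall>y\<in>set (xs x). \<exists>n<b. D (x, y) n"])
      (intro D(1)[THEN computable_compose2] computable_intros assms(2)[THEN computable_compose])
qed

lemma ce_bex_set:
  assumes "ce (\<lambda>p. P (fst p) (snd p))" "computable xs"
  shows "ce (\<lambda>x. \<exists>y\<in>set (xs x). P x y)"
  unfolding Bex_def
  by (intro ce_ex ce_conj assms(1) ce_computable computable_intros assms(2)[THEN computable_compose])

lemmas ce_intros = ce_ex ce_conj ce_disj ce_ball_less ce_ball_set ce_bex_set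

text \<open>The value \<open>None\<close> lets the enumeration idle, so it is total even if
  \<open>P\<close> is empty.\<close>

lemma ce_enumeration:
  assumes "ce P"
  obtains f :: "nat \<Rightarrow> 'a::enc option" where "computable f" "\<And>x. P x \<longleftrightarrow> (\<exists>n. f n = Some x)"
proof -
  from assms obtain D where D: "computable (\<lambda>p. D (fst p) (snd p))" "\<And>x. P x \<longleftrightarrow> (\<exists>n::nat. D x n)"
    by (elim ceE) blast
  define f where "f n = (if D (dec (fst (prod_decode n))) (snd (prod_decode n))
      then Some (dec (fst (prod_decode n)) :: 'a) else None)" for n
  show thesis
  proof
    show "computable f" unfolding f_def
      by (intro D(1)[THEN computable_compose2] computable_intros)
    show "P x \<longleftrightarrow> (\<exists>n. f n = Some x)" for x
    proof
      assume "P x"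
      then obtain n where "D x n" using D(2) by auto
      then show "\<exists>n. f n = Some x"
        by (intro exI[of _ "prod_encode (enc x, n)"]) (simp add: f_def)
    qed (auto simp: f_def D(2) split: if_splits)
  qed
qed

section \<open>Least fixed points of c.e. rules\<close>

inductive closure :: "('a list \<times> 'a \<Rightarrow> bool) \<Rightarrow> 'a \<Rightarrow> bool" for R where
  closureI: "R (ys, x) \<Longrightarrow> \<forall>y\<in>set ys. closure R y \<Longrightarrow> closure R x"

text \<open>A formal proof with conclusions in front of their premises. The entry at
  \<open>i\<close> is written as a one-element sublist, a form built from operations already known
  to be computable.\<close>

definition derivation :: "('a list \<times> 'a \<Rightarrow> bool) \<Rightarrow> 'a list \<Rightarrow> bool" where
  "derivation R zs \<longleftrightarrow> (\<forall>i<length zs. \<exists>ys. (\<forall>y\<in>set ys. y \<in> set (drop (Suc i) zs)) \<and>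
     (\<forall>x\<in>set (take (Suc 0) (drop i zs)). R (ys, x)))"

lemma take_Suc_0_drop: "i < length zs \<Longrightarrow> take (Suc 0) (drop i zs) = [zs ! i]"
  by (simp add: Cons_nth_drop_Suc[symmetric])

lemma derivation_append:
  assumes "derivation R xs" "derivation R ys" shows "derivation R (xs @ ys)"
  unfolding derivation_def
proof (intro allI impI)
  fix i assume i: "i < length (xs @ ys)"
  show "\<exists>us. (\<forall>y\<in>set us. y \<in> set (drop (Suc i) (xs @ ys))) \<and>
     (\<forall>x\<in>set (take (Suc 0) (drop i (xs @ ys))). R (us, x))"
  proof (cases "i < length xs")
    case True
    with assms(1) obtain us where "\<forall>y\<in>set us. y \<in> set (drop (Suc i) xs)" "R (us, xs ! i)"
      unfolding derivation_def by (auto simp: take_Suc_0_drop)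
    then show ?thesis using i True
      by (intro exI[of _ us]) (auto simp: nth_append take_Suc_0_drop)
  next
    case False
    with i have j: "i - length xs < length ys" by auto
    with assms(2) obtain us where
      "\<forall>y\<in>set us. y \<in> set (drop (Suc (i - length xs)) ys)" "R (us, ys ! (i - length xs))"
      unfolding derivation_def by (auto simp: take_Suc_0_drop)
    then show ?thesis using i False
      by (intro exI[of _ us]) (auto simp: nth_append Suc_diff_le take_Suc_0_drop)
  qed
qed

lemma closure_derivation:
  assumes "closure R x" shows "\<exists>zs. derivation R zs \<and> x \<in> set zs"
  using assms
proof induction
  case (closureI ys x)
  then have "\<forall>y\<in>set ys. \<exists>zs. derivation R zs \<and> y \<in> set zs" by auto
  then have "\<exists>zs. derivation R zs \<and> set ys \<subseteq> set zs"
  proof (induction ys)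
    case Nil
    show ?case by (auto simp: derivation_def intro!: exI[of _ "[]"])
  next
    case (Cons y ys)
    then obtain zs zs' where "derivation R zs" "set ys \<subseteq> set zs" "derivation R zs'" "y \<in> set zs'"
      by auto
    then show ?case by (intro exI[of _ "zs @ zs'"]) (auto simp: derivation_append)
  qed
  then obtain zs where zs: "derivation R zs" "set ys \<subseteq> set zs" by blast
  have "derivation R (x # zs)"
    unfolding derivation_def
  proof (intro allI impI)
    fix i assume "i < length (x # zs)"
    then show "\<exists>us. (\<forall>y\<in>set us. y \<in> set (drop (Suc i) (x # zs))) \<and>
       (\<forall>u\<in>set (take (Suc 0) (drop i (x # zs))). R (us, u))"
      using zs closureI(1) by (cases i) (auto simp: derivation_def)
  qed
  then show ?case by (intro exI[of _ "x # zs"]) auto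
qed

lemma derivation_closure:
  assumes "derivation R zs" "x \<in> set zs" shows "closure R x"
  using assms
proof (induction zs arbitrary: x)
  case (Cons z zs)
  have zs: "derivation R zs"
    unfolding derivation_def
  proof (intro allI impI)
    fix i assume "i < length zs"
    then show "\<exists>us. (\<forall>y\<in>set us. y \<in> set (drop (Suc i) zs)) \<and>
       (\<forall>u\<in>set (take (Suc 0) (drop i zs)). R (us, u))"
      using Cons(2)[unfolded derivation_def, rule_format, of "Suc i"] by simp
  qed
  obtain us where "\<forall>y\<in>set us. y \<in> set zs" "R (us, z)"
    using Cons(2)[unfolded derivation_def, rule_format, of 0] by auto
  then have "closure R z" using Cons.IH[OF zs] by (intro closureI[of R us]) auto
  then show ?case using Cons.IH[OF zs] Cons(3) by auto
qed simp

text \<open>Derivations are finite objects, and checking one is a finite conjunction of c.e.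
  conditions. This makes evaluation and the tree of settled bits enumerable.\<close>

lemma ce_closure:
  assumes "ce R" shows "ce (closure R)"
proof -
  have *: "closure R = (\<lambda>x. \<exists>zs. derivation R zs \<and> x \<in> set zs)"
    by (rule ext) (metis closure_derivation derivation_closure)
  show ?thesis
    unfolding * derivation_def
    by (intro ce_intros ce_compose[OF assms] ce_computable computable_intros)
qed

section \<open>The numbering of programs is a bijection\<close>

lemma goedel_inject: "goedel p = goedel q \<Longrightarrow> p = q"
proof (induction p arbitrary: q)
  case (Tup f g)
  from Tup.prems have "\<exists>f' g'. q = Tup f' g' \<and> prod_encode (goedel f, goedel g) = prod_encode (goedel f', goedel g')"
    by (cases q) (simp_all, presburger+)
  then show ?case using Tup.IH by auto
next
  case (Comp f g)
  from Comp.prems have "\<exists>f' g'. q = Comp f' g' \<and> prod_encode (goedel f, goedel g) = prod_encode (goedel f', goedel g')"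
    by (cases q) (simp_all, presburger+)
  then show ?case using Comp.IH by auto
next
  case (PrimRec f g)
  from PrimRec.prems have "\<exists>f' g'. q = PrimRec f' g' \<and> prod_encode (goedel f, goedel g) = prod_encode (goedel f', goedel g')"
    by (cases q) (simp_all, presburger+)
  then show ?case using PrimRec.IH by auto
next
  case (Mu f)
  from Mu.prems have "\<exists>f'. q = Mu f' \<and> goedel f = goedel f'"
    by (cases q) (simp_all, presburger+)
  then show ?case using Mu.IH by auto
qed (case_tac q; simp)+

text \<open>Above 4 the residue modulo 4 selects the constructor, and its components have smaller
  codes. Since every number codes a program, recoding program codes is the identity.\<close>

lemma goedel_surj: "\<exists>p. goedel p = n"
proof (induction n rule: less_induct)
  case (less n)
  consider "n \<le> 4" | x where "n = 4 * x + 5" | x where "n = 4 * x + 6"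
    | x where "n = 4 * x + 7" | x where "n = 4 * x + 8"
  proof -
    assume *: "n \<le> 4 \<Longrightarrow> thesis" "\<And>x. n = 4 * x + 5 \<Longrightarrow> thesis" "\<And>x. n = 4 * x + 6 \<Longrightarrow> thesis"
      "\<And>x. n = 4 * x + 7 \<Longrightarrow> thesis" "\<And>x. n = 4 * x + 8 \<Longrightarrow> thesis"
    have "n \<le> 4 \<or> (\<exists>x. n = 4 * x + 5 \<or> n = 4 * x + 6 \<or> n = 4 * x + 7 \<or> n = 4 * x + 8)"
      by presburger
    then show thesis using * by blast
  qed
  then show ?case
  proof cases
    case 1
    then have "n = 0 \<or> n = 1 \<or> n = 2 \<or> n = 3 \<or> n = 4" by auto
    then show ?thesis by (metis goedel.simps(1-5))
  next
    case (2 x)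
    obtain a b where x: "x = prod_encode (a, b)" by (metis prod_decode_inverse surj_pair)
    then have "a \<le> x" "b \<le> x" by (simp_all add: le_prod_encode_1 le_prod_encode_2)
    then have "a < n" "b < n" using 2 by auto
    then obtain p q where "goedel p = a" "goedel q = b" using less by blast
    then show ?thesis using 2 x by (intro exI[of _ "Tup p q"]) simp
  next
    case (3 x)
    obtain a b where x: "x = prod_encode (a, b)" by (metis prod_decode_inverse surj_pair)
    then have "a \<le> x" "b \<le> x" by (simp_all add: le_prod_encode_1 le_prod_encode_2)
    then have "a < n" "b < n" using 3 by auto
    then obtain p q where "goedel p = a" "goedel q = b" using less by blast
    then show ?thesis using 3 x by (intro exI[of _ "Comp p q"]) simp
  next
    case (4 x)
    obtain a b where x: "x = prod_encode (a, b)" by (metis prod_decode_inverse surj_pair)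
    then have "a \<le> x" "b \<le> x" by (simp_all add: le_prod_encode_1 le_prod_encode_2)
    then have "a < n" "b < n" using 4 by auto
    then obtain p q where "goedel p = a" "goedel q = b" using less by blast
    then show ?thesis using 4 x by (intro exI[of _ "PrimRec p q"]) simp
  next
    case (5 x)
    then have "x < n" by simp
    then obtain p where "goedel p = x" using less by blast
    then show ?thesis using 5 by (intro exI[of _ "Mu p"]) simp
  qed
qed

instantiation prog :: enc begin
definition enc_prog :: "prog \<Rightarrow> nat" where "enc_prog = goedel"
definition dec_prog :: "nat \<Rightarrow> prog" where "dec_prog n = (THE p. goedel p = n)"
instance
proof
  show "dec (enc p) = p" for p :: prog
    unfolding enc_prog_def dec_prog_def by (rule the_equality) (auto dest: goedel_inject)
  then have "enc (dec n :: prog) = n" for n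
    using goedel_surj[of n] by (auto simp: enc_prog_def)
  then show "\<exists>p. \<forall>Z n. eval Z p n = Some (enc (dec n :: prog))"
    using eval_Id_prog by metis
qed
end

lemma enc_prog_simps:
  "enc (Tup f g) = 4 * prod_encode (enc f, enc g) + 5"
  "enc (Comp f g) = 4 * prod_encode (enc f, enc g) + 6"
  "enc (PrimRec f g) = 4 * prod_encode (enc f, enc g) + 7"
  "enc (Mu f) = 4 * enc f + 8"
  by (simp_all add: enc_prog_def)

lemma computable_Tup [computable_intros]:
  "computable f \<Longrightarrow> computable g \<Longrightarrow> computable (\<lambda>x. Tup (f x) (g x))"
  by (rule computable_of_enc) (unfold enc_prog_simps, intro computable_intros)

lemma computable_Comp [computable_intros]:
  "computable f \<Longrightarrow> computable g \<Longrightarrow> computable (\<lambda>x. Comp (f x) (g x))"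
  by (rule computable_of_enc) (unfold enc_prog_simps, intro computable_intros)

lemma computable_PrimRec [computable_intros]:
  "computable f \<Longrightarrow> computable g \<Longrightarrow> computable (\<lambda>x. PrimRec (f x) (g x))"
  by (rule computable_of_enc) (unfold enc_prog_simps, intro computable_intros)

lemma computable_Mu [computable_intros]:
  "computable f \<Longrightarrow> computable (\<lambda>x. Mu (f x))"
  by (rule computable_of_enc) (unfold enc_prog_simps, intro computable_intros)

lemma computable_Const_prog [computable_intros]:
  assumes "computable f" shows "computable (\<lambda>x. Const_prog (f x))"
proof -
  have *: "Const_prog n = rec_nat Zero (\<lambda>_ r. Comp Succ r) n" for n by (induction n) auto
  show ?thesis unfolding * by (intro computable_intros assms)
qed

subsection \<open>Initial segments\<close>

lemma length_initial_segment [simp]: "length (A \<restriction> n) = n"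
  by (simp add: initial_segment_def)

lemma nth_initial_segment [simp]: "i < n \<Longrightarrow> (A \<restriction> n) ! i \<longleftrightarrow> i \<in> A"
  by (simp add: initial_segment_def)

lemma take_initial_segment [simp]: "take m (A \<restriction> n) = A \<restriction> min m n"
  by (simp add: initial_segment_def take_map take_upt min_def)

definition initial :: "bool list \<Rightarrow> nat set \<Rightarrow> bool" where
  "initial s A \<longleftrightarrow> s = A \<restriction> length s"

lemma initial_iff: "initial s A \<longleftrightarrow> (\<forall>i<length s. s ! i \<longleftrightarrow> i \<in> A)"
  unfolding initial_def by (auto simp: list_eq_iff_nth_eq)

lemma initial_segment_initial [simp]: "initial (A \<restriction> n) A"
  by (simp add: initial_def)

lemma initial_prefix: "initial t A \<Longrightarrow> prefix s t \<Longrightarrow> initial s A"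
  unfolding initial_iff prefix_def by (metis length_append nth_append trans_less_add1)

lemma prefix_initial_segment: "prefix s (A \<restriction> n) \<longleftrightarrow> initial s A \<and> length s \<le> n"
proof
  assume "prefix s (A \<restriction> n)"
  then show "initial s A \<and> length s \<le> n"
    using initial_prefix[OF initial_segment_initial] prefix_length_le by fastforce
next
  assume "initial s A \<and> length s \<le> n"
  then have "s = take (length s) (A \<restriction> n)" by (simp add: initial_def min_def)
  then show "prefix s (A \<restriction> n)" by (metis take_is_prefix)
qed

lemma initial_same_prefix: "initial s A \<Longrightarrow> initial t A \<Longrightarrow> length s \<le> length t \<Longrightarrow> prefix s t"
  by (metis initial_def prefix_initial_segment)

lemma ex_initial_of_string: "\<exists>A. initial s A"
  by (intro exI[of _ "{i. i < length s \<and> s ! i}"]) (simp add: initial_iff)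

lemma prefix_same_cases2: "prefix s u \<Longrightarrow> prefix t u \<Longrightarrow> length s \<le> length t \<Longrightarrow> prefix s t"
  by (metis prefix_length_prefix)

subsection \<open>Evaluation from finite oracle information\<close>

text \<open>The oracle is known on the finite string \<open>s\<close> only; a query beyond its end
  has no derivation. This gives the use principle, and evaluation becomes c.e. with the oracle
  string as an ordinary argument.\<close>

inductive Ev :: "bool list \<Rightarrow> prog \<Rightarrow> nat \<Rightarrow> nat \<Rightarrow> bool" for s where
  Ev_Zero: "Ev s Zero x 0"
| Ev_Succ: "Ev s Succ x (Suc x)"
| Ev_ProjL: "Ev s ProjL x (fst (prod_decode x))"
| Ev_ProjR: "Ev s ProjR x (snd (prod_decode x))"
| Ev_Query: "prefix t s \<Longrightarrow> length t = Suc x \<Longrightarrow> drop x t = [b] \<Longrightarrow> Ev s Query x (of_bool b)"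
| Ev_Tup: "Ev s f x a \<Longrightarrow> Ev s g x b \<Longrightarrow> Ev s (Tup f g) x (prod_encode (a, b))"
| Ev_Comp: "Ev s g x a \<Longrightarrow> Ev s f a y \<Longrightarrow> Ev s (Comp f g) x y"
| Ev_PrimRec_0: "Ev s f a y \<Longrightarrow> Ev s (PrimRec f g) (prod_encode (a, 0)) y"
| Ev_PrimRec_Suc: "Ev s (PrimRec f g) (prod_encode (a, k)) r \<Longrightarrow>
    Ev s g (prod_encode (a, prod_encode (k, r))) y \<Longrightarrow>
    Ev s (PrimRec f g) (prod_encode (a, Suc k)) y"
| Ev_Mu: "Ev s f (prod_encode (x, n)) 0 \<Longrightarrow>
    \<forall>m<n. \<exists>y. y \<noteq> 0 \<and> Ev s f (prod_encode (x, m)) y \<Longrightarrow> Ev s (Mu f) x n"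

lemma Ev_sound:
  assumes "Ev s p x y" "initial s Z" shows "eval Z p x = Some y"
  using assms(1)
proof induction
  case (Ev_Query t x b)
  then have "initial t Z" using assms(2) initial_prefix by blast
  moreover have "t ! x = b" using Ev_Query
    by (metis Cons_nth_drop_Suc lessI list.inject)
  ultimately show ?case using Ev_Query by (auto simp: initial_iff)
next
  case (Ev_Mu f x n)
  let ?P = "\<lambda>n. eval Z f (prod_encode (x, n)) = Some 0 \<and> (\<forall>m<n. eval Z f (prod_encode (x, m)) \<noteq> None)"
  have n: "?P n" using Ev_Mu by auto
  moreover have "(LEAST n. ?P n) = n"
  proof (rule Least_equality[of ?P, OF n])
    fix m assume "?P m"
    then show "n \<le> m" using Ev_Mu by (metis not_le option.inject)
  qed
  ultimately show ?case by (auto simp: Let_def)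
qed auto

lemma Ev_mono:
  assumes "Ev s p x y" "prefix s t" shows "Ev t p x y"
  using assms(1)
proof induction
  case (Ev_Query u x b)
  then show ?case using assms(2) by (meson Ev.Ev_Query prefix_order.trans)
next
  case (Ev_Mu f x n)
  then show ?case by (meson Ev.Ev_Mu)
qed (auto intro: Ev.intros)

lemma Ev_mono_initial:
  assumes "Ev (Z \<restriction> n) p x y" "n \<le> m" shows "Ev (Z \<restriction> m) p x y"
  by (rule Ev_mono[OF assms(1)]) (simp add: prefix_initial_segment assms(2))

text \<open>A convergent computation asks finitely many questions. The uses of its subcomputations
  are merged by taking the maximum and applying monotonicity.\<close>

lemma Ev_complete:
  assumes "eval Z p x = Some y" shows "\<exists>n. Ev (Z \<restriction> n) p x y"
  using assms
proof (induction p arbitrary: x y)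
  case Query
  have "Ev (Z \<restriction> Suc x) Query x (of_bool (x \<in> Z))"
    by (rule Ev_Query[of "Z \<restriction> Suc x"]) (auto simp: initial_segment_def)
  then show ?case using Query by auto
next
  case (Tup f g)
  then obtain a b where ab: "eval Z f x = Some a" "eval Z g x = Some b" "y = prod_encode (a, b)"
    by (auto simp: bind_eq_Some_conv)
  then obtain n m where "Ev (Z \<restriction> n) f x a" "Ev (Z \<restriction> m) g x b" using Tup.IH by blast
  then have "Ev (Z \<restriction> max n m) f x a" "Ev (Z \<restriction> max n m) g x b"
    by (auto intro: Ev_mono_initial)
  then show ?case using ab Ev_Tup by blast
next
  case (Comp f g)
  then obtain a where ab: "eval Z g x = Some a" "eval Z f a = Some y"
    by (auto simp: bind_eq_Some_conv)
  then obtain n m where "Ev (Z \<restriction> n) g x a" "Ev (Z \<restriction> m) f a y" using Comp.IH by blast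
  then have "Ev (Z \<restriction> max n m) g x a" "Ev (Z \<restriction> max n m) f a y"
    by (auto intro: Ev_mono_initial)
  then show ?case using Ev_Comp by blast
next
  case (PrimRec f g)
  obtain a k where x: "x = prod_encode (a, k)" by (metis prod_decode_inverse surj_pair)
  have "rec_nat (eval Z f a)
       (\<lambda>k r. Option.bind r (\<lambda>y. eval Z g (prod_encode (a, prod_encode (k, y))))) k = Some y
     \<Longrightarrow> \<exists>n. Ev (Z \<restriction> n) (PrimRec f g) (prod_encode (a, k)) y" for y
  proof (induction k arbitrary: y)
    case 0
    then obtain n where "Ev (Z \<restriction> n) f a y" using PrimRec.IH(1)[of a y] by auto
    then show ?case using Ev_PrimRec_0 by blast
  next
    case (Suc k)
    then obtain r n m where r: "Ev (Z \<restriction> n) (PrimRec f g) (prod_encode (a, k)) r"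
      "Ev (Z \<restriction> m) g (prod_encode (a, prod_encode (k, r))) y"
      using PrimRec.IH(2) by (auto simp: bind_eq_Some_conv) blast
    then have "Ev (Z \<restriction> max n m) (PrimRec f g) (prod_encode (a, k)) r"
      "Ev (Z \<restriction> max n m) g (prod_encode (a, prod_encode (k, r))) y"
      by (auto intro: Ev_mono_initial)
    then show ?case using Ev_PrimRec_Suc by blast
  qed
  then show ?case using PrimRec.prems x by simp
next
  case (Mu f)
  let ?P = "\<lambda>n. eval Z f (prod_encode (x, n)) = Some 0 \<and> (\<forall>m<n. eval Z f (prod_encode (x, m)) \<noteq> None)"
  have if_Some: "(if c then Some u else None) = Some v \<Longrightarrow> c \<and> v = u" for c and u v :: nat
    by (simp split: if_splits)
  have ex: "(\<exists>n. ?P n) \<and> y = (LEAST n. ?P n)"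
    by (rule if_Some) (use Mu.prems in \<open>simp only: eval.simps Let_def\<close>)
  have Least: "P y \<and> (\<forall>m<y. \<not> P m)" if "(\<exists>n. P n) \<and> y = (LEAST n. P n)" for P and y :: nat
    using that LeastI_ex[of P] not_less_Least[of _ P] by blast
  from Least[OF ex] have P: "?P y" and y: "\<forall>m<y. \<not> ?P m" by blast+
  have "\<exists>k z. z \<noteq> 0 \<and> Ev (Z \<restriction> k) f (prod_encode (x, m)) z" if "m < y" for m
  proof -
    obtain z where z: "eval Z f (prod_encode (x, m)) = Some z" using P \<open>m < y\<close> by auto
    have "z \<noteq> 0"
    proof
      assume "z = 0"
      then have "?P m" using z P \<open>m < y\<close> by auto
      then show False using y \<open>m < y\<close> by blast
    qed
    then show ?thesis using Mu.IH z by blast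
  qed
  then obtain k where k: "\<And>m. m < y \<Longrightarrow> \<exists>z. z \<noteq> 0 \<and> Ev (Z \<restriction> k m) f (prod_encode (x, m)) z"
    by metis
  obtain j where j: "Ev (Z \<restriction> j) f (prod_encode (x, y)) 0" using Mu.IH P by blast
  define N where "N = Max (insert j (k ` {..<y}))"
  have "j \<le> N" "\<And>m. m < y \<Longrightarrow> k m \<le> N" by (auto simp: N_def)
  then have "Ev (Z \<restriction> N) (Mu f) x y"
    using k j by (intro Ev_Mu) (meson Ev_mono_initial)+
  then show ?case by blast
qed (auto intro: Ev.intros)

text \<open>The rules of \<open>Ev\<close> with premises looked up in a finite list
  \<open>Y\<close>, so that one inference is a c.e. condition and \<open>ce_closure\<close>
  applies.\<close>

definition Ev_step :: "(bool list \<times> prog \<times> nat \<times> nat) list \<Rightarrow> bool list \<Rightarrow> prog \<Rightarrow> nat \<Rightarrow> nat \<Rightarrow> bool" where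
  "Ev_step Y s p x y \<longleftrightarrow>
     p = Zero \<and> y = 0 \<or> p = Succ \<and> y = Suc x
   \<or> p = ProjL \<and> y = fst (prod_decode x) \<or> p = ProjR \<and> y = snd (prod_decode x)
   \<or> p = Query \<and> (\<exists>t b. prefix t s \<and> length t = Suc x \<and> drop x t = [b] \<and> y = (if b then 1 else 0))
   \<or> (\<exists>f g a b. p = Tup f g \<and> (s, f, x, a) \<in> set Y \<and> (s, g, x, b) \<in> set Y \<and> y = prod_encode (a, b))
   \<or> (\<exists>f g a. p = Comp f g \<and> (s, g, x, a) \<in> set Y \<and> (s, f, a, y) \<in> set Y)
   \<or> (\<exists>f g a. p = PrimRec f g \<and> x = prod_encode (a, 0) \<and> (s, f, a, y) \<in> set Y)
   \<or> (\<exists>f g a k r. p = PrimRec f g \<and> x = prod_encode (a, Suc k) \<and> (s, p, prod_encode (a, k), r) \<in> set Y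
        \<and> (s, g, prod_encode (a, prod_encode (k, r)), y) \<in> set Y)
   \<or> (\<exists>f. p = Mu f \<and> (s, f, prod_encode (x, y), 0) \<in> set Y
        \<and> (\<forall>m<y. \<exists>z. z \<noteq> 0 \<and> (s, f, prod_encode (x, m), z) \<in> set Y))"

definition Ev_rule where
  "Ev_rule = (\<lambda>q. Ev_step (fst q) (fst (snd q)) (fst (snd (snd q)))
     (fst (snd (snd (snd q)))) (snd (snd (snd (snd q)))))"

lemma Ev_rule [simp]: "Ev_rule (Y, s, p, x, y) \<longleftrightarrow> Ev_step Y s p x y"
  by (simp add: Ev_rule_def)

lemma ce_Ev_rule: "ce Ev_rule"
  unfolding Ev_rule_def Ev_step_def
  by (intro ce_intros; (rule ce_computable)?; intro computable_intros)

lemma Ev_step_Query: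
  assumes "prefix t s" "length t = Suc x" "drop x t = [b]"
  shows "Ev_step Y s Query x (of_bool b)"
proof -
  have "\<exists>t c. prefix t s \<and> length t = Suc x \<and> drop x t = [c] \<and> of_bool b = (if c then 1 else 0 :: nat)"
    using assms by (intro exI[of _ t] exI[of _ b]) simp
  then show ?thesis unfolding Ev_step_def by (simp only: prog.distinct simp_thms)
qed

lemma Ev_step_Comp:
  "(s, g, x, a) \<in> set Y \<Longrightarrow> (s, f, a, y) \<in> set Y \<Longrightarrow> Ev_step Y s (Comp f g) x y"
  by (simp add: Ev_step_def) blast

lemma Ev_step_PrimRec_Suc:
  "(s, PrimRec f g, prod_encode (a, k), r) \<in> set Y \<Longrightarrow>
   (s, g, prod_encode (a, prod_encode (k, r)), y) \<in> set Y \<Longrightarrow>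
   Ev_step Y s (PrimRec f g) (prod_encode (a, Suc k)) y"
  by (simp add: Ev_step_def) blast

lemma Ev_of_step:
  assumes "Ev_step Y s p x y" "\<And>s p x y. (s, p, x, y) \<in> set Y \<Longrightarrow> Ev s p x y"
  shows "Ev s p x y"
proof (cases p)
  case Query
  then show ?thesis using assms(1) Ev_Query[of _ s x True] Ev_Query[of _ s x False]
    by (auto simp: Ev_step_def split: if_splits)
next
  case (Tup f g)
  then show ?thesis using assms by (auto simp: Ev_step_def intro!: Ev_Tup)
next
  case (Comp f g)
  with assms(1) obtain a where "(s, g, x, a) \<in> set Y" "(s, f, a, y) \<in> set Y"
    by (auto simp: Ev_step_def)
  then show ?thesis using assms(2) Comp Ev_Comp by blast
next
  case (PrimRec f g)
  with assms(1) consider a where "x = prod_encode (a, 0)" "(s, f, a, y) \<in> set Y"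
    | a k r where "x = prod_encode (a, Suc k)" "(s, PrimRec f g, prod_encode (a, k), r) \<in> set Y"
      "(s, g, prod_encode (a, prod_encode (k, r)), y) \<in> set Y"
    by (auto simp: Ev_step_def)
  then show ?thesis
  proof cases
    case 1
    then show ?thesis using Ev_PrimRec_0[OF assms(2)] PrimRec by simp
  next
    case 2
    then show ?thesis using Ev_PrimRec_Suc[OF assms(2) assms(2)] PrimRec by simp
  qed
next
  case (Mu f)
  have "Ev s (Mu f) x y"
    by (rule Ev_Mu) (use assms Mu in \<open>simp_all add: Ev_step_def\<close>, blast)
  then show ?thesis using Mu by simp
qed (use assms(1) Ev_Zero Ev_Succ Ev_ProjL Ev_ProjR in \<open>simp_all add: Ev_step_def\<close>)

lemma closure_Ev_rule_iff: "closure Ev_rule (s, p, x, y) \<longleftrightarrow> Ev s p x y"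
proof
  have "closure Ev_rule q \<Longrightarrow> case q of (s, p, x, y) \<Rightarrow> Ev s p x y" for q
  proof (induction rule: closure.induct)
    case (closureI ys q)
    obtain s p x y where q: "q = (s, p, x, y)" by (metis surj_pair)
    have "Ev s p x y"
      by (rule Ev_of_step[of ys]) (use closureI q in auto)
    then show ?case using q by simp
  qed
  then show "closure Ev_rule (s, p, x, y) \<Longrightarrow> Ev s p x y" by blast
next
  have *: "closure Ev_rule (s, p, x, y)"
    if "Ev_step Y s p x y" "list_all (closure Ev_rule) Y" for Y s p x y
    using that by (intro closureI[of Ev_rule Y]) (auto simp: list_all_iff)
  assume "Ev s p x y"
  then show "closure Ev_rule (s, p, x, y)"
  proof induction
    case (Ev_Query t x b)
    then have "Ev_step [] s Query x (of_bool b)" by (intro Ev_step_Query)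
    then show ?case by (rule *) simp
  next
    case (Ev_Tup f x a g b)
    let ?Y = "[(s, f, x, a), (s, g, x, b)]"
    have "Ev_step ?Y s (Tup f g) x (prod_encode (a, b))" by (simp add: Ev_step_def)
    then show ?case by (rule *) (simp add: Ev_Tup)
  next
    case (Ev_Comp g x a f y)
    let ?Y = "[(s, g, x, a), (s, f, a, y)]"
    have "Ev_step ?Y s (Comp f g) x y" by (rule Ev_step_Comp[of _ _ _ a]) simp_all
    then show ?case by (rule *) (simp add: Ev_Comp)
  next
    case (Ev_PrimRec_0 f a y g)
    have "Ev_step [(s, f, a, y)] s (PrimRec f g) (prod_encode (a, 0)) y"
      by (simp add: Ev_step_def)
    then show ?case by (rule *) (simp add: Ev_PrimRec_0)
  next
    case (Ev_PrimRec_Suc f g a k r y)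
    let ?Y = "[(s, PrimRec f g, prod_encode (a, k), r), (s, g, prod_encode (a, prod_encode (k, r)), y)]"
    have "Ev_step ?Y s (PrimRec f g) (prod_encode (a, Suc k)) y"
      by (rule Ev_step_PrimRec_Suc[of _ _ _ _ _ r]) simp_all
    then show ?case by (rule *) (simp add: Ev_PrimRec_Suc)
  next
    case (Ev_Mu f x n)
    then obtain h where h: "\<And>m. m < n \<Longrightarrow> h m \<noteq> 0 \<and> closure Ev_rule (s, f, prod_encode (x, m), h m)"
      by metis
    let ?Y = "(s, f, prod_encode (x, n), 0) # map (\<lambda>m. (s, f, prod_encode (x, m), h m)) [0..<n]"
    have "\<exists>z. z \<noteq> 0 \<and> (s, f, prod_encode (x, m), z) \<in> set ?Y" if "m < n" for m
      using that h[OF that] by (intro exI[of _ "h m"]) auto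
    then have "Ev_step ?Y s (Mu f) x n" by (simp add: Ev_step_def)
    moreover have "list_all (closure Ev_rule) ?Y" using Ev_Mu(2) h by (simp add: list_all_iff)
    ultimately show ?case by (rule *)
  next
    case (Ev_Zero x)
    have "Ev_step [] s Zero x 0" by (simp add: Ev_step_def)
    then show ?case by (rule *) simp
  next
    case (Ev_Succ x)
    have "Ev_step [] s Succ x (Suc x)" by (simp add: Ev_step_def)
    then show ?case by (rule *) simp
  next
    case (Ev_ProjL x)
    have "Ev_step [] s ProjL x (fst (prod_decode x))" by (simp add: Ev_step_def)
    then show ?case by (rule *) simp
  next
    case (Ev_ProjR x)
    have "Ev_step [] s ProjR x (snd (prod_decode x))" by (simp add: Ev_step_def)
    then show ?case by (rule *) simp
  qed
qed

lemma ce_Ev: "ce (\<lambda>q. Ev (fst q) (fst (snd q)) (fst (snd (snd q))) (snd (snd (snd q))))"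
proof -
  have "closure Ev_rule = (\<lambda>q. Ev (fst q) (fst (snd q)) (fst (snd (snd q))) (snd (snd (snd q))))"
    by (rule ext) (metis closure_Ev_rule_iff prod.collapse)
  then show ?thesis using ce_closure[OF ce_Ev_rule] by simp
qed

lemma ce_Ev_compose:
  assumes "computable s" "computable p" "computable x" "computable y"
  shows "ce (\<lambda>q. Ev (s q) (p q) (x q) (y q))"
proof -
  have "computable (\<lambda>q. (s q, p q, x q, y q))" by (intro computable_intros assms)
  from ce_compose[OF ce_Ev this] show ?thesis by simp
qed

section \<open>Completeness of the halting set, programs from c.e. graphs, Turing reductions\<close>

lemma ce_compose2:
  assumes "ce (\<lambda>p. P (fst p) (snd p))" "computable f" "computable g"
  shows "ce (\<lambda>x. P (f x) (g x))"
  using ce_compose[OF assms(1) computable_Pair[OF assms(2,3)]] by simp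

text \<open>\<open>Mu\<close> looks for a zero, hence the negated test. As the test is total, the
  search diverges only if there is nothing to find.\<close>

lemma eval_Mu_search:
  assumes "\<And>m. eval Z q (prod_encode (a, m)) = Some (of_bool (\<not> T m))"
  shows "eval Z (Mu q) a = (if \<exists>m. T m then Some (LEAST m. T m) else None)"
  by (simp add: assms)

text \<open>The program \<open>g x\<close> ignores its input and searches for a witness of
  \<open>P x\<close>, so it halts on its own code iff \<open>P x\<close> holds.\<close>

lemma halting_reduction:
  fixes P :: "'a::enc \<Rightarrow> bool"
  assumes "ce P"
  shows "\<exists>f. computable f \<and> (\<forall>x. P x \<longleftrightarrow> f x \<in> halting)"
proof -
  from assms obtain D where D: "computable (\<lambda>p. D (fst p) (snd p))" "\<And>x. P x \<longleftrightarrow> (\<exists>n::nat. D x n)"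
    by (elim ceE) blast
  have "computable (\<lambda>p. \<not> D (fst p) (snd p))" by (intro computable_intros D)
  then obtain q where q: "\<And>Z p. eval Z q (enc p) = Some (enc (\<not> D (fst p) (snd p)))"
    unfolding computable_def by blast
  have Mu: "eval Z (Mu q) (enc x) = (if \<exists>m. D x m then Some (LEAST m. D x m) else None)" for Z x
    by (rule eval_Mu_search) (use q[of _ "(x, _)"] in \<open>simp add: enc_bool_def\<close>)
  define g where "g x = Comp (Mu q) (Const_prog (enc x))" for x :: 'a
  have "enc (g x) \<in> halting \<longleftrightarrow> P x" for x
  proof -
    have "eval {} (g x) y \<noteq> None \<longleftrightarrow> P x" for y
      unfolding g_def using Mu[of "{}" x] D(2)[of x] by (simp del: eval.simps(9))
    then show ?thesis
      unfolding halting_def enc_prog_def by (auto dest: goedel_inject)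
  qed
  moreover have "computable (\<lambda>x. enc (g x))" unfolding g_def by (intro computable_intros)
  ultimately show ?thesis by blast
qed

lemma initial_segment_empty: "{} \<restriction> n = replicate n False"
  by (simp add: initial_segment_def map_replicate_const)

lemma initial_empty_iff: "eval {} p x = Some y \<longleftrightarrow> (\<exists>n. Ev (replicate n False) p x y)"
  using Ev_complete[of "{}" p x y] Ev_sound[of _ p x y "{}"]
  by (metis initial_segment_empty initial_segment_initial)

lemma ce_halting: "ce (\<lambda>n. n \<in> halting)"
proof -
  have "n \<in> halting \<longleftrightarrow> (\<exists>k y. Ev (replicate k False) (dec n) n y)" for n
  proof -
    obtain p where p: "n = goedel p" using goedel_surj by metis
    then have d: "dec n = p" by (metis dec_enc enc_prog_def)
    have "n \<in> halting \<longleftrightarrow> eval {} p n \<noteq> None"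
      unfolding halting_def using p by (auto dest: goedel_inject)
    then show ?thesis using initial_empty_iff d by auto
  qed
  then show ?thesis by (simp only:) (intro ce_intros ce_Ev_compose; intro computable_intros)
qed

text \<open>Search for a value together with a stage certifying that it belongs to the graph, then
  return the value.\<close>

lemma ce_graph_program:
  fixes F :: "nat \<Rightarrow> nat option"
  assumes "ce (\<lambda>q. F (fst q) = Some (snd q))"
  obtains p where "\<And>n. eval {} p n = F n"
proof -
  from assms obtain D where D: "computable (\<lambda>p. D (fst p) (snd p))"
    "\<And>q. F (fst q) = Some (snd q) \<longleftrightarrow> (\<exists>n::nat. D q n)"
    by (elim ceE) blast
  define T where "T n w \<longleftrightarrow> D (n, fst (prod_decode w)) (snd (prod_decode w))" for n w
  have "computable (\<lambda>t. \<not> T (fst t) (snd t))"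
    unfolding T_def by (intro computable_intros D(1)[THEN computable_compose2])
  then obtain q where q: "\<And>Z t. eval Z q (enc t) = Some (enc (\<not> T (fst t) (snd t)))"
    unfolding computable_def by blast
  have Mu: "eval {} (Mu q) n = (if \<exists>m. T n m then Some (LEAST m. T n m) else None)" for n
    by (rule eval_Mu_search) (use q[of _ "(n, _)"] in \<open>simp add: enc_bool_def\<close>)
  have "eval {} (Comp ProjL (Mu q)) n = F n" for n
  proof (cases "\<exists>m. T n m")
    case True
    define w where "w = (LEAST m. T n m)"
    have "T n w" using True LeastI_ex unfolding w_def by blast
    then have "F n = Some (fst (prod_decode w))" using D(2)[of "(n, _)"] T_def by auto
    then show ?thesis using Mu True w_def by (simp del: eval.simps(9))
  next
    case False
    have "F n = None"
    proof (rule ccontr)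
      assume "F n \<noteq> None"
      then obtain y k where "D (n, y) k" using D(2)[of "(n, _)"] by auto
      then have "T n (prod_encode (y, k))" by (simp add: T_def)
      then show False using False by blast
    qed
    then show ?thesis using Mu False by (simp del: eval.simps(9))
  qed
  then show ?thesis using that by blast
qed

text \<open>A reduction is given as a c.e. set of axioms: oracle string, input, answer. Axioms off
  \<open>Z\<close> may contradict each other; only those on initial segments of \<open>Z\<close>
  have to be correct. The program searches for a certified axiom whose string it can confirm by
  querying \<open>Z\<close>.\<close>

lemma turing_leI:
  assumes ce: "ce (\<lambda>q. S (fst q) (fst (snd q)) (snd (snd q)))"
    and complete: "\<And>n. \<exists>s. initial s Z \<and> S s n (n \<in> C)"
    and sound: "\<And>s n b. initial s Z \<Longrightarrow> S s n b \<Longrightarrow> b \<longleftrightarrow> n \<in> C"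
  shows "C \<le>\<^sub>T Z"
proof -
  from ce obtain D where D: "computable (\<lambda>p. D (fst p) (snd p))"
    "\<And>q. S (fst q) (fst (snd q)) (snd (snd q)) \<longleftrightarrow> (\<exists>n::nat. D q n)"
    by (elim ceE) blast
  \<comment> \<open>Here \<open>z\<close> is the true initial segment, supplied by the calling
    program; comparing it with the string of the axiom needs no query.\<close>
  define T where "T z n (v :: (bool list \<times> bool) \<times> nat) \<longleftrightarrow>
     z = fst (fst v) \<and> D (fst (fst v), n, snd (fst v)) (snd v)" for z n v
  have "computable (\<lambda>t :: bool list \<times> nat \<times> nat. \<not> T (fst t) (fst (snd t)) (dec (snd (snd t))))"
    unfolding T_def by (intro computable_intros D(1)[THEN computable_compose2])
  then obtain pt where pt: "\<And>Z t. eval Z pt (enc t) = Some (enc (\<not> T (fst t) (fst (snd t)) (dec (snd (snd t)))))"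
    unfolding computable_def by blast
  have "computable (\<lambda>t :: bool list \<times> bool. fst t @ [snd t])" by (intro computable_intros)
  then obtain ps where ps: "\<And>Z t. eval Z ps (enc t) = Some (enc (fst t @ [snd t :: bool]))"
    unfolding computable_def by blast
  \<comment> \<open>The only part that queries the oracle: it assembles
    \<open>Z \<restriction> n\<close> bit by bit.\<close>
  define ph where "ph = PrimRec Zero (Comp ps (Tup (Comp ProjR ProjR) (Comp Query (Comp ProjL ProjR))))"
  have ph: "eval Z ph (prod_encode (a, n)) = Some (enc (Z \<restriction> n))" for a n
  proof -
    have "rec_nat (Some 0) (\<lambda>k r. Option.bind r (\<lambda>y. eval Z ps (prod_encode (y, of_bool (k \<in> Z))))) n
      = Some (enc (Z \<restriction> n))"
    proof (induction n)
      case (Suc n)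
      have "Z \<restriction> Suc n = (Z \<restriction> n) @ [n \<in> Z]" by (simp add: initial_segment_def)
      then show ?case using Suc ps[of Z "(Z \<restriction> n, n \<in> Z)"] by (simp add: enc_bool_def)
    qed (simp add: initial_segment_def enc_Nil)
    then show ?thesis by (simp add: ph_def)
  qed
  have "computable (\<lambda>w. length (fst (fst (dec w :: (bool list \<times> bool) \<times> nat))))"
    by (intro computable_intros)
  then obtain pl where pl: "\<And>Z w. eval Z pl w = Some (length (fst (fst (dec w :: (bool list \<times> bool) \<times> nat))))"
    unfolding computable_def by auto
  have "computable (\<lambda>w. snd (fst (dec w :: (bool list \<times> bool) \<times> nat)))"
    by (intro computable_intros)
  then obtain pout where pout: "\<And>Z w. eval Z pout w = Some (of_bool (snd (fst (dec w :: (bool list \<times> bool) \<times> nat))))"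
    unfolding computable_def by (auto simp: enc_bool_def)
  define T' where "T' n w \<longleftrightarrow> T (Z \<restriction> length (fst (fst (dec w :: (bool list \<times> bool) \<times> nat)))) n (dec w)" for n w
  define q where "q = Comp pt (Tup (Comp ph (Tup Zero (Comp pl ProjR))) (Tup ProjL ProjR))"
  have "eval Z q (prod_encode (n, w)) = Some (of_bool (\<not> T' n w))" for n w
    using pt[of Z "(Z \<restriction> length (fst (fst (dec w :: (bool list \<times> bool) \<times> nat))), n, w)"]
    by (simp add: q_def ph pl T'_def enc_bool_def)
  then have Mu: "eval Z (Mu q) n = (if \<exists>m. T' n m then Some (LEAST m. T' n m) else None)" for n
    by (rule eval_Mu_search)
  have "eval Z (Comp pout (Mu q)) n = Some (of_bool (n \<in> C))" for n
  proof -
    obtain s k where s: "initial s Z" "D (s, n, n \<in> C) k"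
      using complete[of n] D(2)[of "(_, n, n \<in> C)"] by auto
    have "T' n (enc ((s, n \<in> C), k))" using s unfolding T'_def T_def dec_enc by (simp add: initial_def)
    then have ex: "\<exists>m. T' n m" by blast
    define w where "w = (LEAST m. T' n m)"
    have "T' n w" using ex LeastI_ex unfolding w_def by blast
    then have "initial (fst (fst (dec w :: (bool list \<times> bool) \<times> nat))) Z"
      "S (fst (fst (dec w :: (bool list \<times> bool) \<times> nat))) n (snd (fst (dec w :: (bool list \<times> bool) \<times> nat)))"
      using D(2)[of "(_, n, _)"] unfolding T'_def T_def initial_def by auto
    then have "snd (fst (dec w :: (bool list \<times> bool) \<times> nat)) \<longleftrightarrow> n \<in> C" by (rule sound)
    then show ?thesis using Mu ex pout by (simp add: w_def del: eval.simps(9))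
  qed
  then show ?thesis unfolding turing_le_def by blast
qed

section \<open>Prefix-free machines as c.e. graphs\<close>

lemma inj_str_encode: "inj str_encode"
proof (rule injI)
  fix s t show "str_encode s = str_encode t \<Longrightarrow> s = t"
  proof (induction s arbitrary: t)
    case (Cons b s)
    show ?case
    proof (cases t)
      case Nil
      then show ?thesis using Cons.prems by (simp split: if_splits)
    next
      case t: (Cons a u)
      with Cons.prems have "2 * str_encode s + (if b then 2 else 1) = 2 * str_encode u + (if a then 2 else 1)"
        by simp
      then have "a = b \<and> str_encode s = str_encode u"
        by (cases a; cases b) (simp_all, presburger+)
      then show ?thesis using Cons.IH t by simp
    qed
  qed (case_tac t; simp split: if_splits)
qed

lemma ce_machine:
  assumes "prefix_free_machine U" shows "ce (\<lambda>q. U (fst q) = Some (snd q))"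
proof -
  obtain p where p: "\<And>s. eval {} p (str_encode s) = map_option str_encode (U s)"
    using assms unfolding prefix_free_machine_def by blast
  have "U s = Some t \<longleftrightarrow> (\<exists>n. Ev (replicate n False) p (str_encode s) (str_encode t))" for s t
    unfolding initial_empty_iff[symmetric] p using inj_str_encode by (auto dest: injD)
  then show ?thesis by (simp only:) (intro ce_intros ce_Ev_compose; intro computable_intros)
qed

lemma machine_of_ce:
  assumes ce: "ce (\<lambda>q. G (fst q) (snd q))"
    and functional: "\<And>s t u. G s t \<Longrightarrow> G s u \<Longrightarrow> t = u"
    and free: "\<And>s t s' t'. G s t \<Longrightarrow> G s' t' \<Longrightarrow> prefix s s' \<Longrightarrow> s = s'"
  obtains M where "prefix_free_machine M" "\<And>s t. M s = Some t \<longleftrightarrow> G s t"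
proof -
  define M where "M s = (if \<exists>t. G s t then Some (THE t. G s t) else None)" for s
  have M: "M s = Some t \<longleftrightarrow> G s t" for s t
  proof
    assume "G s t"
    moreover from this have "(THE t. G s t) = t" using functional by blast
    ultimately show "M s = Some t" by (auto simp: M_def)
  next
    assume *: "M s = Some t"
    then obtain u where u: "G s u" unfolding M_def by (auto split: if_splits)
    then have "(THE t. G s t) = u" using functional by blast
    then show "G s t" using * u unfolding M_def by (auto split: if_splits)
  qed
  define F where "F n = (if \<exists>s. n = str_encode s then map_option str_encode (M (inv str_encode n)) else None)" for n
  have F: "F (str_encode s) = map_option str_encode (M s)" for s
    using inj_str_encode by (auto simp: F_def)
  have "F n = Some m \<longleftrightarrow> (\<exists>s t. n = str_encode s \<and> m = str_encode t \<and> G s t)" for n m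
  proof (cases "\<exists>s. n = str_encode s")
    case True
    then obtain s where s: "n = str_encode s" by blast
    have "F n = Some m \<longleftrightarrow> (\<exists>t. m = str_encode t \<and> G s t)"
      unfolding s F by (auto simp: M[symmetric])
    then show ?thesis using s inj_str_encode by (auto dest: injD)
  qed (auto simp: F_def)
  then have "ce (\<lambda>q. F (fst q) = Some (snd q))"
    by (simp only:) (intro ce_intros ce_compose2[OF ce]; (rule ce_computable)?; intro computable_intros)
  then obtain p where "\<And>n. eval {} p n = F n" using ce_graph_program by blast
  then have "prefix_free_machine M"
    unfolding prefix_free_machine_def
  proof (intro conjI exI[of _ p] ballI impI)
    show "\<forall>s. eval {} p (str_encode s) = map_option str_encode (M s)" if "\<And>n. eval {} p n = F n"
      using that F by simp
    show "s = t" if "s \<in> dom M" "t \<in> dom M" "prefix s t" for s t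
      using that M free by blast
  qed
  then show ?thesis using that M by blast
qed

lemma card_extensions: "card {r :: bool list. length r = L \<and> prefix s r} = (if length s \<le> L then 2 ^ (L - length s) else 0)"
proof (cases "length s \<le> L")
  case True
  have "{r. length r = L \<and> prefix s r} = (\<lambda>t. s @ t) ` {t. length t = L - length s}"
    using True by (auto simp: prefix_def image_iff)
  moreover have "inj_on (\<lambda>t. s @ t) {t. length t = L - length s}" by (auto simp: inj_on_def)
  moreover have "card {t :: bool list. length t = n} = 2 ^ n" for n
    using card_lists_length_eq[of "UNIV :: bool set" n] by simp
  ultimately show ?thesis using True by (simp add: card_image)
next
  case False
  then have "{r. length r = L \<and> prefix s r} = {}" using prefix_length_le by force
  then show ?thesis using False by (simp only: card.empty if_False)
qed

lemma finite_strings_length: "finite {r :: bool list. length r = L \<and> P r}"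
  by (rule finite_subset[OF _ finite_lists_length_eq[of "UNIV :: bool set" L]]) auto

subsection \<open>Kraft's inequality\<close>

text \<open>Measure is treated by counting at a finite level: divided by \<open>2 ^ L\<close>, the
  cardinality of this set is the measure of the union of the cones, once \<open>L\<close> bounds the
  lengths in \<open>S\<close>.\<close>

definition cover :: "nat \<Rightarrow> bool list set \<Rightarrow> bool list set" where
  "cover L S = {r. length r = L \<and> (\<exists>s\<in>S. prefix s r)}"

lemma cover_UN: "cover L S = (\<Union>s\<in>S. {r. length r = L \<and> prefix s r})"
  by (auto simp: cover_def)

lemma half_power_diff: "a \<le> b \<Longrightarrow> (2::real) ^ (b - a) = 2 ^ b * (1/2) ^ a"
  by (simp add: power_diff power_one_over field_simps)

definition antichain :: "bool list set \<Rightarrow> bool" where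
  "antichain S \<longleftrightarrow> (\<forall>s\<in>S. \<forall>t\<in>S. prefix s t \<longrightarrow> s = t)"

lemma antichain_subset: "antichain S \<Longrightarrow> T \<subseteq> S \<Longrightarrow> antichain T"
  unfolding antichain_def by blast

lemma card_cover_antichain:
  assumes "finite S" "antichain S" "\<And>s. s \<in> S \<Longrightarrow> length s \<le> L"
  shows "real (card (cover L S)) = 2 ^ L * (\<Sum>s\<in>S. (1/2) ^ length s)"
proof -
  have "card (cover L S) = (\<Sum>s\<in>S. card {r :: bool list. length r = L \<and> prefix s r})"
    unfolding cover_UN
  proof (rule card_UN_disjoint[OF assms(1)])
    show "\<forall>i\<in>S. finite {r. length r = L \<and> prefix i r}" by (simp add: finite_strings_length)
    show "\<forall>i\<in>S. \<forall>j\<in>S. i \<noteq> j \<longrightarrow>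
       {r. length r = L \<and> prefix i r} \<inter> {r. length r = L \<and> prefix j r} = {}"
      using assms(2) unfolding antichain_def disjoint_iff mem_Collect_eq by (metis prefix_same_cases)
  qed
  then have "real (card (cover L S)) = (\<Sum>s\<in>S. real (card {r :: bool list. length r = L \<and> prefix s r}))"
    by simp
  also have "\<dots> = (\<Sum>s\<in>S. 2 ^ L * (1/2) ^ length s)"
    by (rule sum.cong) (auto simp: card_extensions half_power_diff assms(3))
  finally show ?thesis by (simp add: sum_distrib_left)
qed

lemma Kraft_above:
  assumes "finite S" "antichain S" "\<And>s. s \<in> S \<Longrightarrow> prefix u s"
  shows "(\<Sum>s\<in>S. (1/2 :: real) ^ length s) \<le> (1/2) ^ length u"
proof (cases "S = {}")
  case False
  define L where "L = Max (length ` S)"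
  have L: "length s \<le> L" if "s \<in> S" for s using that assms(1) by (simp add: L_def)
  have u: "length u \<le> L" using False assms(3) L prefix_length_le by (meson all_not_in_conv order_trans)
  have "cover L S \<subseteq> {r. length r = L \<and> prefix u r}"
    using assms(3) by (auto simp: cover_def intro: prefix_order.trans)
  then have "card (cover L S) \<le> card {r. length r = L \<and> prefix u r}"
    by (rule card_mono[OF finite_strings_length])
  then have "card (cover L S) \<le> 2 ^ (L - length u)" using u by (simp add: card_extensions)
  then have "real (card (cover L S)) \<le> 2 ^ (L - length u)"
    using of_nat_mono[of _ "2 ^ (L - length u)", where 'a = real] by simp
  then have "real (card (cover L S)) \<le> 2 ^ L * (1/2) ^ length u"
    by (simp only: half_power_diff[OF u])
  moreover have "real (card (cover L S)) = 2 ^ L * (\<Sum>s\<in>S. (1/2) ^ length s)"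
    using assms L by (intro card_cover_antichain) auto
  ultimately show ?thesis by simp
qed simp

lemma Kraft:
  assumes "finite S" "antichain S" shows "(\<Sum>s\<in>S. (1/2 :: real) ^ length s) \<le> 1"
  using Kraft_above[OF assms, of "[]"] by simp

text \<open>A finite bound excludes the infimum of the empty set, and other infima in
  \<open>enat\<close> are attained.\<close>

lemma complexity_le_iff: "complexity M t \<le> enat n \<longleftrightarrow> (\<exists>s. M s = Some t \<and> length s \<le> n)"
proof
  assume le: "complexity M t \<le> enat n"
  let ?X = "{enat (length s) | s. M s = Some t}"
  have "?X \<noteq> {}" using le unfolding complexity_def by (auto simp: Inf_enat_def split: if_splits)
  then have "Inf ?X \<in> ?X" unfolding Inf_enat_def by (simp only: if_False) (meson LeastI all_not_in_conv)
  then show "\<exists>s. M s = Some t \<and> length s \<le> n" using le unfolding complexity_def by auto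
next
  assume "\<exists>s. M s = Some t \<and> length s \<le> n"
  then obtain s where s: "M s = Some t" "length s \<le> n" by blast
  have "complexity M t \<le> enat (length s)" unfolding complexity_def using s by (intro Inf_lower) blast
  then show "complexity M t \<le> enat n" using s by (meson enat_ord_simps(1) order_trans)
qed

text \<open>One description is chosen for each string. Different strings have different
  descriptions, and these form an antichain.\<close>

lemma Kraft_complexity:
  assumes "prefix_free_machine M" "finite T" "\<And>t. t \<in> T \<Longrightarrow> complexity M t \<le> enat (l t)"
  shows "(\<Sum>t\<in>T. (1/2 :: real) ^ l t) \<le> 1"
proof -
  have "\<forall>t\<in>T. \<exists>s. M s = Some t \<and> length s \<le> l t" using assms(3) complexity_le_iff by blast
  then obtain d where d: "\<And>t. t \<in> T \<Longrightarrow> M (d t) = Some t" "\<And>t. t \<in> T \<Longrightarrow> length (d t) \<le> l t"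
    by metis
  have inj: "inj_on d T" by (rule inj_onI) (metis d(1) option.inject)
  have "antichain (d ` T)"
    using assms(1) d(1) unfolding antichain_def prefix_free_machine_def by fast
  then have "(\<Sum>s\<in>d ` T. (1/2 :: real) ^ length s) \<le> 1" using assms(2) by (intro Kraft) auto
  moreover have "(\<Sum>t\<in>T. (1/2 :: real) ^ l t) \<le> (\<Sum>t\<in>T. (1/2) ^ length (d t))"
    by (rule sum_mono) (simp add: d power_decreasing)
  ultimately show ?thesis by (simp add: sum.reindex[OF inj])
qed

text \<open>Without repetitions a sum over stages counts every element once, so weights can be
  transferred between elements and stages.\<close>

lemma ce_enumeration_inj:
  assumes "ce P"
  obtains f :: "nat \<Rightarrow> 'a::enc option" where "computable f" "\<And>x. P x \<longleftrightarrow> (\<exists>n. f n = Some x)"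
    "\<And>i j x. f i = Some x \<Longrightarrow> f j = Some x \<Longrightarrow> i = j"
proof -
  from assms obtain g :: "nat \<Rightarrow> 'a option" where g: "computable g" "\<And>x. P x \<longleftrightarrow> (\<exists>n. g n = Some x)"
    by (elim ce_enumeration) blast
  define f where "f n = (if \<exists>k<n. g k = g n then None else g n)" for n
  show thesis
  proof
    show "computable f" unfolding f_def by (intro computable_intros g(1)[THEN computable_compose])
    show "P x \<longleftrightarrow> (\<exists>n. f n = Some x)" for x
    proof
      assume "P x"
      then have "\<exists>n. g n = Some x" using g(2) by blast
      then obtain n where "g n = Some x" "\<forall>k<n. g k \<noteq> Some x"
        using exists_least_iff[of "\<lambda>n. g n = Some x"] by auto
      then show "\<exists>n. f n = Some x" by (intro exI[of _ n]) (auto simp: f_def)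
    qed (auto simp: f_def g(2) split: if_splits)
    show "i = j" if "f i = Some x" "f j = Some x" for i j x
      using that by (auto simp: f_def split: if_splits) (metis linorder_neqE_nat)
  qed
qed

subsection \<open>The Kraft-Chaitin theorem\<close>

definition bin_val :: "bool list \<Rightarrow> nat" where
  "bin_val s = foldl (\<lambda>a b. 2 * a + (if b then 1 else 0)) 0 s"

text \<open>The left endpoint of the dyadic interval of length \<open>(1/2) ^ length s\<close> that
  belongs to \<open>s\<close>; prefixes correspond to larger intervals.\<close>

primrec bin_frac :: "bool list \<Rightarrow> real" where
  "bin_frac [] = 0"
| "bin_frac (b # s) = ((if b then 1 else 0) + bin_frac s) / 2"

lemma bin_frac_bounds: "0 \<le> bin_frac s" "bin_frac s < 1"
  by (induction s) auto

lemma bin_frac_snoc: "bin_frac (s @ [b]) = bin_frac s + (if b then 1 else 0) / 2 ^ Suc (length s)"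
  by (induction s) (auto simp: field_simps)

lemma bin_frac_eq: "bin_frac s = real (bin_val s) / 2 ^ length s"
proof (induction s rule: rev_induct)
  case (snoc b s)
  have "bin_val (s @ [b]) = 2 * bin_val s + (if b then 1 else 0)" by (simp add: bin_val_def)
  then show ?case using snoc by (auto simp: bin_frac_snoc field_simps)
qed (simp add: bin_val_def)

lemma bin_frac_prefix:
  assumes "prefix s t" shows "bin_frac s \<le> bin_frac t" "bin_frac t < bin_frac s + (1/2) ^ length s"
proof -
  have *: "bin_frac s \<le> bin_frac (s @ u) \<and> bin_frac (s @ u) < bin_frac s + (1/2) ^ length s" for u
  proof (induction s)
    case Nil
    then show ?case using bin_frac_bounds[of u] by simp
  qed (auto simp: field_simps)
  show "bin_frac s \<le> bin_frac t" "bin_frac t < bin_frac s + (1/2) ^ length s"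
    using assms * by (auto simp: prefix_def)
qed

lemma ex_bin_val: "v < 2 ^ n \<Longrightarrow> \<exists>s. length s = n \<and> bin_val s = v"
proof (induction n arbitrary: v)
  case 0
  then show ?case by (simp add: bin_val_def)
next
  case (Suc n)
  then have "v div 2 < 2 ^ n" by auto
  then obtain s where s: "length s = n" "bin_val s = v div 2" using Suc.IH by blast
  have "bin_val (s @ [v mod 2 = 1]) = 2 * bin_val s + v mod 2"
    by (auto simp: bin_val_def) 
  then show ?case using s by (intro exI[of _ "s @ [v mod 2 = 1]"]) simp
qed

text \<open>Multiples of \<open>(1/2) ^ n\<close> meet every half-open interval of that length; the
  room left below 1 keeps the numerator under \<open>2 ^ n\<close>.\<close>

lemma ex_bin_frac:
  assumes "0 \<le> x" "x + (1/2) ^ n \<le> 1"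
  shows "\<exists>s. length s = n \<and> x \<le> bin_frac s \<and> bin_frac s < x + (1/2) ^ n"
proof -
  define v where "v = nat \<lceil>x * 2 ^ n\<rceil>"
  have v: "real v = of_int \<lceil>x * 2 ^ n\<rceil>" using assms(1) by (simp add: v_def)
  have lo: "x * 2 ^ n \<le> real v" unfolding v by linarith
  have hi: "real v < x * 2 ^ n + 1" unfolding v by linarith
  have "x * 2 ^ n + 1 \<le> 2 ^ n"
    using mult_right_mono[OF assms(2), of "2 ^ n"] by (simp add: algebra_simps power_one_over)
  then have "real v < 2 ^ n" using hi by linarith
  then have "v < 2 ^ n" by simp
  then obtain s where s: "length s = n" "bin_val s = v" using ex_bin_val by blast
  then have "bin_frac s = real v / 2 ^ n" by (simp add: bin_frac_eq)
  moreover have "x \<le> real v / 2 ^ n" "real v / 2 ^ n < x + (1/2) ^ n"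
    using lo hi by (simp_all add: field_simps power_one_over)
  ultimately show ?thesis using s by auto
qed

text \<open>Requests receive consecutive intervals of length \<open>(1/2) ^ r\<close>, with no
  attempt to align them. A dyadic interval of half that length whose left endpoint lies in the first
  half stays inside, which is why descriptions have length \<open>Suc r\<close>.\<close>

lemma Kraft_Chaitin_machine:
  assumes ce: "ce (\<lambda>q :: bool list \<times> nat. R (fst q) (snd q))"
    and weight: "\<And>F. finite F \<Longrightarrow> (\<And>t r. (t, r) \<in> F \<Longrightarrow> R t r) \<Longrightarrow> (\<Sum>q\<in>F. (1/2 :: real) ^ snd q) \<le> 1"
  obtains M where "prefix_free_machine M" "\<And>t r. R t r \<Longrightarrow> \<exists>s. M s = Some t \<and> length s = Suc r"
proof -
  from ce obtain f :: "nat \<Rightarrow> (bool list \<times> nat) option" where f: "computable f"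
    "\<And>q. R (fst q) (snd q) \<longleftrightarrow> (\<exists>n. f n = Some q)"
    "\<And>i j q. f i = Some q \<Longrightarrow> f j = Some q \<Longrightarrow> i = j"
    by (elim ce_enumeration_inj) blast
  \<comment> \<open>The position is kept as numerator and exponent of a dyadic fraction, which stays
    within the naturals.\<close>
  define st :: "nat \<Rightarrow> nat \<times> nat" where "st n = rec_nat (0, 0) (\<lambda>i p. case f i of None \<Rightarrow> p
     | Some q \<Rightarrow> (fst p * 2 ^ snd q + 2 ^ snd p, snd p + snd q)) n" for n
  have st: "computable st"
    unfolding st_def by (intro computable_intros f(1)[THEN computable_compose])
  define pos where "pos n = real (fst (st n)) / 2 ^ snd (st n)" for n
  define wt where "wt i = (case f i of None \<Rightarrow> 0 | Some q \<Rightarrow> (1/2 :: real) ^ snd q)" for i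
  have pos_Suc: "pos (Suc n) = pos n + wt n" for n
    by (auto simp: pos_def st_def wt_def field_simps power_add split: option.splits)
  have pos_0: "pos 0 = 0" by (simp add: pos_def st_def)
  have wt_nonneg: "0 \<le> wt i" for i by (simp add: wt_def split: option.split)
  have pos_mono: "mono pos"
    by (rule incseq_SucI) (simp add: pos_Suc wt_nonneg)
  have pos_sum: "pos n = (\<Sum>i<n. wt i)" for n
    by (induction n) (auto simp: pos_0 pos_Suc)
  have pos_le: "pos n \<le> 1" for n
  proof -
    define I where "I = {i. i < n \<and> f i \<noteq> None}"
    have "pos n = (\<Sum>i\<in>I. wt i)"
      unfolding pos_sum I_def by (rule sum.mono_neutral_right) (auto simp: wt_def split: option.splits)
    also have "\<dots> = (\<Sum>i\<in>I. (1/2) ^ snd (the (f i)))"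
      by (rule sum.cong) (auto simp: wt_def I_def)
    also have "\<dots> = (\<Sum>q\<in>(\<lambda>i. the (f i)) ` I. (1/2) ^ snd q)"
    proof -
      have "inj_on (\<lambda>i. the (f i)) I"
        by (rule inj_onI) (use f(3) in \<open>auto simp: I_def\<close>)
      then show ?thesis by (simp add: sum.reindex)
    qed
    also have "\<dots> \<le> 1"
    proof (rule weight)
      show "finite ((\<lambda>i. the (f i)) ` I)" by (simp add: I_def)
      fix t r assume "(t, r) \<in> (\<lambda>i. the (f i)) ` I"
      then have "\<exists>i. f i = Some (t, r)" by (auto simp: I_def)
      then show "R t r" using f(2)[of "(t, r)"] by simp
    qed
    finally show ?thesis .
  qed
  \<comment> \<open>Denominators are cleared to make this computable; it says that the left endpoint
    of \<open>s\<close> lies in the first half of the interval of request \<open>i\<close>.\<close>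
  define G where "G s t \<longleftrightarrow> (\<exists>i. \<exists>r. f i = Some (t, r) \<and> length s = Suc r \<and>
     fst (st i) * 2 ^ length s \<le> bin_val s * 2 ^ snd (st i) \<and>
     bin_val s * 2 ^ snd (st i) < fst (st i) * 2 ^ length s + 2 ^ snd (st i))" for s t
  have G: "G s t \<longleftrightarrow> (\<exists>i r. f i = Some (t, r) \<and> length s = Suc r \<and> pos i \<le> bin_frac s
      \<and> bin_frac s < pos i + (1/2) ^ length s)" for s t
  proof -
    have 1: "fst (st i) * 2 ^ n \<le> v * 2 ^ snd (st i) \<longleftrightarrow> pos i \<le> real v / 2 ^ n" for i n v
    proof -
      have "fst (st i) * 2 ^ n \<le> v * 2 ^ snd (st i) \<longleftrightarrow> real (fst (st i)) * 2 ^ n \<le> real v * 2 ^ snd (st i)"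
        by (subst of_nat_le_iff[where 'a = real, symmetric]) simp
      then show ?thesis by (simp add: pos_def field_simps)
    qed
    have 2: "v * 2 ^ snd (st i) < fst (st i) * 2 ^ n + 2 ^ snd (st i) \<longleftrightarrow> real v / 2 ^ n < pos i + (1/2) ^ n" for i n v
    proof -
      have "v * 2 ^ snd (st i) < fst (st i) * 2 ^ n + 2 ^ snd (st i) \<longleftrightarrow>
        real v * 2 ^ snd (st i) < real (fst (st i)) * 2 ^ n + 2 ^ snd (st i)"
        by (subst of_nat_less_iff[where 'a = real, symmetric]) simp
      then show ?thesis by (simp add: pos_def field_simps power_one_over)
    qed
    show ?thesis unfolding G_def 1 2 bin_frac_eq by blast
  qed
  have overlap: "i = j" if "f i = Some q" "f j = Some q'" "pos i \<le> x" "x < pos i + (1/2) ^ Suc (snd q) + (1/2) ^ Suc (snd q)"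
     "pos j \<le> x" "x < pos j + (1/2) ^ Suc (snd q') + (1/2) ^ Suc (snd q')" for i j q q' x
  proof (rule ccontr)
    have lt: "x < pos (Suc i)" "x < pos (Suc j)" using that by (simp_all add: pos_Suc wt_def)
    assume "i \<noteq> j"
    then have "Suc i \<le> j \<or> Suc j \<le> i" by auto
    then have "pos (Suc i) \<le> pos j \<or> pos (Suc j) \<le> pos i" using pos_mono monoD by blast
    then show False using lt that by linarith
  qed
  have G_ce: "ce (\<lambda>q. G (fst q) (snd q))"
    unfolding G_def bin_val_def
    by (intro ce_intros; (rule ce_computable)?;
        intro computable_intros f(1)[THEN computable_compose] st[THEN computable_compose])
  have G_pre: "s = s' \<and> t = t'" if "G s t" "G s' t'" "prefix s s'" for s t s' t'
  proof -
    from that obtain i r i' r' where i: "f i = Some (t, r)" "length s = Suc r" "pos i \<le> bin_frac s"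
        "bin_frac s < pos i + (1/2) ^ length s"
      and i': "f i' = Some (t', r')" "length s' = Suc r'" "pos i' \<le> bin_frac s'"
        "bin_frac s' < pos i' + (1/2) ^ length s'"
      unfolding G by blast
    have "i = i'"
    \<comment> \<open>The left endpoint of the longer string lies in the intervals of both requests,
      and different requests have disjoint intervals.\<close>
    proof (rule overlap[OF i(1) i'(1), of "bin_frac s'"])
      show "pos i \<le> bin_frac s'" using i(3) bin_frac_prefix(1)[OF that(3)] by linarith
      show "bin_frac s' < pos i + (1/2) ^ Suc (snd (t, r)) + (1/2) ^ Suc (snd (t, r))"
        using i(2,4) bin_frac_prefix(2)[OF that(3)] by simp
      show "pos i' \<le> bin_frac s'" by (fact i'(3))
      have "(0 :: real) < (1/2) ^ length s'" by simp
      then show "bin_frac s' < pos i' + (1/2) ^ Suc (snd (t', r')) + (1/2) ^ Suc (snd (t', r'))"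
        using i'(2,4) by (simp del: zero_less_power)
    qed
    then have "t = t' \<and> length s = length s'" using i i' by auto
    then show ?thesis using that(3) by (auto simp: prefix_def)
  qed
  obtain M where M: "prefix_free_machine M" "\<And>s t. M s = Some t \<longleftrightarrow> G s t"
    using machine_of_ce[OF G_ce] G_pre by (metis prefix_order.refl)
  show thesis
  proof (rule that[OF M(1)])
    fix t r assume "R t r"
    then obtain i where i: "f i = Some (t, r)" using f(2)[of "(t, r)"] by auto
    have "pos i + (1/2) ^ r \<le> 1" using pos_le[of "Suc i"] i by (simp add: pos_Suc wt_def)
    moreover have "(1/2 :: real) ^ Suc r \<le> (1/2) ^ r" by (rule power_decreasing) auto
    ultimately have "pos i + (1/2) ^ Suc r \<le> 1" by linarith
    moreover have "0 \<le> pos i" using monoD[OF pos_mono, of 0 i] pos_0 by simp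
    ultimately obtain s where s: "length s = Suc r" "pos i \<le> bin_frac s" "bin_frac s < pos i + (1/2) ^ Suc r"
      using ex_bin_frac by blast
    then have "G s t" unfolding G using i by metis
    then show "\<exists>s. M s = Some t \<and> length s = Suc r" using M(2) s by blast
  qed
qed

lemma Kraft_Chaitin:
  assumes "optimal_machine U"
    and "ce (\<lambda>q :: bool list \<times> nat. R (fst q) (snd q))"
    and "\<And>F. finite F \<Longrightarrow> (\<And>t r. (t, r) \<in> F \<Longrightarrow> R t r) \<Longrightarrow> (\<Sum>q\<in>F. (1/2 :: real) ^ snd q) \<le> 1"
  obtains c where "\<And>t r. R t r \<Longrightarrow> complexity U t \<le> enat (r + c)"
proof -
  obtain M where M: "prefix_free_machine M" "\<And>t r. R t r \<Longrightarrow> \<exists>s. M s = Some t \<and> length s = Suc r"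
    using Kraft_Chaitin_machine[OF assms(2,3)] by blast
  then obtain c where c: "\<And>t. complexity U t \<le> complexity M t + enat c"
    using assms(1) unfolding optimal_machine_def by blast
  show thesis
  proof (rule that)
    fix t r assume "R t r"
    then have "complexity M t \<le> enat (Suc r)" using M(2) complexity_le_iff by (metis order_refl)
    then have "complexity U t \<le> enat (Suc r) + enat c" using c[of t] add_right_mono order_trans by blast
    then show "complexity U t \<le> enat (r + Suc c)" by simp
  qed
qed

section \<open>Weight estimates with powers of one half\<close>

lemma sum_half_powers_le:
  assumes "finite (C :: nat set)" shows "(\<Sum>c\<in>C. (1/2 :: real) ^ Suc c) \<le> 1"
proof -
  obtain n where n: "C \<subseteq> {..<n}" using assms finite_nat_iff_bounded by blast
  have "(\<Sum>c<n. (1/2 :: real) ^ Suc c) = 1 - (1/2) ^ n" by (induction n) auto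
  moreover have "(\<Sum>c\<in>C. (1/2 :: real) ^ Suc c) \<le> (\<Sum>c<n. (1/2) ^ Suc c)"
    by (rule sum_mono2[OF _ n]) auto
  ultimately show ?thesis by (smt (verit) zero_le_power divide_nonneg_nonneg)
qed

lemma card_prefixes_le: "card {s. P s \<and> prefix s r} \<le> Suc (length r)"
proof -
  have "{s. P s \<and> prefix s r} \<subseteq> set (prefixes r)" by auto
  then have "card {s. P s \<and> prefix s r} \<le> card (set (prefixes r))" by (rule card_mono[OF finite_set])
  also have "\<dots> \<le> length (prefixes r)" by (rule card_length)
  finally show ?thesis by simp
qed

text \<open>Markov's inequality for the number of prefixes in \<open>S\<close>: exchange the sums,
  and bound the part of \<open>F\<close> above each member of \<open>S\<close> by Kraft's
  inequality.\<close>

lemma sum_antichain_multiplicity: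
  assumes "finite F" "antichain F" "finite S"
    and "\<And>r. r \<in> F \<Longrightarrow> m \<le> card {s\<in>S. prefix s r}"
  shows "real m * (\<Sum>r\<in>F. (1/2) ^ length r) \<le> (\<Sum>s\<in>S. (1/2) ^ length s)"
proof -
  have "real m * (\<Sum>r\<in>F. (1/2) ^ length r) = (\<Sum>r\<in>F. real m * (1/2) ^ length r)"
    by (rule sum_distrib_left)
  also have "\<dots> \<le> (\<Sum>r\<in>F. real (card {s\<in>S. prefix s r}) * (1/2) ^ length r)"
    by (rule sum_mono) (simp add: assms(4) mult_right_mono)
  also have "\<dots> = (\<Sum>r\<in>F. \<Sum>s\<in>{s\<in>S. prefix s r}. (1/2) ^ length r)" by simp
  also have "\<dots> = (\<Sum>s\<in>S. \<Sum>r\<in>{r\<in>F. prefix s r}. (1/2) ^ length r)"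
    by (rule sum.swap_restrict[OF assms(1,3)])
  also have "\<dots> \<le> (\<Sum>s\<in>S. (1/2) ^ length s)"
    using assms(1) antichain_subset[OF assms(2)] by (intro sum_mono Kraft_above) auto
  finally show ?thesis .
qed

subsection \<open>Solovay tests\<close>

definition stage :: "(nat \<Rightarrow> bool list option) \<Rightarrow> nat \<Rightarrow> bool list set" where
  "stage f k = {s. \<exists>i<k. f i = Some s}"

text \<open>A computable level beyond all strings of stage \<open>k\<close>. Idle stages contribute
  1 to make it strictly increasing, so that a length determines its stage.\<close>

definition stage_len :: "(nat \<Rightarrow> bool list option) \<Rightarrow> nat \<Rightarrow> nat" where
  "stage_len f k = sum_list (map (\<lambda>i. case f i of None \<Rightarrow> 1 | Some s \<Rightarrow> Suc (length s)) [0..<k])"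

lemma finite_stage [simp]: "finite (stage f k)"
proof -
  have "stage f k \<subseteq> (\<lambda>i. the (f i)) ` {..<k}" by (force simp: stage_def)
  then show ?thesis by (rule finite_subset) simp
qed

lemma stage_mono: "k \<le> l \<Longrightarrow> stage f k \<subseteq> stage f l"
  unfolding stage_def by (auto intro: less_le_trans)

lemma strict_mono_stage_len: "strict_mono (stage_len f)"
  unfolding strict_mono_Suc_iff by (auto simp: stage_len_def split: option.split)

lemma stage_len_ge: "s \<in> stage f k \<Longrightarrow> length s \<le> stage_len f k"
proof -
  assume "s \<in> stage f k"
  then obtain i where i: "i < k" "f i = Some s" by (auto simp: stage_def)
  have "length s < stage_len f (Suc i)" using i by (simp add: stage_len_def)
  also have "\<dots> \<le> stage_len f k" using i strict_mono_stage_len by (simp add: strict_mono_less_eq)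
  finally show ?thesis by simp
qed

text \<open>If \<open>S\<close> contained infinitely many initial segments of \<open>X\<close>, the
  number of prefixes in \<open>S\<close> would be unbounded along \<open>X\<close>. Strings where
  this number first reaches \<open>M c\<close> have so little weight that they get descriptions
  about \<open>c\<close> bits shorter than themselves, which contradicts randomness for large
  \<open>c\<close>.\<close>

theorem Solovay:
  assumes opt: "optimal_machine U" and rand: "martin_loef_random U X" and ce: "ce S"
    and weight: "\<And>F. finite F \<Longrightarrow> (\<And>s. s \<in> F \<Longrightarrow> S s) \<Longrightarrow> (\<Sum>s\<in>F. (1/2 :: real) ^ length s) \<le> B"
  shows "finite {s. S s \<and> initial s X}"
proof (rule ccontr)
  assume inf: "infinite {s. S s \<and> initial s X}"
  obtain d where d: "B \<le> 2 ^ d"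
    using real_arch_pow[of 2 B] by (metis less_eq_real_def one_less_numeral_iff semiring_norm(76))
  from ce obtain f :: "nat \<Rightarrow> bool list option" where f: "computable f"
    "\<And>s. S s \<longleftrightarrow> (\<exists>n. f n = Some s)" "\<And>i j s. f i = Some s \<Longrightarrow> f j = Some s \<Longrightarrow> i = j"
    by (elim ce_enumeration_inj) blast
  have stage_S: "S s" if "s \<in> stage f k" for s k using f(2) that by (auto simp: stage_def)
  define cnt where "cnt k r = length (filter (\<lambda>i. case f i of None \<Rightarrow> False | Some s \<Rightarrow> prefix s r) [0..<k])" for k r
  have cnt: "cnt k r = card {s\<in>stage f k. prefix s r}" for k r
  proof -
    let ?I = "{i. i < k \<and> (case f i of None \<Rightarrow> False | Some s \<Rightarrow> prefix s r)}"
    have "cnt k r = card (set (filter (\<lambda>i. case f i of None \<Rightarrow> False | Some s \<Rightarrow> prefix s r) [0..<k]))"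
      unfolding cnt_def by (rule distinct_card[symmetric]) simp
    also have "\<dots> = card ?I" by (rule arg_cong[where f = card]) auto
    also have "\<dots> = card ((\<lambda>i. the (f i)) ` ?I)"
    proof (rule card_image[symmetric], rule inj_onI)
      fix x y assume "x \<in> ?I" "y \<in> ?I" "the (f x) = the (f y)"
      then show "x = y" using f(3) by (auto split: option.splits)
    qed
    also have "(\<lambda>i. the (f i)) ` ?I = {s\<in>stage f k. prefix s r}"
    proof (intro set_eqI iffI)
      fix s assume "s \<in> {s\<in>stage f k. prefix s r}"
      then obtain i where "i < k" "f i = Some s" "prefix s r" by (auto simp: stage_def)
      then show "s \<in> (\<lambda>i. the (f i)) ` ?I" by (intro image_eqI[of _ _ i]) auto
    qed (auto simp: stage_def split: option.splits)
    finally show ?thesis .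
  qed
  \<comment> \<open>The factor \<open>2 ^ d\<close> absorbs the total weight. Of the remaining
    \<open>2 * c + 1\<close> bits, \<open>c\<close> pay for the shorter descriptions and
    \<open>c + 1\<close> make the weights summable over \<open>c\<close>.\<close>
  define M where "M c = (2 :: nat) ^ (2 * c + d + 1)" for c
  \<comment> \<open>Demanding the first stage makes the hits for a fixed \<open>c\<close> an
    antichain.\<close>
  define Hit where "Hit c k r \<longleftrightarrow> length r = stage_len f k \<and> M c \<le> cnt k r \<and> (\<forall>j<k. cnt j (take (stage_len f j) r) < M c)" for c k r
  define R where "R r n \<longleftrightarrow> (\<exists>c k. Hit c k r \<and> length r = n + c)" for r n
  have anti: "r = r'" if "Hit c k r" "Hit c k' r'" "prefix r r'" for c k k' r r'
  proof -
    have "stage_len f k \<le> stage_len f k'" using that prefix_length_le unfolding Hit_def by metis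
    then have "k \<le> k'" using strict_mono_stage_len strict_mono_less_eq by blast
    moreover have "\<not> k < k'"
    proof
      assume "k < k'"
      then have "cnt k (take (stage_len f k) r') < M c" using that(2) by (simp add: Hit_def)
      moreover have "take (stage_len f k) r' = r" using that(1,3) by (auto simp: Hit_def prefix_def)
      ultimately show False using that(1) by (simp add: Hit_def)
    qed
    ultimately have "length r = length r'" using that by (simp add: Hit_def)
    then show ?thesis using that(3) by (auto simp: prefix_def)
  qed
  have Hit_weight: "(\<Sum>r\<in>F. (1/2 :: real) ^ length r) \<le> (1/2) ^ (2 * c + 1)"
    if F: "finite F" "\<And>r. r \<in> F \<Longrightarrow> \<exists>k. Hit c k r" for F c
  proof -
    obtain kf where kf: "\<And>r. r \<in> F \<Longrightarrow> Hit c (kf r) r" using F(2) by metis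
    define K where "K = Max (insert 0 (kf ` F))"
    have K: "kf r \<le> K" if "r \<in> F" for r using that F(1) by (auto simp: K_def)
    have "real (M c) * (\<Sum>r\<in>F. (1/2) ^ length r) \<le> (\<Sum>s\<in>stage f K. (1/2) ^ length s)"
    proof (rule sum_antichain_multiplicity[OF F(1) _ finite_stage])
      show "antichain F" unfolding antichain_def using kf anti by blast
      fix r assume r: "r \<in> F"
      have "M c \<le> card {s\<in>stage f (kf r). prefix s r}" using kf[OF r] cnt by (simp add: Hit_def)
      also have "\<dots> \<le> card {s\<in>stage f K. prefix s r}"
        using stage_mono[OF K[OF r]] finite_stage by (intro card_mono) auto
      finally show "M c \<le> card {s\<in>stage f K. prefix s r}" .
    qed
    also have "\<dots> \<le> 2 ^ d" using weight[OF finite_stage stage_S] d by (meson order_trans)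
    finally have "2 ^ d * (2 ^ (2 * c + 1) * (\<Sum>r\<in>F. (1/2) ^ length r)) \<le> (2 :: real) ^ d * 1"
      by (simp add: M_def power_add mult.assoc mult.left_commute)
    then have "2 ^ (2 * c + 1) * (\<Sum>r\<in>F. (1/2 :: real) ^ length r) \<le> 1"
      by (simp only: mult_le_cancel_left_pos zero_less_power zero_less_numeral)
    then show ?thesis by (simp add: field_simps power_one_over)
  qed
  have R_ce: "ce (\<lambda>q. R (fst q) (snd q))"
    unfolding R_def Hit_def cnt_def stage_len_def M_def
    by (intro ce_intros; (rule ce_computable)?; intro computable_intros f(1)[THEN computable_compose])
  have R_weight: "(\<Sum>q\<in>F. (1/2 :: real) ^ snd q) \<le> 1"
    if F: "finite F" "\<And>r n. (r, n) \<in> F \<Longrightarrow> R r n" for F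
  proof -
    define cc where "cc q = length (fst q) - snd q" for q :: "bool list \<times> nat"
    have "(\<Sum>q\<in>F. (1/2 :: real) ^ snd q) = (\<Sum>c\<in>cc ` F. \<Sum>q\<in>{q\<in>F. cc q = c}. (1/2) ^ snd q)"
      by (rule sum.image_gen[OF F(1)])
    also have "\<dots> \<le> (\<Sum>c\<in>cc ` F. (1/2) ^ Suc c)"
    proof (rule sum_mono)
      fix c assume "c \<in> cc ` F"
      let ?Q = "{q\<in>F. cc q = c}"
      have q: "\<exists>k. Hit c k (fst q)" "length (fst q) = snd q + c" if "q \<in> ?Q" for q
      proof -
        have "R (fst q) (snd q)" using that F(2)[of "fst q" "snd q"] by simp
        then show "\<exists>k. Hit c k (fst q)" "length (fst q) = snd q + c"
          using that unfolding R_def cc_def by auto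
      qed
      have inj: "inj_on fst ?Q" by (rule inj_onI) (metis add_right_cancel prod_eqI q(2))
      have "(\<Sum>q\<in>?Q. (1/2 :: real) ^ snd q) = (\<Sum>q\<in>?Q. 2 ^ c * (1/2) ^ length (fst q))"
        by (rule sum.cong) (simp_all add: q(2) power_add power_one_over)
      also have "\<dots> = 2 ^ c * (\<Sum>r\<in>fst ` ?Q. (1/2) ^ length r)"
        by (simp add: sum.reindex[OF inj] sum_distrib_left)
      also have "\<dots> \<le> 2 ^ c * (1/2) ^ (2 * c + 1)"
        using F(1) q(1) by (intro mult_left_mono Hit_weight) auto
      also have "\<dots> = (1/2) ^ Suc c" by (simp add: power_add power_one_over power_mult power2_eq_square field_simps)
      finally show "(\<Sum>q\<in>?Q. (1/2 :: real) ^ snd q) \<le> (1/2) ^ Suc c" .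
    qed
    also have "\<dots> \<le> 1" using F(1) by (intro sum_half_powers_le) simp
    finally show ?thesis .
  qed
  obtain c0 where c0: "\<And>t r. R t r \<Longrightarrow> complexity U t \<le> enat (r + c0)"
    using Kraft_Chaitin[OF opt R_ce R_weight] by blast
  obtain cX where cX: "\<And>n. complexity U (X \<restriction> n) + enat cX > enat n"
    using rand unfolding martin_loef_random_def by blast
  define c where "c = c0 + cX"
  have "\<exists>k. M c \<le> cnt k (X \<restriction> stage_len f k)"
  proof -
    obtain T where T: "finite T" "card T = M c" "T \<subseteq> {s. S s \<and> initial s X}"
      using infinite_arbitrarily_large[OF inf] by blast
    then have "\<forall>s\<in>T. \<exists>i. f i = Some s" using f(2) by auto
    then obtain h where h: "\<And>s. s \<in> T \<Longrightarrow> f (h s) = Some s" by metis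
    define k where "k = Suc (Max (insert 0 (h ` T)))"
    have "h s < k" if "s \<in> T" for s using that T(1) by (auto simp: k_def less_Suc_eq_le)
    then have "T \<subseteq> stage f k" using h by (auto simp: stage_def)
    then have "T \<subseteq> {s\<in>stage f k. prefix s (X \<restriction> stage_len f k)}"
      using T(3) stage_len_ge by (auto simp: prefix_initial_segment)
    then have "M c \<le> cnt k (X \<restriction> stage_len f k)"
      unfolding cnt T(2)[symmetric] using finite_stage by (intro card_mono) auto
    then show ?thesis by blast
  qed
  then obtain k where k: "M c \<le> cnt k (X \<restriction> stage_len f k)" "\<forall>j<k. \<not> M c \<le> cnt j (X \<restriction> stage_len f j)"
    using exists_least_iff[of "\<lambda>k. M c \<le> cnt k (X \<restriction> stage_len f k)"] by auto
  have "stage_len f j \<le> stage_len f k" if "j < k" for j using that strict_mono_stage_len by (simp add: strict_mono_less_eq)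
  then have "Hit c k (X \<restriction> stage_len f k)" using k by (simp add: Hit_def min_def not_le)
  \<comment> \<open>A string has at most one prefix of each length, so a high count forces a long
    string; otherwise the difference of length and \<open>c\<close> would be truncated.\<close>
  moreover have "c \<le> stage_len f k"
  proof -
    have "c < 2 ^ c" by (rule less_exp)
    also have "(2 :: nat) ^ c \<le> M c" unfolding M_def by (rule power_increasing) auto
    also have "\<dots> \<le> Suc (stage_len f k)"
      using k(1) card_prefixes_le[of "\<lambda>s. s \<in> stage f k" "X \<restriction> stage_len f k"] by (simp add: cnt)
    finally show ?thesis by simp
  qed
  ultimately have "R (X \<restriction> stage_len f k) (stage_len f k - c)" unfolding R_def by (intro exI[of _ c] exI[of _ k]) simp
  then have "complexity U (X \<restriction> stage_len f k) \<le> enat (stage_len f k - c + c0)" by (rule c0)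
  then have "complexity U (X \<restriction> stage_len f k) + enat cX \<le> enat (stage_len f k - c + c0) + enat cX" by (rule add_right_mono)
  also have "\<dots> = enat (stage_len f k)" using \<open>c \<le> stage_len f k\<close> by (simp add: c_def)
  finally show False using cX[of "stage_len f k"] by simp
qed

subsection \<open>Covering the requests along a K-trivial set\<close>

text \<open>
  A request \<open>j\<close> consists of a string \<open>tau j\<close> and an exponent \<open>rr j\<close>. A path lists nested attempts, the innermost
  first: the entry \<open>(j, m)\<close> stands for the \<open>m\<close>-th of the \<open>2 ^ (j + 1)\<close> units into which the weight of request \<open>j\<close>
  is split. An attempt is returned (\<open>Ret\<close>) when it has supplied its goal \<open>(1/2) ^ gl u\<close>. It is upgraded (\<open>Upg\<close>)
  when every leaf spent on it has been paid for with a description of a string that extends the string of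
  the parent but lies outside the cone of the attempt itself; its weight then counts towards the goal of the
  parent. It is synchronised (\<open>Syn\<close>) when no incompatible sibling returned before it still awaits its
  upgrade, so that synchronised attempts without an upgrade are pairwise compatible. Events are recorded
  newest first.
\<close>

type_synonym path = "(nat \<times> nat) list"
type_synonym event = "nat \<times> path"

abbreviation (input) Ret :: "path \<Rightarrow> event" where "Ret u \<equiv> (0, u)"
abbreviation (input) Syn :: "path \<Rightarrow> event" where "Syn u \<equiv> (1, u)"
abbreviation (input) Upg :: "path \<Rightarrow> event" where "Upg u \<equiv> (2, u)"

definition compat :: "bool list \<Rightarrow> bool list \<Rightarrow> bool" where
  "compat s t \<longleftrightarrow> prefix s t \<or> prefix t s"

lemma compat_initial: "initial s A \<Longrightarrow> initial t A \<Longrightarrow> compat s t"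
  unfolding compat_def by (meson initial_same_prefix nat_le_linear)

text \<open>With the newest event first, an earlier return stands further to the right.\<close>

definition older :: "event list \<Rightarrow> path \<Rightarrow> path \<Rightarrow> bool" where
  "older L w u \<longleftrightarrow> (\<exists>i<length L. case drop i L of [] \<Rightarrow> False | q # r \<Rightarrow> q = Ret u \<and> Ret w \<in> set r)"

lemma older_iff: "older L w u \<longleftrightarrow> (\<exists>X r. L = X @ Ret u # r \<and> Ret w \<in> set r)"
proof
  assume "older L w u"
  then obtain i where i: "case drop i L of [] \<Rightarrow> False | q # r \<Rightarrow> q = Ret u \<and> Ret w \<in> set r"
    unfolding older_def by blast
  then obtain r where "drop i L = Ret u # r" "Ret w \<in> set r" by (cases "drop i L") auto
  then show "\<exists>X r. L = X @ Ret u # r \<and> Ret w \<in> set r"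
    by (metis append_take_drop_id)
next
  assume "\<exists>X r. L = X @ Ret u # r \<and> Ret w \<in> set r"
  then obtain X r where "L = X @ Ret u # r" "Ret w \<in> set r" by blast
  then show "older L w u" unfolding older_def by (intro exI[of _ "length X"]) simp
qed

definition kids :: "event list \<Rightarrow> nat \<Rightarrow> path \<Rightarrow> path list" where
  "kids L e v = map snd (filter (\<lambda>q. fst q = e \<and> snd q \<noteq> [] \<and> tl (snd q) = v) L)"

lemma set_kids: "set (kids L e v) = {w. (e, w) \<in> set L \<and> w \<noteq> [] \<and> tl w = v}"
  by (force simp: kids_def)

lemma length_kid: "w \<in> set (kids L e v) \<Longrightarrow> length w = Suc (length v)"
proof -
  assume "w \<in> set (kids L e v)"
  then have "w \<noteq> []" "tl w = v" by (simp_all add: set_kids)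
  then show ?thesis by (cases w) auto
qed

lemma distinct_kids: "distinct L \<Longrightarrow> distinct (kids L e v)"
  unfolding kids_def by (auto simp: distinct_map inj_on_def prod_eq_iff)

text \<open>Paths begin with the innermost attempt, so the ancestors of a leaf are the suffixes of
  its path.\<close>

definition below :: "path \<Rightarrow> path \<Rightarrow> bool" where
  "below u l \<longleftrightarrow> (\<exists>i<Suc (length l). drop i l = u)"

text \<open>The weight of \<open>l\<close> has been handed on from attempt to parent until it counts
  for \<open>u\<close>; the attempt \<open>u\<close> itself may still await its upgrade.\<close>

definition above_upgraded :: "event list \<Rightarrow> path \<Rightarrow> path \<Rightarrow> bool" where
  "above_upgraded L u l \<longleftrightarrow> (\<exists>i<Suc (length l). drop i l = u \<and> (\<forall>j<i. Upg (drop j l) \<in> set L))"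

definition leaves :: "nat \<Rightarrow> event list \<Rightarrow> path \<Rightarrow> path list" where
  "leaves D L u = map snd (filter (\<lambda>q. fst q = 0 \<and> length (snd q) = D \<and> above_upgraded L u (snd q)) L)"

lemma set_leaves: "set (leaves D L u) = {l. Ret l \<in> set L \<and> length l = D \<and> above_upgraded L u l}"
  by (force simp: leaves_def)

text \<open>
  With triviality constant \<open>d\<close> the opponent pays \<open>(1/2) ^ (2 * d)\<close> per unit weight of a leaf on every level, and
  the payments on different levels are disjoint; with this many levels they exceed \<open>1\<close>.
\<close>

definition depth :: "nat \<Rightarrow> nat" where
  "depth d = 2 ^ (2 * d + 1) + 1"

text \<open>Requests are indexed by the stages of an enumeration, and \<open>inst j\<close> says
  that stage \<open>j\<close> issues one; thus all data are total. Pairwise compatibility is the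
  finite form of lying along a common set. The function \<open>out\<close> will enumerate the graph
  of the optimal machine.\<close>

locale decanter =
  fixes tau :: "nat \<Rightarrow> bool list" and rr :: "nat \<Rightarrow> nat" and inst :: "nat \<Rightarrow> bool"
    and out :: "nat \<Rightarrow> (bool list \<times> bool list) option"
  assumes computable_tau: "computable tau" and computable_rr: "computable rr"
    and computable_inst: "computable inst" and computable_out: "computable out"
    and inst_weight: "\<And>J. finite J \<Longrightarrow> (\<And>j. j \<in> J \<Longrightarrow> inst j) \<Longrightarrow>
      (\<And>i j. i \<in> J \<Longrightarrow> j \<in> J \<Longrightarrow> compat (tau i) (tau j)) \<Longrightarrow> (\<Sum>j\<in>J. (1/2 :: real) ^ rr j) \<le> 1"
begin

definition sig :: "path \<Rightarrow> bool list" where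
  "sig u = (case u of [] \<Rightarrow> [] | p # v \<Rightarrow> tau (fst p))"

lemma sig_simps [simp]: "sig [] = []" "sig (p # v) = tau (fst p)"
  by (simp_all add: sig_def)

text \<open>
  The \<open>2 ^ (j + 1)\<close> units of request \<open>j\<close> together weigh \<open>(1/2) ^ rr j\<close>, scaled down by the factor
  \<open>(1/2) ^ (gl v + length v + 4)\<close> (the fee) that bounds what is lost to attempts which are never upgraded.
\<close>

primrec gl :: "path \<Rightarrow> nat" where
  "gl [] = 1"
| "gl (p # v) = gl v + length v + 5 + rr (fst p) + fst p"

text \<open>Units of one request are tried one after another, each waiting for its predecessor to be
  synchronised. So at most one unit per request is in progress, and the weight blocked there is
  summable over all requests.\<close>

definition started_at :: "event list \<Rightarrow> path \<Rightarrow> bool" where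
  "started_at L u \<longleftrightarrow> (case u of [] \<Rightarrow> True | p # v \<Rightarrow> inst (fst p) \<and> prefix (sig v) (tau (fst p)) \<and>
     snd p < 2 ^ Suc (fst p) \<and> (snd p = 0 \<or> Syn ((fst p, snd p - 1) # v) \<in> set L))"

definition started :: "event list \<Rightarrow> path \<Rightarrow> bool" where
  "started L u \<longleftrightarrow> (\<forall>i<length u. started_at L (drop i u))"

lemma started_Nil [simp]: "started L []"
  by (simp add: started_def)

lemma started_Cons: "started L (p # v) \<longleftrightarrow> started_at L (p # v) \<and> started L v"
  by (auto simp: started_def less_Suc_eq_0_disj)

text \<open>Multiplied by \<open>2 ^ G\<close> to be computable. In real numbers, as in
  \<open>reached_iff\<close>: the upgraded children of \<open>v\<close> weigh at least the goal of
  \<open>v\<close>.\<close>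

definition reached :: "event list \<Rightarrow> path \<Rightarrow> bool" where
  "reached L v \<longleftrightarrow> (let G = gl v + sum_list (map gl (kids L 2 v)) in
     2 ^ (G - gl v) \<le> (sum_list (map (\<lambda>w. 2 ^ (G - gl w)) (kids L 2 v)) :: nat))"

text \<open>
  K-triviality is exploited at these lengths, which are different for different paths.
\<close>

definition num :: "nat \<Rightarrow> path \<Rightarrow> nat" where
  "num d u = prod_encode (enc (d, u), length (sig u))"

text \<open>The payment that K-triviality forces when \<open>A\<close> stays in the cone of the
  parent of \<open>u\<close> but leaves that of \<open>u\<close>: the described string is then
  \<open>A \<restriction> num d l\<close>. In the bound, one \<open>d\<close> covers the share of
  run \<open>d\<close> and the other all additive constants.\<close>

definition paid :: "nat \<Rightarrow> path \<Rightarrow> path \<Rightarrow> nat \<Rightarrow> bool" where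
  "paid d u l i \<longleftrightarrow> (case out i of None \<Rightarrow> False | Some q \<Rightarrow> length (fst q) \<le> gl l + 2 * d
     \<and> length (snd q) = num d l \<and> prefix (sig (tl u)) (snd q) \<and> \<not> prefix (sig u) (snd q))"

text \<open>Upgrades are blocked once the parent has reached its goal. Therefore upgraded children
  overshoot the goal by at most one child, and a returned attempt gains no further leaves.\<close>

definition enabled :: "nat \<Rightarrow> nat \<Rightarrow> event list \<Rightarrow> event \<Rightarrow> bool" where
  "enabled d s L e \<longleftrightarrow>
     fst e = 0 \<and> started L (snd e) \<and> length (snd e) \<le> depth d \<and> (length (snd e) = depth d \<or> reached L (snd e))
   \<or> fst e = 1 \<and> snd e \<noteq> [] \<and> Ret (snd e) \<in> set L \<and>
       (\<forall>w\<in>set (kids L 0 (tl (snd e))). older L w (snd e) \<and> \<not> compat (sig w) (sig (snd e)) \<longrightarrow> Upg w \<in> set L)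
   \<or> fst e = 2 \<and> snd e \<noteq> [] \<and> Ret (snd e) \<in> set L \<and> \<not> reached L (tl (snd e)) \<and>
       (\<forall>l\<in>set (leaves (depth d) L (snd e)). \<exists>i<s. paid d (snd e) l i)"

text \<open>A stage tries only the event coded in its first component, so every event is tried at
  infinitely many stages.\<close>

definition events :: "nat \<Rightarrow> nat \<Rightarrow> event list" where
  "events d s = rec_nat [] (\<lambda>s L. let e = dec (fst (prod_decode s)) in
     if e \<notin> set L \<and> enabled d s L e then e # L else L) s"

lemma gl_foldr: "(gl u, length u) = foldr (\<lambda>p a. (fst a + snd a + 5 + rr (fst p) + fst p, Suc (snd a))) u (1, 0)"
  by (induction u) (auto simp: prod_eq_iff)

lemma computable_gl [computable_intros]:
  assumes "computable f" shows "computable (\<lambda>x. gl (f x))"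
proof -
  have *: "gl u = fst (foldr (\<lambda>p a. (fst a + snd a + 5 + rr (fst p) + fst p, Suc (snd a))) u (1, 0))" for u
    by (metis fst_conv gl_foldr)
  show ?thesis unfolding * by (intro computable_intros assms computable_rr[THEN computable_compose])
qed

lemma computable_sig [computable_intros]:
  assumes "computable f" shows "computable (\<lambda>x. sig (f x))"
  unfolding sig_def by (intro computable_intros assms computable_tau[THEN computable_compose])

lemma computable_started [computable_intros]:
  assumes "computable L" "computable u" shows "computable (\<lambda>x. started (L x) (u x))"
  unfolding started_def started_at_def
  by (intro computable_intros assms[THEN computable_compose] computable_tau[THEN computable_compose]
      computable_inst[THEN computable_compose])

lemma computable_kids [computable_intros]:
  assumes "computable L" "computable e" "computable u" shows "computable (\<lambda>x. kids (L x) (e x) (u x))"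
  unfolding kids_def by (intro computable_intros assms[THEN computable_compose])

lemma computable_reached [computable_intros]:
  assumes "computable L" "computable u" shows "computable (\<lambda>x. reached (L x) (u x))"
  unfolding reached_def Let_def by (intro computable_intros assms[THEN computable_compose])

lemma computable_compat [computable_intros]:
  assumes "computable L" "computable u" shows "computable (\<lambda>x. compat (L x) (u x))"
  unfolding compat_def by (intro computable_intros assms[THEN computable_compose])

lemma computable_older [computable_intros]:
  assumes "computable L" "computable w" "computable u" shows "computable (\<lambda>x. older (L x) (w x) (u x))"
  unfolding older_def by (intro computable_intros assms[THEN computable_compose])

lemma computable_leaves [computable_intros]:
  assumes "computable D" "computable L" "computable u" shows "computable (\<lambda>x. leaves (D x) (L x) (u x))"
  unfolding leaves_def above_upgraded_def by (intro computable_intros assms[THEN computable_compose])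

lemma computable_depth [computable_intros]:
  assumes "computable d" shows "computable (\<lambda>x. depth (d x))"
  unfolding depth_def by (intro computable_intros assms[THEN computable_compose])

lemma computable_num [computable_intros]:
  assumes "computable d" "computable u" shows "computable (\<lambda>x. num (d x) (u x))"
  unfolding num_def by (intro computable_intros assms[THEN computable_compose])

lemma computable_paid [computable_intros]:
  assumes "computable d" "computable u" "computable l" "computable i"
  shows "computable (\<lambda>x. paid (d x) (u x) (l x) (i x))"
  unfolding paid_def
  by (intro computable_intros assms[THEN computable_compose] computable_out[THEN computable_compose])

lemma computable_enabled [computable_intros]:
  assumes "computable d" "computable s" "computable L" "computable e"
  shows "computable (\<lambda>x. enabled (d x) (s x) (L x) (e x))"
  unfolding enabled_def by (intro computable_intros assms[THEN computable_compose])

lemma computable_events [computable_intros]: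
  assumes "computable d" "computable s" shows "computable (\<lambda>x. events (d x) (s x))"
  unfolding events_def Let_def by (intro computable_intros assms[THEN computable_compose])

section \<open>Growth, fairness and order of the events\<close>

lemma events_0 [simp]: "events d 0 = []"
  by (simp add: events_def)

lemma events_Suc: "events d (Suc s) = (let e = dec (fst (prod_decode s)) in
    if e \<notin> set (events d s) \<and> enabled d s (events d s) e then e # events d s else events d s)"
  by (simp add: events_def Let_def)

lemma distinct_events: "distinct (events d s)"
  by (induction s) (auto simp: events_Suc Let_def)

lemma events_append: "s \<le> t \<Longrightarrow> \<exists>X. events d t = X @ events d s"
proof (induction t rule: dec_induct)
  case (step n)
  then show ?case by (auto simp: events_Suc Let_def)
qed simp

lemma events_mono: "s \<le> t \<Longrightarrow> set (events d s) \<subseteq> set (events d t)"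
  by (metis Un_upper2 events_append set_append)

lemma events_entered:
  assumes "e \<in> set (events d t)"
  obtains s where "s < t" "e \<notin> set (events d s)" "enabled d s (events d s) e" "events d (Suc s) = e # events d s"
proof -
  have "\<exists>s<t. e \<notin> set (events d s) \<and> enabled d s (events d s) e \<and> events d (Suc s) = e # events d s"
    using assms
  proof (induction t)
    case (Suc t)
    show ?case
    proof (cases "e \<in> set (events d t)")
      case True
      then show ?thesis using Suc.IH less_SucI by blast
    next
      case False
      then show ?thesis using Suc.prems by (intro exI[of _ t]) (auto simp: events_Suc Let_def split: if_splits)
    qed
  qed simp
  then show ?thesis using that by blast
qed

lemma events_fair:
  assumes "\<And>s. s0 \<le> s \<Longrightarrow> e \<notin> set (events d s) \<Longrightarrow> enabled d s (events d s) e"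
  shows "\<exists>s. e \<in> set (events d s)"
proof (rule ccontr)
  assume no: "\<nexists>s. e \<in> set (events d s)"
  \<comment> \<open>The second component is free and pushes the stage past
    \<open>s0\<close>.\<close>
  define s where "s = prod_encode (enc e, s0)"
  have "s0 \<le> s" by (simp add: s_def le_prod_encode_2)
  then have "enabled d s (events d s) e" using assms no by blast
  then have "e \<in> set (events d (Suc s))" using no by (simp add: events_Suc s_def)
  then show False using no by blast
qed

lemma reached_iff:
  assumes "distinct L"
  shows "reached L v \<longleftrightarrow> (1/2 :: real) ^ gl v \<le> (\<Sum>w\<in>set (kids L 2 v). (1/2) ^ gl w)"
proof -
  define G where "G = gl v + sum_list (map gl (kids L 2 v))"
  have le: "gl w \<le> G" if "w \<in> set (kids L 2 v)" for w
    using member_le_sum_list[of "gl w" "map gl (kids L 2 v)"] that by (simp add: G_def)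
  have "reached L v \<longleftrightarrow> real (2 ^ (G - gl v)) \<le> real (sum_list (map (\<lambda>w. 2 ^ (G - gl w)) (kids L 2 v)))"
    unfolding reached_def Let_def G_def[symmetric] of_nat_le_iff by (rule refl)
  also have "real (sum_list (map (\<lambda>w. 2 ^ (G - gl w)) (kids L 2 v))) = (\<Sum>w\<in>set (kids L 2 v). 2 ^ (G - gl w))"
    using distinct_kids[OF assms] by (simp add: sum_list_distinct_conv_sum_set)
  also have "\<dots> = (\<Sum>w\<in>set (kids L 2 v). 2 ^ G * (1/2) ^ gl w)"
    by (rule sum.cong) (simp_all add: half_power_diff le)
  also have "\<dots> = 2 ^ G * (\<Sum>w\<in>set (kids L 2 v). (1/2) ^ gl w)" by (simp add: sum_distrib_left)
  also have "real (2 ^ (G - gl v)) = 2 ^ G * (1/2) ^ gl v" 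
  proof -
    have "gl v \<le> G" by (simp add: G_def)
    then show ?thesis by (simp add: half_power_diff)
  qed
  finally show ?thesis by simp
qed

lemma kids_mono: "s \<le> t \<Longrightarrow> set (kids (events d s) e v) \<subseteq> set (kids (events d t) e v)"
  using events_mono[of s t d] by (auto simp: set_kids)

lemma reached_mono:
  assumes "reached (events d s) v" "s \<le> t" shows "reached (events d t) v"
proof -
  have "(\<Sum>w\<in>set (kids (events d s) 2 v). (1/2 :: real) ^ gl w)
      \<le> (\<Sum>w\<in>set (kids (events d t) 2 v). (1/2) ^ gl w)"
    using kids_mono[OF assms(2)] by (intro sum_mono2) auto
  then show ?thesis using assms(1) by (simp add: reached_iff distinct_events)
qed

lemma started_mono: "started (events d s) u \<Longrightarrow> s \<le> t \<Longrightarrow> started (events d t) u"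
  using events_mono[of s t d]
  by (induction u) (auto simp: started_Cons started_at_def)

lemma started_drop: "started L u \<Longrightarrow> started L (drop i u)"
  by (auto simp: started_def)

lemma started_sig: "started L u \<Longrightarrow> prefix (sig (drop i u)) (sig u)"
proof (induction u arbitrary: i)
  case (Cons p v)
  show ?case
  proof (cases i)
    case (Suc j)
    have "prefix (sig (drop j v)) (sig v)" using Cons by (simp add: started_Cons)
    moreover have "prefix (sig v) (sig (p # v))"
      using Cons.prems by (simp add: started_Cons started_at_def)
    ultimately show ?thesis using Suc prefix_order.trans by auto
  qed simp
qed simp

lemma Ret_D:
  assumes "Ret u \<in> set (events d t)"
  shows "started (events d t) u" "length u \<le> depth d" "length u = depth d \<or> reached (events d t) u"
proof -
  from assms obtain s where "s < t" "enabled d s (events d s) (Ret u)" by (elim events_entered)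
  then show "started (events d t) u" "length u \<le> depth d" "length u = depth d \<or> reached (events d t) u"
    using started_mono[of d s u t] reached_mono[of d s u t] by (auto simp: enabled_def)
qed

lemma Syn_D:
  assumes "Syn u \<in> set (events d t)" shows "Ret u \<in> set (events d t)" "u \<noteq> []"
proof -
  from assms obtain s where "s < t" "enabled d s (events d s) (Syn u)" by (elim events_entered)
  then show "Ret u \<in> set (events d t)" "u \<noteq> []"
    using events_mono[of s t d] by (auto simp: enabled_def)
qed

lemma Upg_D:
  assumes "Upg u \<in> set (events d t)" shows "Ret u \<in> set (events d t)" "u \<noteq> []"
proof -
  from assms obtain s where "s < t" "enabled d s (events d s) (Upg u)" by (elim events_entered)
  then show "Ret u \<in> set (events d t)" "u \<noteq> []"
    using events_mono[of s t d] by (auto simp: enabled_def)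
qed

text \<open>The log grows only at the front and has no repetitions, so what returned before
  \<open>u\<close> is settled when \<open>u\<close> returns.\<close>

lemma older_same:
  assumes "older (events d t) w u" "Ret u \<in> set (events d s)" "s \<le> t"
  shows "older (events d s) w u"
proof -
  obtain X where X: "events d t = X @ events d s" using events_append[OF assms(3)] by blast
  obtain Y r where Y: "events d t = Y @ Ret u # r" "Ret w \<in> set r" using assms(1) older_iff by blast
  obtain Z q where Z: "events d s = Z @ Ret u # q" using assms(2) by (meson split_list)
  have "(X @ Z) @ Ret u # q = Y @ Ret u # r" using X Y Z by simp
  moreover have "Ret u \<notin> set (X @ Z)" "Ret u \<notin> set q"
  proof -
    have "distinct (Y @ Ret u # r)" "distinct ((X @ Z) @ Ret u # q)"
      using distinct_events[of t d] distinct_events[of d t] X Y Z by simp_all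
    then show "Ret u \<notin> set (X @ Z)" "Ret u \<notin> set q" by auto
  qed
  ultimately have "q = r" using append_Cons_eq_iff[of "Ret u" "X @ Z" q Y r] by simp
  then show ?thesis using Z Y older_iff by blast
qed

lemma older_total:
  assumes "Ret u \<in> set L" "Ret w \<in> set L" "u \<noteq> w" shows "older L w u \<or> older L u w"
proof -
  obtain X r where X: "L = X @ Ret u # r" using assms(1) by (meson split_list)
  show ?thesis
  proof (cases "Ret w \<in> set r")
    case True
    then show ?thesis using X older_iff by blast
  next
    case False
    then have "Ret w \<in> set X" using assms(2,3) X by auto
    then obtain Y q where "X = Y @ Ret w # q" by (meson split_list)
    then have "L = Y @ Ret w # (q @ Ret u # r)" using X by simp
    then show ?thesis unfolding older_iff by (intro disjI2 exI[of _ Y] exI[of _ "q @ Ret u # r"]) simp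
  qed
qed

lemma Syn_older:
  assumes "Syn u \<in> set (events d t)" "Ret w \<in> set (events d t)" "w \<noteq> []" "tl w = tl u"
    and "older (events d t) w u" "\<not> compat (sig w) (sig u)"
  shows "Upg w \<in> set (events d t)"
proof -
  from assms(1) obtain s where s: "s < t" "enabled d s (events d s) (Syn u)" by (elim events_entered)
  then have u: "Ret u \<in> set (events d s)" by (simp add: enabled_def)
  then have old: "older (events d s) w u" using older_same assms(5) s(1) less_imp_le by blast
  then have "Ret w \<in> set (events d s)" unfolding older_iff by auto
  then have "w \<in> set (kids (events d s) 0 (tl u))" using assms by (simp add: set_kids)
  then have "Upg w \<in> set (events d s)" using s(2) old assms(6) by (auto simp: enabled_def)
  then show ?thesis using events_mono s(1) less_imp_le by blast
qed

text \<open>One of the two returned first. Had it been incompatible with the other, the other could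
  not have been synchronised before its upgrade.\<close>

lemma Syn_compat:
  assumes "Syn u \<in> set (events d t)" "Syn w \<in> set (events d t)" "tl w = tl u"
    and "Upg u \<notin> set (events d t)" "Upg w \<notin> set (events d t)"
  shows "compat (sig u) (sig w)"
proof (cases "u = w")
  case False
  have "older (events d t) w u \<or> older (events d t) u w"
    using older_total[OF Syn_D(1)[OF assms(1)] Syn_D(1)[OF assms(2)] False] .
  then show ?thesis
  proof
    assume "older (events d t) w u"
    from Syn_older[OF assms(1) Syn_D[OF assms(2)] assms(3) this] have "compat (sig w) (sig u)"
      using assms(5) by metis
    then show ?thesis by (auto simp: compat_def)
  next
    assume "older (events d t) u w"
    from Syn_older[OF assms(2) Syn_D[OF assms(1)] assms(3)[symmetric] this] show ?thesis
      using assms(4) by metis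
  qed
qed (simp add: compat_def)

text \<open>An attempt above leaf level returns only after reaching its goal, and from then on its
  children are barred from upgrades.\<close>

lemma Upg_before_reached:
  assumes "Ret u \<in> set (events d s)" "length u < depth d" "Upg w \<in> set (events d t)" "tl w = u"
  shows "Upg w \<in> set (events d s)"
proof (rule ccontr)
  assume no: "Upg w \<notin> set (events d s)"
  from assms(3) obtain s' where s': "enabled d s' (events d s') (Upg w)" "events d (Suc s') = Upg w # events d s'"
    by (elim events_entered)
  have "s \<le> s'"
  proof (rule ccontr)
    assume "\<not> s \<le> s'"
    then have "set (events d (Suc s')) \<subseteq> set (events d s)" by (intro events_mono) simp
    then show False using s'(2) no by simp
  qed
  moreover have "reached (events d s) u" using Ret_D(3)[OF assms(1)] assms(2) by simp
  ultimately have "reached (events d s') u" using reached_mono by blast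
  then show False using s'(1) assms(4) by (simp add: enabled_def)
qed

lemma leaves_mono:
  assumes "s \<le> t" shows "set (leaves D (events d s) u) \<subseteq> set (leaves D (events d t) u)"
proof -
  have "above_upgraded (events d s) u l \<Longrightarrow> above_upgraded (events d t) u l" for l
    using events_mono[OF assms, of d] unfolding above_upgraded_def by blast
  then show ?thesis using events_mono[OF assms, of d] by (auto simp: set_leaves)
qed

text \<open>An upgrade needs payment for all leaves of the attempt; that wait could be endless if
  new leaves kept arriving after the return.\<close>

lemma leaves_frozen:
  assumes "Ret u \<in> set (events d s)" "s \<le> t"
  shows "set (leaves (depth d) (events d t) u) = set (leaves (depth d) (events d s) u)"
proof
  show "set (leaves (depth d) (events d t) u) \<subseteq> set (leaves (depth d) (events d s) u)"
  proof
    fix l assume "l \<in> set (leaves (depth d) (events d t) u)"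
    then obtain i where l: "Ret l \<in> set (events d t)" "length l = depth d" and i: "i < Suc (length l)"
      "drop i l = u" "\<forall>j<i. Upg (drop j l) \<in> set (events d t)"
      by (auto simp: set_leaves above_upgraded_def)
    \<comment> \<open>Walk from \<open>u\<close> inwards to \<open>l\<close>: each attempt on the
      way has returned by stage \<open>s\<close> and so admits no later upgrade of a child.\<close>
    have *: "j \<le> i \<Longrightarrow> Ret (drop (i - j) l) \<in> set (events d s) \<and> (\<forall>k<i. i - j \<le> k \<longrightarrow> Upg (drop k l) \<in> set (events d s))" for j
    proof (induction j)
      case 0
      then show ?case using assms i by auto
    next
      case (Suc j)
      let ?v = "drop (i - j) l" and ?w = "drop (i - Suc j) l"
      have eq: "i - j = Suc (i - Suc j)" using Suc.prems by simp
      have tl: "tl ?w = ?v" unfolding eq by (simp add: drop_Suc tl_drop)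
      have "Upg ?w \<in> set (events d t)" using i Suc.prems by auto
      moreover have "length ?v < depth d" using l i(1) eq by simp
      ultimately have U: "Upg ?w \<in> set (events d s)"
        using Upg_before_reached[of ?v d s ?w t] Suc tl by auto
      then have "Ret ?w \<in> set (events d s)" by (rule Upg_D)
      moreover have "Upg (drop k l) \<in> set (events d s)" if "k < i" "i - Suc j \<le> k" for k
      proof (cases "k = i - Suc j")
        case False
        then have "i - j \<le> k" using that eq by simp
        then show ?thesis using Suc that by auto
      qed (use U in simp)
      ultimately show ?case by blast
    qed
    from *[of i] have "Ret l \<in> set (events d s)" "\<forall>k<i. Upg (drop k l) \<in> set (events d s)" by auto
    then show "l \<in> set (leaves (depth d) (events d s) u)"
      using l i by (auto simp: set_leaves above_upgraded_def)
  qed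
qed (rule leaves_mono[OF assms(2)])

text \<open>The upgraded children add up to the goal of \<open>u\<close>, and inductively the goal
  of each child is made of leaves. Leaf sets of different children are disjoint, as a leaf
  determines its ancestor on every level.\<close>

lemma leaves_weight:
  assumes "Ret u \<in> set (events d t)"
  shows "(1/2 :: real) ^ gl u \<le> (\<Sum>l\<in>set (leaves (depth d) (events d t) u). (1/2) ^ gl l)"
  using assms
proof (induction "depth d - length u" arbitrary: u)
  case 0
  then have "length u = depth d" using Ret_D(2)[OF 0(2)] by simp
  then have "u \<in> set (leaves (depth d) (events d t) u)"
    using 0 by (auto simp: set_leaves above_upgraded_def)
  then show ?case by (intro member_le_sum) auto
next
  case (Suc n)
  let ?lv = "\<lambda>u. set (leaves (depth d) (events d t) u)" and ?K = "set (kids (events d t) 2 u)"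
  have "reached (events d t) u" using Ret_D(3)[OF Suc.prems] Suc.hyps(2) by auto
  then have "(1/2 :: real) ^ gl u \<le> (\<Sum>w\<in>?K. (1/2) ^ gl w)" by (simp add: reached_iff distinct_events)
  also have "\<dots> \<le> (\<Sum>w\<in>?K. \<Sum>l\<in>?lv w. (1/2) ^ gl l)"
  proof (rule sum_mono)
    fix w assume w: "w \<in> ?K"
    then have "length w = Suc (length u)" by (rule length_kid)
    then have "n = depth d - length w" using Suc.hyps(2) by simp
    moreover have "Ret w \<in> set (events d t)" using w by (intro Upg_D) (simp add: set_kids)
    ultimately show "(1/2 :: real) ^ gl w \<le> (\<Sum>l\<in>?lv w. (1/2) ^ gl l)" using Suc.hyps(1) by blast
  qed
  also have "\<dots> = (\<Sum>l\<in>(\<Union>w\<in>?K. ?lv w). (1/2) ^ gl l)"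
  proof (rule sum.UNION_disjoint[symmetric])
    show "\<forall>i\<in>?K. \<forall>j\<in>?K. i \<noteq> j \<longrightarrow> ?lv i \<inter> ?lv j = {}"
    proof (intro ballI impI equals0I)
      fix v w l assume *: "v \<in> ?K" "w \<in> ?K" "v \<noteq> w" "l \<in> ?lv v \<inter> ?lv w"
      have "length v = Suc (length u)" "length w = Suc (length u)"
        using * by (auto intro: length_kid)
      moreover obtain i j where "i \<le> length l" "j \<le> length l" "drop i l = v" "drop j l = w"
        using *(4) by (auto simp: set_leaves above_upgraded_def less_Suc_eq_le)
      ultimately have "i = j" by auto
      then show False using \<open>drop i l = v\<close> \<open>drop j l = w\<close> *(3) by simp
    qed
  qed auto
  also have "\<dots> \<le> (\<Sum>l\<in>?lv u. (1/2) ^ gl l)"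
  proof (rule sum_mono2)
    show "(\<Union>w\<in>?K. ?lv w) \<subseteq> ?lv u"
    proof
      fix l assume "l \<in> (\<Union>w\<in>?K. ?lv w)"
      then obtain w where wl: "w \<in> ?K" "l \<in> ?lv w" by blast
      then have w: "Upg w \<in> set (events d t)" "w \<noteq> []" "tl w = u" by (simp_all add: set_kids)
      have l: "Ret l \<in> set (events d t)" "length l = depth d" using wl by (simp_all add: set_leaves)
      obtain i where i: "i < Suc (length l)" "drop i l = w" "\<forall>j<i. Upg (drop j l) \<in> set (events d t)"
        using wl(2) unfolding set_leaves above_upgraded_def by blast
      have "i < length l" using i(2) w(2) by (cases "i < length l") auto
      moreover have "drop (Suc i) l = u" using i(2) w(3) by (metis drop_Suc tl_drop)
      moreover have "\<forall>j<Suc i. Upg (drop j l) \<in> set (events d t)"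
        using i(2,3) w(1) less_Suc_eq by metis
      ultimately have "above_upgraded (events d t) u l"
        unfolding above_upgraded_def by (intro exI[of _ "Suc i"]) blast
      then show "l \<in> ?lv u" using l by (simp add: set_leaves)
    qed
  qed auto
  finally show ?case .
qed

lemma Upg_paid:
  assumes "Upg u \<in> set (events d t)" "l \<in> set (leaves (depth d) (events d t) u)"
  shows "\<exists>i. paid d u l i"
proof -
  from assms(1) obtain s where s: "s < t" "enabled d s (events d s) (Upg u)" by (elim events_entered)
  then have "Ret u \<in> set (events d s)" by (simp add: enabled_def)
  then have "l \<in> set (leaves (depth d) (events d s) u)" using leaves_frozen s(1) assms(2) less_imp_le by blast
  then have "\<exists>i<s. paid d u l i" using s(2) by (auto simp: enabled_def)
  then show ?thesis by blast
qed

end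

section \<open>Bounds on the weight that attempts consume\<close>

lemma sum_UN_le:
  fixes f :: "'a \<Rightarrow> real"
  assumes "finite I" "\<And>i. i \<in> I \<Longrightarrow> finite (A i)" "\<And>x. 0 \<le> f x"
  shows "sum f (\<Union>i\<in>I. A i) \<le> (\<Sum>i\<in>I. sum f (A i))"
  using assms(1,2)
proof (induction I rule: finite_induct)
  case (insert i I)
  have "sum f (A i \<union> (\<Union>i\<in>I. A i)) + sum f (A i \<inter> (\<Union>i\<in>I. A i)) = sum f (A i) + sum f (\<Union>i\<in>I. A i)"
    using insert by (intro sum.union_inter) auto
  moreover have "0 \<le> sum f (A i \<inter> (\<Union>i\<in>I. A i))" by (intro sum_nonneg assms(3))
  ultimately show ?case using insert by simp
qed simp

context decanter
begin

lemma num_inject: "num d u = num d' u' \<longleftrightarrow> d = d' \<and> u = u'"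
  unfolding num_def by (metis dec_enc fst_conv prod.inject prod_encode_eq)

lemma length_sig_le_num: "length (sig u) \<le> num d u"
  unfolding num_def by (rule le_prod_encode_2)

definition fee :: "path \<Rightarrow> real" where
  "fee u = (1/2) ^ (gl u + length u + 4)"

lemma weight_kid: "(1/2 :: real) ^ gl ((j, m) # u) = fee u * (1/2) ^ rr j * (1/2) ^ Suc j"
  by (simp add: fee_def power_add eval_nat_numeral)

lemma fee_pos: "0 < fee u"
  by (simp add: fee_def)

lemma weight_kid_le_fee: "(1/2 :: real) ^ gl (p # u) \<le> fee u"
  unfolding fee_def by (rule power_decreasing) auto

text \<open>With one unit per request, the factor \<open>(1/2) ^ Suc j\<close> alone makes the
  weights summable.\<close>

lemma finite_set_weight_path:
  assumes "finite J" "inj_on fst J" "\<And>q. q \<in> J \<Longrightarrow> inst (fst q)"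
  shows "(\<Sum>q\<in>J. (1/2 :: real) ^ gl (q # u)) \<le> fee u"
proof -
  have one: "(1/2 :: real) ^ rr j \<le> 1" for j by (rule power_le_one) auto
  have "(\<Sum>q\<in>J. (1/2 :: real) ^ gl (q # u)) = (\<Sum>q\<in>J. fee u * (1/2) ^ rr (fst q) * (1/2) ^ Suc (fst q))"
    by (rule sum.cong) (simp_all add: weight_kid[of "fst q" "snd q" for q, simplified])
  also have "\<dots> \<le> (\<Sum>q\<in>J. fee u * (1/2) ^ Suc (fst q))"
    using one less_imp_le[OF fee_pos[of u]] by (intro sum_mono mult_right_mono) (auto intro: mult_left_le)
  also have "\<dots> = fee u * (\<Sum>j\<in>fst ` J. (1/2) ^ Suc j)"
    by (simp only: sum.reindex[OF assms(2)] sum_distrib_left o_def)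
  also have "\<dots> \<le> fee u * 1"
    using assms(1) fee_pos by (intro mult_left_mono sum_half_powers_le) (auto intro: less_imp_le)
  finally show ?thesis by simp
qed

text \<open>The goal was not yet reached before the latest upgrade, and a single child weighs at
  most the fee.\<close>

lemma upgraded_weight:
  "(\<Sum>w\<in>set (kids (events d t) 2 u). (1/2 :: real) ^ gl w) \<le> (1/2) ^ gl u + fee u"
proof (induction t)
  case 0
  show ?case using fee_pos[of u] by (simp add: kids_def less_imp_le add_nonneg_nonneg)
next
  case (Suc t)
  show ?case
  proof (cases "set (kids (events d (Suc t)) 2 u) = set (kids (events d t) 2 u)")
    case True
    then show ?thesis using Suc by simp
  next
    case False
    define e where "e = (dec (fst (prod_decode t)) :: event)"
    have ev: "events d (Suc t) = e # events d t" and en: "enabled d t (events d t) e" and new: "e \<notin> set (events d t)"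
      using False by (auto simp: events_Suc e_def Let_def split: if_splits)
    have e: "fst e = 2" "snd e \<noteq> []" "tl (snd e) = u"
      using False unfolding ev by (auto simp: set_kids)
    have "\<not> reached (events d t) u" using en e by (simp add: enabled_def)
    then have "(\<Sum>w\<in>set (kids (events d t) 2 u). (1/2 :: real) ^ gl w) < (1/2) ^ gl u"
      by (simp add: reached_iff distinct_events)
    moreover have "set (kids (events d (Suc t)) 2 u) = insert (snd e) (set (kids (events d t) 2 u))"
      using e unfolding ev set_kids by (cases e) auto
    moreover have "snd e \<notin> set (kids (events d t) 2 u)" using new e by (cases e) (auto simp: set_kids)
    moreover have "(1/2 :: real) ^ gl (snd e) \<le> fee u"
      using weight_kid_le_fee[of "hd (snd e)" u] e(2) unfolding e(3)[symmetric] by simp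
    ultimately show ?thesis by simp
  qed
qed

text \<open>These attempts are pairwise compatible, so their requests weigh at most 1 together; the
  units of one request sum to at most the fee times its weight.\<close>

lemma synced_weight:
  assumes "finite W" "\<And>w. w \<in> W \<Longrightarrow> Syn w \<in> set (events d t) \<and> tl w = u \<and> Upg w \<notin> set (events d t)"
  shows "(\<Sum>w\<in>W. (1/2 :: real) ^ gl w) \<le> fee u"
proof -
  define j where "j w = fst (hd w)" for w :: path
  have w: "w = (j w, snd (hd w)) # u" "inst (j w)" "snd (hd w) < 2 ^ Suc (j w)" "sig w = tau (j w)" if "w \<in> W" for w
  proof -
    have "w \<noteq> []" "started (events d t) w" "tl w = u" using Syn_D Ret_D assms(2)[OF that] by blast+
    then show "w = (j w, snd (hd w)) # u" "inst (j w)" "snd (hd w) < 2 ^ Suc (j w)" "sig w = tau (j w)"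
      by (cases w; auto simp: j_def started_Cons started_at_def)+
  qed
  have "(\<Sum>w\<in>W. (1/2 :: real) ^ gl w) = (\<Sum>i\<in>j ` W. \<Sum>w\<in>{w\<in>W. j w = i}. (1/2) ^ gl w)"
    by (rule sum.image_gen[OF assms(1)])
  also have "\<dots> \<le> (\<Sum>i\<in>j ` W. fee u * (1/2) ^ rr i)"
  proof (rule sum_mono)
    fix i assume "i \<in> j ` W"
    have gl_w: "(1/2 :: real) ^ gl w = fee u * (1/2) ^ rr i * (1/2) ^ Suc i" if "w \<in> W" "j w = i" for w
      using w(1)[OF that(1)] that(2) weight_kid by metis
    have "{w\<in>W. j w = i} \<subseteq> (\<lambda>m. (i, m) # u) ` {..<2 ^ Suc i}"
    proof
      fix v assume "v \<in> {w\<in>W. j w = i}"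
      then show "v \<in> (\<lambda>m. (i, m) # u) ` {..<2 ^ Suc i}"
        using w[of v] by (intro image_eqI[of _ _ "snd (hd v)"]) auto
    qed
    then have "card {w\<in>W. j w = i} \<le> card {..<2 ^ Suc i :: nat}"
      by (metis (no_types, lifting) card_image_le card_mono finite_imageI finite_lessThan le_trans)
    then have c: "real (card {w\<in>W. j w = i}) \<le> 2 ^ Suc i"
      using of_nat_mono[of _ "2 ^ Suc i", where 'a = real] by simp
    have "(\<Sum>w\<in>{w\<in>W. j w = i}. (1/2 :: real) ^ gl w)
        = (\<Sum>w\<in>{w\<in>W. j w = i}. fee u * (1/2) ^ rr i * (1/2) ^ Suc i)"
      by (intro sum.cong refl gl_w) auto
    also have "\<dots> = real (card {w\<in>W. j w = i}) * (fee u * (1/2) ^ rr i * (1/2) ^ Suc i)" by simp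
    also have "\<dots> \<le> 2 ^ Suc i * (fee u * (1/2) ^ rr i * (1/2) ^ Suc i)"
      using c fee_pos[of u] by (intro mult_right_mono) auto
    also have "\<dots> = fee u * (1/2) ^ rr i" by (simp add: power_one_over)
    finally show "(\<Sum>w\<in>{w\<in>W. j w = i}. (1/2 :: real) ^ gl w) \<le> fee u * (1/2) ^ rr i" .
  qed
  also have "\<dots> = fee u * (\<Sum>i\<in>j ` W. (1/2) ^ rr i)" by (simp add: sum_distrib_left)
  also have "\<dots> \<le> fee u * 1"
  proof (rule mult_left_mono[OF inst_weight less_imp_le[OF fee_pos]])
    show "finite (j ` W)" using assms(1) by simp
    show "inst i" if "i \<in> j ` W" for i using that w(2) by auto
    fix i k assume "i \<in> j ` W" "k \<in> j ` W"
    then obtain v v' where v: "v \<in> W" "i = j v" "v' \<in> W" "k = j v'" by blast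
    have "compat (sig v) (sig v')"
      by (rule Syn_compat[of v d t v']) (use assms(2) v in auto)
    then show "compat (tau i) (tau k)" using v w(4) by metis
  qed
  finally show ?thesis by simp
qed

lemma Syn_previous:
  assumes "Syn ((j, m) # u) \<in> set (events d t)" "m' \<le> m"
  shows "Syn ((j, m') # u) \<in> set (events d t)"
  using assms
proof (induction m)
  case (Suc m)
  show ?case
  proof (cases "m' = Suc m")
    case False
    have "started (events d t) ((j, Suc m) # u)" using Suc.prems(1) Syn_D Ret_D by blast
    then have "Syn ((j, m) # u) \<in> set (events d t)" by (simp add: started_Cons started_at_def)
    then show ?thesis using Suc False by simp
  qed (use Suc in simp)
qed simp

text \<open>Upgraded children cost at most the goal and one fee. Synchronised ones without upgrade
  cost a fee by compatibility, and unsynchronised ones cost a fee because there is at most one per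
  request.\<close>

lemma started_kids_weight:
  assumes "finite W" "\<And>w. w \<in> W \<Longrightarrow> started (events d t) w \<and> w \<noteq> [] \<and> tl w = u"
  shows "(\<Sum>w\<in>W. (1/2 :: real) ^ gl w) \<le> (1/2) ^ gl u + 3 * fee u"
proof -
  let ?L = "set (events d t)"
  define U where "U = {w\<in>W. Upg w \<in> ?L}"
  define S where "S = {w\<in>W. Upg w \<notin> ?L \<and> Syn w \<in> ?L}"
  define N where "N = {w\<in>W. Upg w \<notin> ?L \<and> Syn w \<notin> ?L}"
  have "W = U \<union> (S \<union> N)" "U \<inter> (S \<union> N) = {}" "S \<inter> N = {}" by (auto simp: U_def S_def N_def)
  moreover have fin: "finite U" "finite S" "finite N" using assms(1) by (simp_all add: U_def S_def N_def)
  ultimately have "(\<Sum>w\<in>W. (1/2 :: real) ^ gl w)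
      = (\<Sum>w\<in>U. (1/2) ^ gl w) + ((\<Sum>w\<in>S. (1/2) ^ gl w) + (\<Sum>w\<in>N. (1/2) ^ gl w))"
    by (metis (no_types, lifting) finite_UnI sum.union_disjoint)
  moreover have "(\<Sum>w\<in>U. (1/2 :: real) ^ gl w) \<le> (1/2) ^ gl u + fee u"
  proof -
    have "U \<subseteq> set (kids (events d t) 2 u)" using assms(2) by (auto simp: U_def set_kids)
    then have "(\<Sum>w\<in>U. (1/2 :: real) ^ gl w) \<le> (\<Sum>w\<in>set (kids (events d t) 2 u). (1/2) ^ gl w)"
      by (intro sum_mono2) auto
    then show ?thesis using upgraded_weight[of d t u] by linarith
  qed
  moreover have "(\<Sum>w\<in>S. (1/2 :: real) ^ gl w) \<le> fee u"
    by (rule synced_weight[OF fin(2), of d t]) (use assms(2) in \<open>auto simp: S_def\<close>)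
  moreover have "(\<Sum>w\<in>N. (1/2 :: real) ^ gl w) \<le> fee u"
  proof -
    have N: "w = hd w # u" "inst (fst (hd w))" if "w \<in> N" for w
    proof -
      have "w \<noteq> []" "started (events d t) w" "tl w = u" using assms(2) that by (auto simp: N_def)
      then show "w = hd w # u" "inst (fst (hd w))" by (cases w; auto simp: started_Cons started_at_def)+
    qed
    have inj_hd: "inj_on hd N" using N(1) by (metis inj_onI)
    have lt: False if *: "(i, a) # u \<in> N" "(i, b) # u \<in> N" "a < b" for i a b
    proof -
      have "started (events d t) ((i, b) # u)" using *(2) assms(2) by (auto simp: N_def)
      then have "Syn ((i, b - 1) # u) \<in> ?L" using *(3) by (simp add: started_Cons started_at_def)
      then have "Syn ((i, a) # u) \<in> ?L" by (rule Syn_previous) (use *(3) in simp)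
      then show False using *(1) by (simp add: N_def)
    qed
    have inj_fst: "inj_on fst (hd ` N)"
    proof (rule inj_onI)
      fix p q assume "p \<in> hd ` N" "q \<in> hd ` N" "fst p = fst q"
      moreover from this have "p # u \<in> N" "q # u \<in> N" using N(1) by (metis imageE)+
      ultimately show "p = q" using lt[of "fst p" "snd p" "snd q"] lt[of "fst q" "snd q" "snd p"]
        by (metis linorder_neqE_nat prod.collapse)
    qed
    have "(\<Sum>w\<in>N. (1/2 :: real) ^ gl w) = (\<Sum>w\<in>N. (1/2) ^ gl (hd w # u))"
      by (rule sum.cong) (use N(1) in \<open>simp_all flip: N(1)\<close>)
    also have "\<dots> = (\<Sum>q\<in>hd ` N. (1/2) ^ gl (q # u))" by (simp only: sum.reindex[OF inj_hd] o_def)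
    also have "\<dots> \<le> fee u"
      using fin(3) inj_fst N(2) by (intro finite_set_weight_path) auto
    finally show ?thesis .
  qed
  ultimately show ?thesis by linarith
qed

definition spent :: "nat \<Rightarrow> nat \<Rightarrow> path \<Rightarrow> path set" where
  "spent d t u = {l. Ret l \<in> set (events d t) \<and> length l = depth d \<and> below u l}"

lemma finite_spent [simp]: "finite (spent d t u)"
proof -
  have "spent d t u \<subseteq> snd ` set (events d t)" by (force simp: spent_def)
  then show ?thesis by (rule finite_subset) simp
qed

text \<open>Leaves count here whether upgraded or not. The children of \<open>u\<close> exceed its
  goal by at most three fees, and a fee is \<open>h / 16\<close> of the goal for
  \<open>h = (1/2) ^ length u\<close>. As this loss shrinks geometrically with the depth,
  \<open>(1 + h / 2) * (1 + 3 * h / 16) \<le> 1 + h\<close> closes the induction.\<close>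

lemma spent_weight:
  assumes "length u \<le> depth d"
  shows "(\<Sum>l\<in>spent d t u. (1/2 :: real) ^ gl l) \<le> (1 + (1/2) ^ length u) * (1/2) ^ gl u"
  using assms
proof (induction "depth d - length u" arbitrary: u)
  case 0
  have "spent d t u \<subseteq> {u}"
  proof
    fix l assume "l \<in> spent d t u"
    then obtain i where "length l = depth d" "i < Suc (length l)" "drop i l = u"
      by (auto simp: spent_def below_def)
    moreover from this have "length l - i = length u" by auto
    ultimately have "i = 0 \<or> length l = 0" using 0 by auto
    then show "l \<in> {u}" using \<open>drop i l = u\<close> by auto
  qed
  then have "(\<Sum>l\<in>spent d t u. (1/2 :: real) ^ gl l) \<le> (\<Sum>l\<in>{u}. (1/2) ^ gl l)"
    by (intro sum_mono2) auto
  also have "\<dots> \<le> (1 + (1/2) ^ length u) * (1/2) ^ gl u" by (simp add: distrib_right)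
  finally show ?case .
next
  case (Suc n)
  define kid where "kid l = drop (length l - Suc (length u)) l" for l :: path
  let ?S = "spent d t u"
  have kid: "length (kid l) = Suc (length u)" "tl (kid l) = u" "l \<in> spent d t (kid l)" "started (events d t) (kid l)"
    if l: "l \<in> ?S" for l
  proof -
    obtain i where i: "i < Suc (length l)" "drop i l = u" using l by (auto simp: spent_def below_def)
    have len: "length l = depth d" "Ret l \<in> set (events d t)" using l by (auto simp: spent_def)
    have "length u = length l - i" using i by auto
    moreover have "length u < length l" using Suc.hyps(2) len by simp
    ultimately have "i = Suc (length l - Suc (length u))" using i(1) by simp
    then have "tl (kid l) = drop i l" by (metis drop_Suc kid_def tl_drop)
    then show "tl (kid l) = u" using i(2) by simp
    show "length (kid l) = Suc (length u)" using \<open>length u < length l\<close> by (simp add: kid_def)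
    show "l \<in> spent d t (kid l)" using len unfolding spent_def below_def kid_def by (auto intro!: exI[of _ "length l - Suc (length u)"])
    show "started (events d t) (kid l)" unfolding kid_def using Ret_D(1)[OF len(2)] by (rule started_drop)
  qed
  let ?W = "kid ` ?S" and ?h = "(1/2 :: real) ^ length u"
  have "(\<Sum>l\<in>?S. (1/2 :: real) ^ gl l) \<le> (\<Sum>l\<in>(\<Union>w\<in>?W. spent d t w). (1/2) ^ gl l)"
    using kid(3) by (intro sum_mono2) auto
  also have "\<dots> \<le> (\<Sum>w\<in>?W. \<Sum>l\<in>spent d t w. (1/2) ^ gl l)"
    by (rule sum_UN_le) auto
  also have "\<dots> \<le> (\<Sum>w\<in>?W. (1 + ?h / 2) * (1/2) ^ gl w)"
  proof (rule sum_mono)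
    fix w assume "w \<in> ?W"
    then have len: "length w = Suc (length u)" using kid(1) by auto
    then have "(\<Sum>l\<in>spent d t w. (1/2 :: real) ^ gl l) \<le> (1 + (1/2) ^ length w) * (1/2) ^ gl w"
      using Suc.hyps by (intro Suc.hyps(1)) auto
    then show "(\<Sum>l\<in>spent d t w. (1/2 :: real) ^ gl l) \<le> (1 + ?h / 2) * (1/2) ^ gl w" by (simp add: len)
  qed
  also have "\<dots> = (1 + ?h / 2) * (\<Sum>w\<in>?W. (1/2) ^ gl w)" by (simp add: sum_distrib_left)
  also have "\<dots> \<le> (1 + ?h / 2) * ((1/2) ^ gl u + 3 * fee u)"
  proof (rule mult_left_mono)
    have "started (events d t) w \<and> w \<noteq> [] \<and> tl w = u" if "w \<in> ?W" for w
      using that kid(1,2,4) by force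
    then show "(\<Sum>w\<in>?W. (1/2 :: real) ^ gl w) \<le> (1/2) ^ gl u + 3 * fee u"
      by (intro started_kids_weight) auto
  qed simp
  also have "fee u = (1/2) ^ gl u * ?h / 16"
    by (simp add: fee_def power_add eval_nat_numeral)
  also have "(1 + ?h / 2) * ((1/2) ^ gl u + 3 * ((1/2) ^ gl u * ?h / 16))
      = (1 + ?h / 2) * (1 + 3 * ?h / 16) * (1/2) ^ gl u"
    by (simp add: algebra_simps)
  also have "\<dots> \<le> (1 + ?h) * (1/2) ^ gl u"
  proof (rule mult_right_mono)
    have *: "(1 + h / 2) * (1 + 3 * h / 16) \<le> 1 + h" if "0 \<le> h" "h \<le> 1" for h :: real
    proof -
      have "(1 + h / 2) * (1 + 3 * h / 16) = 1 + 11 * h / 16 + 3 * (h * h) / 32"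
        by (simp add: field_simps)
      moreover have "h * h \<le> h" using that by (simp add: mult_left_le)
      ultimately show ?thesis using that by linarith
    qed
    show "(1 + ?h / 2) * (1 + 3 * ?h / 16) \<le> 1 + ?h" by (rule *) (simp_all add: power_le_one)
  qed simp
  finally show ?case .
qed

text \<open>The root has goal 1/2 to compensate the factor 2 of \<open>spent_weight\<close>; the
  bound 1 allows all leaves to become Kraft-Chaitin requests.\<close>

lemma spent_root: "(\<Sum>l\<in>spent d t []. (1/2 :: real) ^ gl l) \<le> 1"
  using spent_weight[of "[]" d t] by simp

section \<open>The machine cannot make all the payments\<close>

lemma Kraft_complexity_image:
  assumes "prefix_free_machine M" "finite I" "inj_on g I" "\<And>i. i \<in> I \<Longrightarrow> complexity M (g i) \<le> enat (l i)"
  shows "(\<Sum>i\<in>I. (1/2 :: real) ^ l i) \<le> 1"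
proof -
  have "(\<Sum>t\<in>g ` I. (1/2 :: real) ^ l (the_inv_into I g t)) \<le> 1"
    by (rule Kraft_complexity[OF assms(1)]) (use assms(2-4) in \<open>auto simp: the_inv_into_f_f\<close>)
  then show ?thesis by (simp add: sum.reindex[OF assms(3)] the_inv_into_f_f[OF assms(3)] o_def)
qed

text \<open>A returned root has leaves of weight at least 1/2, each paid for on every level. The
  described strings are all different: leaves have their own lengths, and on two levels of one leaf
  they lie in disjoint sets. So the descriptions violate Kraft's inequality.\<close>

lemma root_not_returned:
  assumes U: "prefix_free_machine U" and out: "\<And>i s t. out i = Some (s, t) \<Longrightarrow> U s = Some t"
  shows "Ret [] \<notin> set (events d t)"
proof
  assume root: "Ret [] \<in> set (events d t)"
  let ?V = "set (leaves (depth d) (events d t) [])" and ?n = "depth d"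
  have leaf: "Ret l \<in> set (events d t)" "length l = ?n" "\<forall>j<?n. Upg (drop j l) \<in> set (events d t)"
    if "l \<in> ?V" for l
  proof -
    show "Ret l \<in> set (events d t)" and len: "length l = ?n" using that by (simp_all add: set_leaves)
    have "above_upgraded (events d t) [] l" using that by (simp add: set_leaves)
    then obtain i where i: "i < Suc (length l)" "drop i l = []" "\<forall>j<i. Upg (drop j l) \<in> set (events d t)"
      unfolding above_upgraded_def by blast
    then have "i = length l" by simp
    then show "\<forall>j<?n. Upg (drop j l) \<in> set (events d t)" using len i(3) by simp
  qed
  define Q where "Q l j r \<longleftrightarrow> complexity U r \<le> enat (gl l + 2 * d) \<and> length r = num d l
     \<and> prefix (sig (drop (Suc j) l)) r \<and> \<not> prefix (sig (drop j l)) r" for l j r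
  have ex: "\<exists>r. Q l j r" if lj: "l \<in> ?V" "j < ?n" for l j
  proof -
    have "l \<in> set (leaves (depth d) (events d t) (drop j l))"
    proof -
      have "above_upgraded (events d t) (drop j l) l"
        unfolding above_upgraded_def using leaf(2,3)[OF lj(1)] lj(2) by (intro exI[of _ j]) simp
      then show ?thesis using leaf(1,2)[OF lj(1)] by (simp add: set_leaves)
    qed
    then obtain i where "paid d (drop j l) l i" using Upg_paid leaf(3)[OF lj(1)] lj(2) by blast
    then obtain q where q: "out i = Some q" "length (fst q) \<le> gl l + 2 * d" "length (snd q) = num d l"
      "prefix (sig (tl (drop j l))) (snd q)" "\<not> prefix (sig (drop j l)) (snd q)"
      unfolding paid_def by (auto split: option.splits)
    have "U (fst q) = Some (snd q)" using out[of i "fst q" "snd q"] q(1) by simp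
    then have "complexity U (snd q) \<le> enat (gl l + 2 * d)" using q(2) complexity_le_iff by blast
    then show ?thesis using q unfolding Q_def by (metis drop_Suc tl_drop)
  qed
  define r where "r l j = (SOME r. Q l j r)" for l j
  have Qr: "Q l j (r l j)" if "l \<in> ?V" "j < ?n" for l j
    unfolding r_def by (rule someI_ex[OF ex[OF that]])
  have r: "\<And>l j. l \<in> ?V \<Longrightarrow> j < ?n \<Longrightarrow> complexity U (r l j) \<le> enat (gl l + 2 * d)"
    "\<And>l j. l \<in> ?V \<Longrightarrow> j < ?n \<Longrightarrow> length (r l j) = num d l"
    "\<And>l j. l \<in> ?V \<Longrightarrow> j < ?n \<Longrightarrow> prefix (sig (drop (Suc j) l)) (r l j)"
    "\<And>l j. l \<in> ?V \<Longrightarrow> j < ?n \<Longrightarrow> \<not> prefix (sig (drop j l)) (r l j)"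
    using Qr unfolding Q_def by blast+
  \<comment> \<open>The string paid on the inner level \<open>i\<close> extends the string of every
    outer attempt, in particular that of level \<open>j\<close>, whose cone the payment on level
    \<open>j\<close> avoids.\<close>
  have lt: False if *: "l \<in> ?V" "i < j" "j < ?n" "r l i = r l j" for l i j
  proof -
    have "prefix (sig (drop (j - Suc i) (drop (Suc i) l))) (sig (drop (Suc i) l))"
      using Ret_D(1)[OF leaf(1)[OF *(1)]] by (intro started_sig started_drop)
    then have "prefix (sig (drop j l)) (sig (drop (Suc i) l))" using *(2) by simp
    then have "prefix (sig (drop j l)) (r l i)"
      using r(3)[of l i] * prefix_order.trans less_trans by metis
    then show False using r(4)[of l j] * by simp
  qed
  have inj: "inj_on (\<lambda>(l, j). r l j) (?V \<times> {..<?n})"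
  proof (rule inj_onI)
    fix x y assume x: "x \<in> ?V \<times> {..<?n}" and y: "y \<in> ?V \<times> {..<?n}"
      and eq: "(case x of (l, j) \<Rightarrow> r l j) = (case y of (l, j) \<Rightarrow> r l j)"
    obtain l j l' j' where xy: "x = (l, j)" "y = (l', j')" by (metis surj_pair)
    have "num d l = num d l'" using r(2)[of l j] r(2)[of l' j'] x y eq xy by auto
    then have "l = l'" by (simp add: num_inject)
    moreover have "j = j'" using lt[of l j j'] lt[of l j' j] x y eq xy \<open>l = l'\<close>
      by (metis (no_types, lifting) SigmaE2 case_prod_conv lessThan_iff linorder_neqE_nat)
    ultimately show "x = y" using xy by simp
  qed
  have "(\<Sum>q\<in>?V \<times> {..<?n}. (1/2 :: real) ^ (gl (fst q) + 2 * d)) \<le> 1"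
    using r(1) by (intro Kraft_complexity_image[OF U _ inj]) auto
  moreover have "(\<Sum>q\<in>?V \<times> {..<?n}. (1/2 :: real) ^ (gl (fst q) + 2 * d))
      = (\<Sum>l\<in>?V. real ?n * ((1/2) ^ gl l * (1/2) ^ (2 * d)))"
  proof -
    have "(\<Sum>q\<in>?V \<times> {..<?n}. (1/2 :: real) ^ (gl (fst q) + 2 * d))
        = (\<Sum>l\<in>?V. \<Sum>j<?n. (1/2) ^ (gl l + 2 * d))"
      by (simp only: sum.cartesian_product) (rule sum.cong, auto)
    then show ?thesis by (simp add: power_add)
  qed
  moreover have "\<dots> = real ?n * (1/2) ^ (2 * d) * (\<Sum>l\<in>?V. (1/2) ^ gl l)"
    by (simp add: sum_distrib_left mult_ac)
  moreover have "real ?n * (1/2) ^ (2 * d) * (1/2) \<le> real ?n * (1/2) ^ (2 * d) * (\<Sum>l\<in>?V. (1/2) ^ gl l)"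
    using leaves_weight[OF root] by (intro mult_left_mono) auto
  ultimately have "real ?n * (1/2) ^ (2 * d) * (1/2) \<le> 1" by linarith
  then show False by (simp add: depth_def power_add field_simps power_one_over)
qed

end

section \<open>Without a cover every attempt along \<open>A\<close> returns\<close>

lemma ex_initial_of_compat:
  assumes "finite S" "\<And>s t. s \<in> S \<Longrightarrow> t \<in> S \<Longrightarrow> compat s t"
  shows "\<exists>Z. \<forall>s\<in>S. initial s Z"
proof (cases "S = {}")
  case False
  then have "Max (length ` S) \<in> length ` S" using assms(1) by simp
  then obtain m where m: "m \<in> S" "length m = Max (length ` S)" by auto
  obtain Z where Z: "initial m Z" using ex_initial_of_string by blast
  have "initial s Z" if "s \<in> S" for s
  proof -
    have "length s \<le> length m" using that m(2) assms(1) by simp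
    then have "prefix s m"
      using assms(2)[OF that m(1)] unfolding compat_def
      by (metis prefix_length_le prefix_order.refl prefix_same_cases2)
    then show ?thesis using Z initial_prefix by blast
  qed
  then show ?thesis by blast
qed simp

definition covers :: "('a::enc \<Rightarrow> bool) \<Rightarrow> ('a \<Rightarrow> bool list) \<Rightarrow> ('a \<Rightarrow> nat) \<Rightarrow> nat set \<Rightarrow> ('a \<Rightarrow> bool) \<Rightarrow> real \<Rightarrow> bool" where
  "covers W tau r A V B \<longleftrightarrow> ce V \<and> (\<forall>x. V x \<longrightarrow> W x) \<and> (\<forall>x. W x \<and> initial (tau x) A \<longrightarrow> V x)
     \<and> (\<forall>F. finite F \<and> (\<forall>x\<in>F. V x) \<longrightarrow> (\<Sum>x\<in>F. (1/2) ^ r x) \<le> B)"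

context decanter
begin

lemma all_entered:
  assumes "finite S" "\<And>e. e \<in> S \<Longrightarrow> \<exists>t. e \<in> set (events d t)"
  shows "\<exists>t. S \<subseteq> set (events d t)"
  using assms
proof (induction S rule: finite_induct)
  case (insert e S)
  then obtain t where "S \<subseteq> set (events d t)" by blast
  moreover obtain t' where "e \<in> set (events d t')" using insert.prems by blast
  ultimately have "S \<subseteq> set (events d t)" "e \<in> set (events d t')" by simp_all
  then have "insert e S \<subseteq> set (events d (max t t'))"
    using events_mono[of t "max t t'" d] events_mono[of t' "max t t'" d] by auto
  then show ?case by blast
qed simp

text \<open>Suppose \<open>u\<close> never returns. Then its goal is never reached and upgrades of
  its children are never blocked, so every unit of a request along \<open>A\<close> that can start
  is eventually synchronised. The requests with all units synchronised then form a cover, with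
  weight bounded by what the children of \<open>u\<close> may consume.\<close>

lemma returned:
  assumes pay: "\<And>l s. Ret l \<in> set (events d s) \<Longrightarrow> length l = depth d \<Longrightarrow>
      \<exists>i q. out i = Some (q, A \<restriction> num d l) \<and> length q \<le> gl l + 2 * d"
    and no_cover: "\<nexists>V B. covers inst tau rr A V B"
  shows "length u \<le> depth d \<Longrightarrow> started (events d s) u \<Longrightarrow> initial (sig u) A \<Longrightarrow>
    \<exists>t. Ret u \<in> set (events d t)"
proof (induction "depth d - length u" arbitrary: u s)
  case 0
  show ?case
  proof (rule events_fair[of s])
    fix s' assume "s \<le> s'"
    then show "enabled d s' (events d s') (Ret u)"
      using 0 started_mono[OF 0(3)] by (simp add: enabled_def)
  qed
next
  case (Suc n)
  show ?case
  proof (rule ccontr)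
    assume nr: "\<nexists>t. Ret u \<in> set (events d t)"
    have not_reached: "\<not> reached (events d t) u" for t
    proof
      assume r: "reached (events d t) u"
      have "\<exists>t. Ret u \<in> set (events d t)"
      proof (rule events_fair[of "max s t"])
        fix s' assume "max s t \<le> s'"
        then show "enabled d s' (events d s') (Ret u)"
          using Suc.prems(1) started_mono[OF Suc.prems(2), of s'] reached_mono[OF r, of s'] by (simp add: enabled_def)
      qed
      then show False using nr by blast
    qed
    define V where "V j \<longleftrightarrow> inst j \<and> (prefix (tau j) (sig u) \<or> (\<exists>t. Syn ((j, 2 ^ Suc j - 1) # u) \<in> set (events d t)))" for j
    have V_ce: "ce V"
    proof -
      have "ce (\<lambda>j. inst j \<and> (prefix (tau j) (sig u) \<or> (\<exists>t. Syn ((j, 2 ^ Suc j - 1) # u) \<in> set (events d t))))"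
        by (intro ce_intros; (rule ce_computable)?;
            intro computable_intros computable_inst[THEN computable_compose] computable_tau[THEN computable_compose])
      then show ?thesis unfolding V_def .
    qed
    \<comment> \<open>If \<open>A\<close> is outside the cone of \<open>w'\<close>, then the
      description of \<open>A \<restriction> num d l\<close> provided by \<open>pay\<close> is the
      payment needed for leaf \<open>l\<close>.\<close>
    have upgraded: "\<exists>t. Upg w' \<in> set (events d t)"
      if w': "Ret w' \<in> set (events d t1)" "w' \<noteq> []" "tl w' = u" "\<not> initial (sig w') A" for w' t1
    proof -
      let ?lv = "set (leaves (depth d) (events d t1) w')"
      have "\<exists>i. paid d w' l i" if l: "l \<in> ?lv" for l
      proof -
        have l': "Ret l \<in> set (events d t1)" "length l = depth d" "above_upgraded (events d t1) w' l"
          using l by (simp_all add: set_leaves)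
        obtain i q where iq: "out i = Some (q, A \<restriction> num d l)" "length q \<le> gl l + 2 * d"
          using pay[OF l'(1,2)] by blast
        obtain k where "drop k l = w'" using l'(3) unfolding above_upgraded_def by blast
        then have "drop (Suc k) l = u" using w'(3) by (metis drop_Suc tl_drop)
        then have "prefix (sig u) (sig l)" using started_sig[OF Ret_D(1)[OF l'(1)], of "Suc k"] by simp
        then have "length (sig u) \<le> num d l" using prefix_length_le length_sig_le_num order_trans by blast
        then have "prefix (sig u) (A \<restriction> num d l)" using Suc.prems(3) by (simp add: prefix_initial_segment)
        moreover have "\<not> prefix (sig w') (A \<restriction> num d l)" using w'(4) by (simp add: prefix_initial_segment)
        ultimately have "paid d w' l i" using iq w'(3) by (simp add: paid_def)
        then show ?thesis by blast
      qed
      then have "\<exists>h. \<forall>l\<in>?lv. paid d w' l (h l)" by metis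
      then obtain h where h: "\<And>l. l \<in> ?lv \<Longrightarrow> paid d w' l (h l)" by blast
      define s2 where "s2 = max t1 (Suc (Max (insert 0 (h ` ?lv))))"
      have hs: "h l < s2" if "l \<in> ?lv" for l
        using that by (auto simp: s2_def less_max_iff_disj less_Suc_eq_le)
      show ?thesis
      proof (rule events_fair[of s2])
        fix s' assume s': "s2 \<le> s'"
        then have t1: "t1 \<le> s'" by (simp add: s2_def)
        have "Ret w' \<in> set (events d s')" using w'(1) events_mono[OF t1, of d] by blast
        moreover have "set (leaves (depth d) (events d s') w') = ?lv" by (rule leaves_frozen[OF w'(1) t1])
        moreover have "\<forall>l\<in>?lv. \<exists>i<s'. paid d w' l i" using h hs s' less_le_trans by metis
        ultimately show "enabled d s' (events d s') (Upg w')"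
          using w'(2,3) not_reached by (simp add: enabled_def)
      qed
    qed
    have synced_if_started: "\<exists>t. Syn w \<in> set (events d t)"
      if w: "w = (j, m) # u" and j: "initial (tau j) A" and st: "started (events d t0) w" for w j m t0
    proof -
      have "\<exists>t. Ret w \<in> set (events d t)"
        using Suc.hyps(2) w j by (intro Suc.hyps(1)[of w t0] st) auto
      then obtain t1 where t1: "Ret w \<in> set (events d t1)" by blast
      \<comment> \<open>The siblings that delay synchronisation of \<open>w\<close> are incompatible
        with a string along \<open>A\<close>, hence off \<open>A\<close>, and get their
        upgrades.\<close>
      define Q where "Q = {w'\<in>set (kids (events d t1) 0 u). \<not> compat (sig w') (sig w)}"
      have "\<exists>t. Upg ` Q \<subseteq> set (events d t)"
      proof (rule all_entered)
        show "finite (Upg ` Q)" by (simp add: Q_def)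
        fix e assume "e \<in> Upg ` Q"
        then obtain w' where e: "e = Upg w'" and w': "Ret w' \<in> set (events d t1)" "w' \<noteq> []" "tl w' = u"
          "\<not> compat (sig w') (sig w)"
          unfolding Q_def set_kids by blast
        have "\<not> initial (sig w') A" using w'(4) w j compat_initial by auto
        then show "\<exists>t. e \<in> set (events d t)" unfolding e using upgraded w' by blast
      qed
      then obtain t2 where t2: "Upg ` Q \<subseteq> set (events d t2)" by blast
      show ?thesis
      proof (rule events_fair[of "max t1 t2"])
        fix s' assume "max t1 t2 \<le> s'"
        then have le: "t1 \<le> s'" "t2 \<le> s'" by auto
        have "Upg w' \<in> set (events d s')"
          if "w' \<in> set (kids (events d s') 0 u)" "older (events d s') w' w" "\<not> compat (sig w') (sig w)" for w'
        proof -
          have "older (events d t1) w' w" using older_same[OF that(2) t1 le(1)] .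
          then have "Ret w' \<in> set (events d t1)" unfolding older_iff by auto
          then have "w' \<in> Q" using that by (simp add: Q_def set_kids)
          then show ?thesis using t2 events_mono[OF le(2), of d] by blast
        qed
        moreover have "Ret w \<in> set (events d s')" using t1 events_mono[OF le(1), of d] by blast
        ultimately show "enabled d s' (events d s') (Syn w)"
          using w by (simp add: enabled_def)
      qed
    qed
    have synced: "\<exists>t. Syn ((j, m) # u) \<in> set (events d t)"
      if j: "inst j" "initial (tau j) A" "prefix (sig u) (tau j)" and m: "m < 2 ^ Suc j" for j m
      using m
    proof (induction m)
      case m: 0
      have "started (events d s) ((j, 0) # u)"
        using Suc.prems(2) j m by (simp add: started_Cons started_at_def)
      then show ?case using synced_if_started j(2) by blast
    next
      case m: (Suc m)
      then obtain t where "Syn ((j, m) # u) \<in> set (events d t)" by auto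
      then have "Syn ((j, m) # u) \<in> set (events d (max s t))"
        using events_mono[of t "max s t" d] by auto
      moreover have "started (events d (max s t)) u" by (rule started_mono[OF Suc.prems(2)]) simp
      ultimately have "started (events d (max s t)) ((j, Suc m) # u)"
        using j m.prems by (simp add: started_Cons started_at_def)
      then show ?case using synced_if_started j(2) by blast
    qed
    have V_covers: "V j" if "inst j" "initial (tau j) A" for j
    proof (cases "prefix (tau j) (sig u)")
      case False
      then have "prefix (sig u) (tau j)"
        using compat_initial[OF Suc.prems(3) that(2)] by (simp add: compat_def)
      then show ?thesis using synced[OF that, of "2 ^ Suc j - 1"] that by (simp add: V_def)
    qed (use that in \<open>simp add: V_def\<close>)
    \<comment> \<open>The 1 is for prefixes of \<open>sig u\<close>. The quotient bounds the rest:
      their units weigh at most the goal plus a fee if upgraded and a fee otherwise, and dividing by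
      the fee turns units into requests.\<close>
    have V_weight: "(\<Sum>j\<in>F. (1/2) ^ rr j) \<le> 1 + ((1/2) ^ gl u + 2 * fee u) / fee u"
      if F: "finite F" "\<forall>j\<in>F. V j" for F
    proof -
      define G where "G = {j\<in>F. \<not> prefix (tau j) (sig u)}"
      have "(\<Sum>j\<in>F - G. (1/2 :: real) ^ rr j) \<le> 1"
      proof (rule inst_weight)
        fix i j assume "i \<in> F - G" "j \<in> F - G"
        then show "compat (tau i) (tau j)" unfolding G_def compat_def using prefix_same_cases by blast
      qed (use F in \<open>auto simp: V_def\<close>)
      moreover have "fee u * (\<Sum>j\<in>G. (1/2) ^ rr j) \<le> (1/2) ^ gl u + 2 * fee u"
      proof -
        have fin: "finite G" using F(1) by (simp add: G_def)
        have "\<exists>t. (\<lambda>j. Syn ((j, 2 ^ Suc j - 1) # u)) ` G \<subseteq> set (events d t)"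
          by (rule all_entered) (use fin F(2) in \<open>auto simp: V_def G_def\<close>)
        then obtain T where T: "\<And>j. j \<in> G \<Longrightarrow> Syn ((j, 2 ^ Suc j - 1) # u) \<in> set (events d T)" by blast
        let ?W = "(\<lambda>(j, m). (j, m) # u) ` (SIGMA j:G. {..<2 ^ Suc j})"
        have Syn_W: "Syn w \<in> set (events d T) \<and> w \<noteq> [] \<and> tl w = u" if w: "w \<in> ?W" for w
        proof -
          obtain j m where jm: "w = (j, m) # u" "j \<in> G" "m < 2 ^ Suc j" using w by auto
          have "Syn ((j, m) # u) \<in> set (events d T)"
            by (rule Syn_previous[OF T[OF jm(2)]]) (use jm(3) in simp)
          then show ?thesis using jm(1) by simp
        qed
        have finW: "finite ?W" using fin by (intro finite_imageI finite_SigmaI) auto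
        have inj: "inj_on (\<lambda>(j, m). (j, m) # u) (SIGMA j:G. {..<2 ^ Suc j :: nat})" by (auto simp: inj_on_def)
        have "fee u * (\<Sum>j\<in>G. (1/2) ^ rr j) = (\<Sum>j\<in>G. \<Sum>m<(2 ^ Suc j :: nat). (1/2) ^ gl ((j, m) # u))"
          unfolding weight_kid by (simp add: sum_distrib_left power_one_over)
        also have "\<dots> = (\<Sum>(j, m)\<in>(SIGMA j:G. {..<2 ^ Suc j}). (1/2) ^ gl ((j, m) # u))"
          by (rule sum.Sigma) (use fin in auto)
        also have "\<dots> = (\<Sum>w\<in>?W. (1/2) ^ gl w)"
          unfolding sum.reindex[OF inj] by (rule sum.cong) auto
        finally have total: "fee u * (\<Sum>j\<in>G. (1/2) ^ rr j) = (\<Sum>w\<in>?W. (1/2) ^ gl w)" .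
        define P where "P = {w\<in>?W. Upg w \<in> set (events d T)}"
        have P: "P \<subseteq> ?W" by (auto simp: P_def)
        have "P \<subseteq> set (kids (events d T) 2 u)"
          using Syn_W unfolding set_kids P_def by blast
        then have "(\<Sum>w\<in>P. (1/2 :: real) ^ gl w) \<le> (\<Sum>w\<in>set (kids (events d T) 2 u). (1/2) ^ gl w)"
          by (intro sum_mono2) simp_all
        moreover have "(\<Sum>w\<in>?W - P. (1/2 :: real) ^ gl w) \<le> fee u"
        proof (rule synced_weight)
          show "finite (?W - P)" using finW by simp
          show "Syn w \<in> set (events d T) \<and> tl w = u \<and> Upg w \<notin> set (events d T)" if "w \<in> ?W - P" for w
            using that Syn_W[of w] unfolding P_def by blast
        qed
        moreover have "(\<Sum>w\<in>?W. (1/2 :: real) ^ gl w) = (\<Sum>w\<in>?W - P. (1/2) ^ gl w) + (\<Sum>w\<in>P. (1/2) ^ gl w)"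
          by (rule sum.subset_diff[OF P finW])
        ultimately show ?thesis using total upgraded_weight[of d T u] by linarith
      qed
      then have "(\<Sum>j\<in>G. (1/2) ^ rr j) \<le> ((1/2) ^ gl u + 2 * fee u) / fee u"
        using fee_pos[of u] by (simp add: field_simps)
      moreover have "(\<Sum>j\<in>F. (1/2 :: real) ^ rr j) = (\<Sum>j\<in>F - G. (1/2) ^ rr j) + (\<Sum>j\<in>G. (1/2) ^ rr j)"
        by (rule sum.subset_diff) (use F in \<open>auto simp: G_def\<close>)
      ultimately show ?thesis by linarith
    qed
    have "covers inst tau rr A V (1 + ((1/2) ^ gl u + 2 * fee u) / fee u)"
      unfolding covers_def using V_ce V_covers V_weight by (auto simp: V_def)
    then show False using no_cover by blast
  qed
qed

lemma spentI: "Ret l \<in> set (events d t) \<Longrightarrow> length l = depth d \<Longrightarrow> l \<in> spent d t []"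
  unfolding spent_def below_def by (auto intro!: exI[of _ "length l"])

text \<open>The coding constant of the machine under construction is known only afterwards. All runs
  \<open>d\<close> are therefore carried out at once, run \<open>d\<close> with the share
  \<open>(1/2) ^ Suc d\<close>, and the right \<open>d\<close> is picked at the end.\<close>

lemma ex_cover:
  assumes opt: "optimal_machine U" and triv: "K_trivial U A"
    and out: "\<And>s t. U s = Some t \<longleftrightarrow> (\<exists>i. out i = Some (s, t))"
  shows "\<exists>V B. covers inst tau rr A V B"
proof (rule ccontr)
  assume no_cover: "\<nexists>V B. covers inst tau rr A V B"
  have U: "prefix_free_machine U" using opt by (simp add: optimal_machine_def)
  define R where "R t n \<longleftrightarrow> (\<exists>d l s. t = replicate (num d l) True \<and> n = gl l + d + 1 \<and>
      Ret l \<in> set (events d s) \<and> length l = depth d)" for t n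
  have R_ce: "ce (\<lambda>q. R (fst q) (snd q))"
    unfolding R_def by (intro ce_intros; (rule ce_computable)?; intro computable_intros)
  have R_weight: "(\<Sum>q\<in>F. (1/2 :: real) ^ snd q) \<le> 1"
    if F: "finite F" "\<And>t n. (t, n) \<in> F \<Longrightarrow> R t n" for F
  proof -
    have "\<forall>q\<in>F. \<exists>p. q = (replicate (num (fst p) (fst (snd p))) True, gl (fst (snd p)) + fst p + 1) \<and>
        Ret (fst (snd p)) \<in> set (events (fst p) (snd (snd p))) \<and> length (fst (snd p)) = depth (fst p)"
      using F(2) unfolding R_def by fastforce
    then obtain h where h: "\<And>q. q \<in> F \<Longrightarrow> q = (replicate (num (fst (h q)) (fst (snd (h q)))) True, gl (fst (snd (h q))) + fst (h q) + 1) \<and>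
        Ret (fst (snd (h q))) \<in> set (events (fst (h q)) (snd (snd (h q)))) \<and> length (fst (snd (h q))) = depth (fst (h q))"
      by metis
    define dq where "dq q = fst (h q)" for q
    define lq where "lq q = fst (snd (h q))" for q
    define T where "T = Max (insert 0 ((\<lambda>q. snd (snd (h q))) ` F))"
    have q: "q = (replicate (num (dq q) (lq q)) True, gl (lq q) + dq q + 1)" "lq q \<in> spent (dq q) T []"
      if "q \<in> F" for q
    proof -
      show "q = (replicate (num (dq q) (lq q)) True, gl (lq q) + dq q + 1)"
        using h[OF that] by (simp add: dq_def lq_def)
      have "snd (snd (h q)) \<le> T" using F(1) that by (simp add: T_def)
      then have "Ret (lq q) \<in> set (events (dq q) T)"
        using h[OF that] events_mono[of _ T "dq q"] unfolding dq_def lq_def by blast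
      then show "lq q \<in> spent (dq q) T []" using h[OF that] by (intro spentI) (simp_all add: dq_def lq_def)
    qed
    have "(\<Sum>q\<in>F. (1/2 :: real) ^ snd q) = (\<Sum>e\<in>dq ` F. \<Sum>q\<in>{q\<in>F. dq q = e}. (1/2) ^ snd q)"
      by (rule sum.image_gen[OF F(1)])
    also have "\<dots> \<le> (\<Sum>e\<in>dq ` F. (1/2) ^ Suc e)"
    proof (rule sum_mono)
      fix e
      let ?Q = "{q\<in>F. dq q = e}"
      have inj: "inj_on lq ?Q"
      proof (rule inj_onI)
        fix x y assume "x \<in> ?Q" "y \<in> ?Q" "lq x = lq y"
        then show "x = y" using q(1)[of x] q(1)[of y] by simp
      qed
      have "(\<Sum>q\<in>?Q. (1/2 :: real) ^ snd q) = (\<Sum>q\<in>?Q. (1/2) ^ Suc e * (1/2) ^ gl (lq q))"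
      proof (rule sum.cong)
        fix q assume "q \<in> ?Q"
        then have "snd q = gl (lq q) + e + 1" using arg_cong[OF q(1)[of q], of snd] by simp
        then show "(1/2 :: real) ^ snd q = (1/2) ^ Suc e * (1/2) ^ gl (lq q)" by (simp add: power_add)
      qed simp
      also have "\<dots> = (1/2) ^ Suc e * (\<Sum>l\<in>lq ` ?Q. (1/2) ^ gl l)"
        by (simp only: sum.reindex[OF inj] sum_distrib_left o_def)
      also have "\<dots> \<le> (1/2) ^ Suc e * 1"
      proof (rule mult_left_mono)
        have "(\<Sum>l\<in>lq ` ?Q. (1/2 :: real) ^ gl l) \<le> (\<Sum>l\<in>spent e T []. (1/2) ^ gl l)"
          using q(2) by (intro sum_mono2) auto
        then show "(\<Sum>l\<in>lq ` ?Q. (1/2 :: real) ^ gl l) \<le> 1" using spent_root[of e T] by linarith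
      qed simp
      finally show "(\<Sum>q\<in>?Q. (1/2 :: real) ^ snd q) \<le> (1/2) ^ Suc e" by simp
    qed
    also have "\<dots> \<le> 1" using F(1) by (intro sum_half_powers_le) simp
    finally show ?thesis .
  qed
  obtain c where c: "\<And>t n. R t n \<Longrightarrow> complexity U t \<le> enat (n + c)"
    using Kraft_Chaitin[OF opt R_ce R_weight] by blast
  obtain b where b: "\<And>n. complexity U (A \<restriction> n) \<le> complexity U (replicate n True) + enat b"
    using triv unfolding K_trivial_def by blast
  \<comment> \<open>The summands are the constant of the machine, the triviality constant, and the
    extra bit in the share of run \<open>d\<close>.\<close>
  define d where "d = c + b + 1"
  have pay: "\<exists>i q. out i = Some (q, A \<restriction> num d l) \<and> length q \<le> gl l + 2 * d"
    if "Ret l \<in> set (events d s)" "length l = depth d" for l s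
  proof -
    have "R (replicate (num d l) True) (gl l + d + 1)" unfolding R_def using that by blast
    then have "complexity U (replicate (num d l) True) + enat b \<le> enat (gl l + d + 1 + c) + enat b"
      by (intro add_right_mono c)
    from order_trans[OF b this] have "complexity U (A \<restriction> num d l) \<le> enat (gl l + d + 1 + c + b)"
      by simp
    also have "gl l + d + 1 + c + b = gl l + 2 * d" by (simp add: d_def)
    finally obtain q where "U q = Some (A \<restriction> num d l)" "length q \<le> gl l + 2 * d"
      using complexity_le_iff by blast
    then show ?thesis using out by blast
  qed
  have "\<exists>t. Ret [] \<in> set (events d t)"
    by (rule returned[OF pay no_cover, where u = "[]" and s = 0]) (auto simp: initial_def initial_segment_def)
  then show False using root_not_returned[OF U] out by blast
qed

end

text \<open>Enumerating \<open>W\<close> without repetition turns requests into the indexed form of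
  the locale; idle indices get default values and are excluded by \<open>inst\<close>.\<close>

theorem covering:
  fixes W :: "'a::enc \<Rightarrow> bool"
  assumes opt: "optimal_machine U" and triv: "K_trivial U A"
    and W: "ce W" and tau: "computable tau" and r: "computable r"
    and weight: "\<forall>Z F. finite F \<and> (\<forall>x\<in>F. W x \<and> initial (tau x) Z) \<longrightarrow> (\<Sum>x\<in>F. (1/2 :: real) ^ r x) \<le> 1"
  shows "\<exists>V B. covers W tau r A V B"
proof -
  obtain f :: "nat \<Rightarrow> 'a option" where f: "computable f" "\<And>x. W x \<longleftrightarrow> (\<exists>n. f n = Some x)"
    "\<And>i j x. f i = Some x \<Longrightarrow> f j = Some x \<Longrightarrow> i = j"
    using W by (elim ce_enumeration_inj) blast
  have "ce (\<lambda>q. U (fst q) = Some (snd q))"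
    using opt by (intro ce_machine) (simp add: optimal_machine_def)
  then obtain out :: "nat \<Rightarrow> (bool list \<times> bool list) option" where out: "computable out" "\<And>q. U (fst q) = Some (snd q) \<longleftrightarrow> (\<exists>i. out i = Some q)"
    by (elim ce_enumeration) blast
  define tau' where "tau' j = (case f j of None \<Rightarrow> [] | Some x \<Rightarrow> tau x)" for j
  define r' where "r' j = (case f j of None \<Rightarrow> 0 | Some x \<Rightarrow> r x)" for j
  define inst where "inst j \<longleftrightarrow> f j \<noteq> None" for j
  interpret decanter tau' r' inst out
  proof
    show "computable tau'" unfolding tau'_def
      by (intro computable_intros f(1)[THEN computable_compose] tau[THEN computable_compose])
    show "computable r'" unfolding r'_def
      by (intro computable_intros f(1)[THEN computable_compose] r[THEN computable_compose])
    show "computable inst" unfolding inst_def by (intro computable_intros f(1)[THEN computable_compose])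
    show "computable out" by (rule out(1))
    fix J assume J: "finite J" "\<And>j. j \<in> J \<Longrightarrow> inst j" "\<And>i j. i \<in> J \<Longrightarrow> j \<in> J \<Longrightarrow> compat (tau' i) (tau' j)"
    obtain Z where Z: "\<forall>s\<in>tau' ` J. initial s Z" using ex_initial_of_compat[of "tau' ` J"] J by auto
    let ?g = "\<lambda>j. the (f j)"
    have g: "f j = Some (?g j)" if "j \<in> J" for j using J(2)[OF that] by (simp add: inst_def)
    have inj: "inj_on ?g J" by (rule inj_onI) (metis f(3) g)
    have "(\<Sum>x\<in>?g ` J. (1/2 :: real) ^ r x) \<le> 1"
    proof (rule weight[THEN spec, THEN spec, THEN mp, OF conjI[OF _ ballI]])
      fix x assume "x \<in> ?g ` J"
      then obtain j where j: "j \<in> J" "f j = Some x" using g by auto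
      then have "tau' j = tau x" by (simp add: tau'_def)
      then show "W x \<and> initial (tau x) Z" using f(2) j Z by auto
    qed (use J in simp)
    moreover have "(\<Sum>j\<in>J. (1/2 :: real) ^ r' j) = (\<Sum>j\<in>J. (1/2) ^ r (?g j))"
    proof (rule sum.cong)
      fix j assume "j \<in> J"
      from g[OF this] show "(1/2 :: real) ^ r' j = (1/2) ^ r (?g j)"
        unfolding r'_def by (metis option.case(2))
    qed simp
    ultimately show "(\<Sum>j\<in>J. (1/2 :: real) ^ r' j) \<le> 1" by (simp add: sum.reindex[OF inj])
  qed
  obtain V B where V: "covers inst tau' r' A V B"
    using ex_cover[OF opt triv] out(2)[of "(_, _)"] by auto
  define V' where "V' x \<longleftrightarrow> (\<exists>j. V j \<and> f j = Some x)" for x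
  have "ce V'"
  proof -
    have V_ce: "ce V" using V by (simp add: covers_def)
    have "ce (\<lambda>x. \<exists>j. V j \<and> f j = Some x)"
      by (intro ce_intros ce_compose[OF V_ce]; (rule ce_computable)?; intro computable_intros f(1)[THEN computable_compose])
    then show ?thesis unfolding V'_def .
  qed
  moreover have "V' x" if "W x" "initial (tau x) A" for x
  proof -
    from that(1) obtain j where j: "f j = Some x" unfolding f(2) by (rule exE)
    then have "inst j" "tau' j = tau x" by (simp_all add: inst_def tau'_def)
    then have "V j" using V that(2) by (simp add: covers_def)
    then show ?thesis using j unfolding V'_def by (intro exI[of _ j]) simp
  qed
  moreover have "(\<Sum>x\<in>F. (1/2) ^ r x) \<le> B" if F: "finite F" "\<forall>x\<in>F. V' x" for F
  proof -
    have "\<forall>x\<in>F. \<exists>j. V j \<and> f j = Some x" using F(2) by (simp add: V'_def)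
    then obtain h where h: "\<And>x. x \<in> F \<Longrightarrow> V (h x) \<and> f (h x) = Some x" by metis
    have inj: "inj_on h F" by (rule inj_onI) (metis h option.inject)
    have "(\<Sum>j\<in>h ` F. (1/2 :: real) ^ r' j) \<le> B"
      using V F(1) h unfolding covers_def by blast
    moreover have "(\<Sum>x\<in>F. (1/2 :: real) ^ r' (h x)) = (\<Sum>x\<in>F. (1/2) ^ r x)"
      by (rule sum.cong) (use h in \<open>auto simp: r'_def\<close>)
    ultimately show ?thesis by (simp add: sum.reindex[OF inj])
  qed
  ultimately have "covers W tau r A V' B" unfolding covers_def using f(2) by (auto simp: V'_def)
  then show ?thesis by (intro exI)
qed

lemma prefix_same_length: "prefix s t \<Longrightarrow> length s = length t \<Longrightarrow> s = t"
  by (auto simp: prefix_def)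

lemma least_witness: "\<exists>n::nat. P n \<Longrightarrow> \<exists>n. P n \<and> (\<forall>m<n. \<not> P m)"
  using exists_least_iff[of P] by blast

lemma prefix_take: "prefix s r \<Longrightarrow> take (length s) r = s"
  by (auto simp: prefix_def)

lemma finite_subset_stage:
  assumes "finite B" "\<And>s. s \<in> B \<Longrightarrow> \<exists>i. f i = Some s"
  obtains k where "B \<subseteq> stage f k" "k0 \<le> k"
proof -
  obtain h where h: "\<And>s. s \<in> B \<Longrightarrow> f (h s) = Some s" using assms(2) by metis
  define k where "k = max k0 (Suc (Max (insert 0 (h ` B))))"
  have "h s < k" if "s \<in> B" for s
    using that assms(1) by (auto simp: k_def less_max_iff_disj less_Suc_eq_le)
  then have "B \<subseteq> stage f k" using h by (auto simp: stage_def)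
  then show ?thesis using that[of k] by (simp add: k_def)
qed

subsection \<open>Density at incomplete random sets\<close>

definition covered :: "nat \<Rightarrow> bool list set \<Rightarrow> bool list \<Rightarrow> bool list set" where
  "covered L B s = {r. length r = L \<and> prefix s r \<and> (\<exists>b\<in>B. prefix b r)}"

lemma finite_covered [simp]: "finite (covered L B s)"
  unfolding covered_def by (rule finite_strings_length)

lemma card_covered_mono:
  assumes "L \<le> L'" "B \<subseteq> B'"
  shows "card (covered L B s) * 2 ^ (L' - L) \<le> card (covered L' B' s)"
proof -
  have len: "r \<in> covered L B s \<Longrightarrow> length r = L" for r by (simp add: covered_def)
  have "antichain (covered L B s)"
    unfolding antichain_def using len prefix_same_length by metis
  then have "real (card (cover L' (covered L B s))) = 2 ^ L' * (\<Sum>r\<in>covered L B s. (1/2) ^ length r)"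
    using len assms(1) by (intro card_cover_antichain) auto
  also have "\<dots> = real (card (covered L B s) * 2 ^ (L' - L))"
    using len assms(1) by (simp add: half_power_diff)
  finally have "card (cover L' (covered L B s)) = card (covered L B s) * 2 ^ (L' - L)"
    by (simp only: of_nat_eq_iff)
  moreover have "cover L' (covered L B s) \<subseteq> covered L' B' s"
    using assms(2) unfolding cover_def covered_def by (auto intro: prefix_order.trans)
  ultimately show ?thesis by (metis card_mono finite_covered)
qed

text \<open>The relative measure of \<open>B\<close> in the cone of \<open>s\<close> exceeds
  \<open>1 - (1/2) ^ t\<close>, counted at level \<open>L\<close> and cleared of denominators.
  Density once seen persists for larger \<open>L\<close> and \<open>B\<close>.\<close>

definition dense :: "nat \<Rightarrow> nat \<Rightarrow> bool list set \<Rightarrow> bool list \<Rightarrow> bool" where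
  "dense t L B s \<longleftrightarrow> length s \<le> L \<and> (2 ^ t - 1) * 2 ^ (L - length s) < card (covered L B s) * 2 ^ t"

lemma dense_mono:
  assumes "dense t L B s" "L \<le> L'" "B \<subseteq> B'" shows "dense t L' B' s"
proof -
  have le: "length s \<le> L" using assms(1) by (simp add: dense_def)
  have "L' - length s = (L - length s) + (L' - L)" using le assms(2) by simp
  then have "(2 ^ t - 1) * 2 ^ (L' - length s) = ((2 ^ t - 1) * 2 ^ (L - length s)) * (2 :: nat) ^ (L' - L)"
    by (simp only: power_add mult.assoc)
  also have "\<dots> < (card (covered L B s) * 2 ^ t) * 2 ^ (L' - L)"
    using assms(1) by (simp add: dense_def)
  also have "\<dots> = (card (covered L B s) * 2 ^ (L' - L)) * 2 ^ t" by simp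
  also have "\<dots> \<le> card (covered L' B' s) * 2 ^ t"
    by (intro mult_right_mono card_covered_mono assms) simp
  finally show ?thesis using le assms(2) by (simp add: dense_def)
qed

text \<open>The shortest dense strings form an antichain \<open>D\<close>. Each leaves less than the
  fraction \<open>(1/2) ^ t\<close> of its cone uncovered, and the cones together have measure at
  most 1.\<close>

lemma dense_uncovered_weight:
  assumes "finite F" "\<And>r. r \<in> F \<Longrightarrow> length r = L \<and> \<not> (\<exists>b\<in>B. prefix b r) \<and> (\<exists>s. prefix s r \<and> dense t L B s)"
  shows "(\<Sum>r\<in>F. (1/2 :: real) ^ length r) \<le> (1/2) ^ t"
proof -
  define D where "D = {s. dense t L B s \<and> (\<forall>s'. prefix s' s \<and> dense t L B s' \<longrightarrow> s' = s)}"
  have len: "s \<in> D \<Longrightarrow> length s \<le> L" for s by (simp add: D_def dense_def)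
  have "D \<subseteq> (\<Union>n\<le>L. {s. length s = n})" using len by auto
  moreover have "finite (\<Union>n\<le>L. {s :: bool list. length s = n})"
    using finite_strings_length[of _ "\<lambda>_. True"] by simp
  ultimately have fin: "finite D" by (rule finite_subset)
  have anti: "antichain D" by (auto simp: antichain_def D_def)
  define E where "E s = {r. length r = L \<and> prefix s r} - covered L B s" for s
  have finE: "finite (E s)" for s by (simp add: E_def finite_strings_length)
  have card_E: "real (card (E s)) \<le> 2 ^ L * (1/2) ^ t * (1/2) ^ length s" if "s \<in> D" for s
  proof -
    have sub: "covered L B s \<subseteq> {r. length r = L \<and> prefix s r}" by (auto simp: covered_def)
    have "card (E s) = 2 ^ (L - length s) - card (covered L B s)"
      unfolding E_def using len[OF that] by (simp add: card_Diff_subset sub card_extensions)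
    moreover have "card (covered L B s) \<le> 2 ^ (L - length s)"
      using card_mono[OF finite_strings_length sub] len[OF that] by (simp add: card_extensions)
    ultimately have "real (card (E s)) = 2 ^ (L - length s) - real (card (covered L B s))"
      by (simp add: of_nat_diff)
    moreover have "(2 ^ t - 1) * 2 ^ (L - length s) < real (card (covered L B s)) * 2 ^ t"
    proof -
      have "real ((2 ^ t - 1) * 2 ^ (L - length s)) < real (card (covered L B s) * 2 ^ t)"
        using that unfolding D_def dense_def of_nat_less_iff by simp
      then show ?thesis by (simp add: of_nat_diff)
    qed
    moreover have "real (card (E s)) * 2 ^ t \<le> p"
      if "real (card (E s)) = p - c" "(2 ^ t - 1) * p < c * 2 ^ t" for p c :: real
      unfolding that(1) using that(2) by (simp add: algebra_simps)
    ultimately have "real (card (E s)) * 2 ^ t \<le> 2 ^ (L - length s)" by blast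
    then have "real (card (E s)) \<le> 2 ^ (L - length s) * (1/2) ^ t" by (simp add: field_simps power_one_over)
    then show ?thesis by (simp add: half_power_diff len[OF that] mult_ac)
  qed
  have "F \<subseteq> (\<Union>s\<in>D. E s)"
  proof
    fix r assume r: "r \<in> F"
    from assms(2)[OF r] obtain s where s: "prefix s r" "dense t L B s" and
      r': "length r = L" "\<not> (\<exists>b\<in>B. prefix b r)" by (elim conjE exE)
    define P where "P n \<longleftrightarrow> n \<le> length r \<and> dense t L B (take n r)" for n
    have "P (length s)" using s prefix_length_le[OF s(1)] by (simp add: P_def prefix_take)
    then obtain n where Pn: "P n" "\<forall>m<n. \<not> P m" using least_witness[of P] by blast
    then have n: "n \<le> length r" "dense t L B (take n r)" by (simp_all add: P_def)
    have "s' = take n r" if "prefix s' (take n r)" "dense t L B s'" for s'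
    proof -
      have s': "s' = take (length s') r" "length s' \<le> n"
      proof -
        have "prefix s' r" using that(1) take_is_prefix prefix_order.trans by blast
        then show "s' = take (length s') r" by (simp add: prefix_take)
        show "length s' \<le> n" using prefix_length_le[OF that(1)] by simp
      qed
      have "P (length s')" using s' n(1) that(2) unfolding P_def by (metis order_trans)
      then have "\<not> length s' < n" using Pn(2) by blast
      then show ?thesis using s' by simp
    qed
    then have "take n r \<in> D" using n(2) by (simp add: D_def)
    moreover have "r \<in> E (take n r)" using r' unfolding E_def covered_def by (simp add: take_is_prefix)
    ultimately show "r \<in> (\<Union>s\<in>D. E s)" by blast
  qed
  then have "card F \<le> card (\<Union>s\<in>D. E s)" using fin finE by (intro card_mono) auto
  also have "\<dots> \<le> (\<Sum>s\<in>D. card (E s))" by (rule card_UN_le[OF fin])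
  finally have "real (card F) \<le> (\<Sum>s\<in>D. real (card (E s)))" by (metis of_nat_mono of_nat_sum)
  also have "\<dots> \<le> (\<Sum>s\<in>D. 2 ^ L * (1/2) ^ t * (1/2) ^ length s)" by (intro sum_mono card_E)
  also have "\<dots> = 2 ^ L * (1/2) ^ t * (\<Sum>s\<in>D. (1/2) ^ length s)" by (simp add: sum_distrib_left)
  also have "\<dots> \<le> 2 ^ L * (1/2) ^ t * 1" by (intro mult_left_mono Kraft fin anti) simp
  finally have card: "real (card F) \<le> 2 ^ L * (1/2) ^ t" by simp
  have "(\<Sum>r\<in>F. (1/2 :: real) ^ length r) = (\<Sum>r\<in>F. (1/2) ^ L)"
    by (rule sum.cong) (use assms(2) in auto)
  also have "\<dots> = real (card F) * (1/2) ^ L" by simp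
  also have "\<dots> \<le> 2 ^ L * (1/2) ^ t * (1/2) ^ L" using card by (intro mult_right_mono) auto
  also have "\<dots> = (1/2) ^ t" by (simp add: power_one_over)
  finally show ?thesis .
qed

text \<open>
  Otherwise \<open>X\<close> computes \<open>\<emptyset>'\<close>: on input \<open>n\<close> wait for a prefix of \<open>X\<close> at which the density of \<open>V\<close> is seen to
  exceed \<open>1 - (1/2) ^ n\<close>. If \<open>n\<close> enters \<open>\<emptyset>'\<close> only later, then the uncovered part of that cone, of weight
  at most \<open>(1/2) ^ n\<close>, contains \<open>X\<close>; as \<open>X\<close> is random, this happens for finitely many \<open>n\<close> only.
\<close>

theorem density_bound:
  assumes opt: "optimal_machine U" and rand: "martin_loef_random U X" and V: "ce V"
    and avoid: "\<And>s. V s \<Longrightarrow> \<not> initial s X" and incomplete: "\<not> halting \<le>\<^sub>T X"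
  shows "\<exists>t. \<forall>n L B. \<not> (finite B \<and> (\<forall>s\<in>B. V s) \<and> dense t L B (X \<restriction> n))"
proof (rule ccontr)
  assume "\<not> ?thesis"
  then have dense: "\<forall>t. \<exists>n L B. finite B \<and> (\<forall>s\<in>B. V s) \<and> dense t L B (X \<restriction> n)"
    by (simp only: not_ex not_all not_not simp_thms)
  obtain f :: "nat \<Rightarrow> bool list option" where f: "computable f" "\<And>s. V s \<longleftrightarrow> (\<exists>i. f i = Some s)"
    using V by (elim ce_enumeration) blast
  obtain h :: "nat \<Rightarrow> nat option" where h: "computable h" "\<And>n. n \<in> halting \<longleftrightarrow> (\<exists>i. h i = Some n)"
    "\<And>i j n. h i = Some n \<Longrightarrow> h j = Some n \<Longrightarrow> i = j"
    using ce_halting by (elim ce_enumeration_inj) blast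
  define len where "len = stage_len f"
  have len_mono: "strict_mono len" unfolding len_def by (rule strict_mono_stage_len)
  define dn where "dn k n s \<longleftrightarrow> dense n (len k) (stage f k) s" for k n s
  have dn_mono: "dn l n s" if "dn k n s" "k \<le> l" for k l n s
  proof -
    have "len k \<le> len l" using that(2) len_mono by (simp add: strict_mono_less_eq)
    from dense_mono[OF that(1)[unfolded dn_def] this stage_mono[OF that(2)]] show ?thesis
      unfolding dn_def .
  qed
  have ex_dn: "\<exists>k m. dn k n (X \<restriction> m)" for n
  proof -
    from dense obtain m L B where B: "finite B" "\<forall>s\<in>B. V s" "dense n L B (X \<restriction> m)"
      by (elim allE[of _ n] exE conjE) (rule that; assumption)
    have "\<exists>i. f i = Some s" if "s \<in> B" for s using B(2) f(2)[of s] that by simp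
    then obtain k where k: "B \<subseteq> stage f k" "L \<le> k"
      using finite_subset_stage[OF B(1), of f L] by metis
    have "L \<le> len k" using k(2) strict_mono_imp_increasing[OF len_mono, of k] by simp
    from dense_mono[OF B(3) this k(1)] show ?thesis unfolding dn_def by (intro exI)
  qed
  have dn_eq: "dn k n s \<longleftrightarrow> length s \<le> len k \<and> (2 ^ n - 1) * 2 ^ (len k - length s) <
      length (filter (\<lambda>r. prefix s r \<and> (\<exists>i<k. case f i of None \<Rightarrow> False | Some b \<Rightarrow> prefix b r)) (strings (len k))) * 2 ^ n" for k n s
  proof -
    have *: "(\<exists>b\<in>stage f k. prefix b r) \<longleftrightarrow> (\<exists>i<k. case f i of None \<Rightarrow> False | Some b \<Rightarrow> prefix b r)" for r
      by (auto simp: stage_def split: option.splits)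
    have "card (covered (len k) (stage f k) s)
      = card (set (filter (\<lambda>r. prefix s r \<and> (\<exists>i<k. case f i of None \<Rightarrow> False | Some b \<Rightarrow> prefix b r)) (strings (len k))))"
      unfolding covered_def * by (rule arg_cong[where f = card]) (auto simp: set_strings)
    also have "\<dots> = length (filter (\<lambda>r. prefix s r \<and> (\<exists>i<k. case f i of None \<Rightarrow> False | Some b \<Rightarrow> prefix b r)) (strings (len k)))"
      by (intro distinct_card distinct_filter distinct_strings)
    finally show ?thesis unfolding dn_def dense_def by simp
  qed
  have dn_comp: "computable (\<lambda>q. dn (fst q) (fst (snd q)) (snd (snd q)))"
    unfolding dn_eq len_def stage_len_def by (intro computable_intros f(1)[THEN computable_compose])
  \<comment> \<open>At the stage \<open>k\<close> at which \<open>n\<close> enters the halting set,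
    the test receives the strings that are still uncovered although a prefix was seen to be dense
    for \<open>n\<close>. They weigh at most \<open>(1/2) ^ n\<close>, hence the total bound
    2.\<close>
  define P where "P r k \<longleftrightarrow> (\<exists>n. h k = Some n \<and> length r = len k \<and> (\<exists>s. prefix s r \<and> dn k n s)
     \<and> (\<forall>i<k. case f i of None \<Rightarrow> True | Some b \<Rightarrow> \<not> prefix b r))" for r k
  define S where "S r \<longleftrightarrow> (\<exists>k. P r k)" for r
  have S_ce: "ce S"
  proof -
    have "ce (\<lambda>r. \<exists>k. P r k)"
      unfolding P_def len_def stage_len_def
      by (intro ce_ex ce_conj; (rule ce_computable)?;
          intro computable_intros f(1)[THEN computable_compose] h(1)[THEN computable_compose] dn_comp[THEN computable_compose3])
    then show ?thesis unfolding S_def .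
  qed
  have S_weight: "(\<Sum>r\<in>F. (1/2 :: real) ^ length r) \<le> 2" if F: "finite F" "\<And>r. r \<in> F \<Longrightarrow> S r" for F
  proof -
    have "\<forall>r\<in>F. \<exists>k. P r k" using F(2) by (simp add: S_def)
    then obtain kk where kk: "\<And>r. r \<in> F \<Longrightarrow> P r (kk r)" by metis
    have h_kk: "\<exists>n. h k = Some n" if k: "k \<in> kk ` F" for k
    proof -
      from k obtain r where r: "r \<in> F" "k = kk r" by (elim imageE)
      from kk[OF r(1)] show ?thesis unfolding P_def r(2) by (elim exE conjE) (rule exI)
    qed
    have "(\<Sum>r\<in>F. (1/2 :: real) ^ length r) = (\<Sum>k\<in>kk ` F. \<Sum>r\<in>{r\<in>F. kk r = k}. (1/2) ^ length r)"
      by (rule sum.image_gen[OF F(1)])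
    also have "\<dots> \<le> (\<Sum>k\<in>kk ` F. (1/2) ^ the (h k))"
    proof (rule sum_mono)
      fix k assume "k \<in> kk ` F"
      then obtain n where n: "h k = Some n" using h_kk by metis
      have "(\<Sum>r\<in>{r\<in>F. kk r = k}. (1/2 :: real) ^ length r) \<le> (1/2) ^ n"
      proof (rule dense_uncovered_weight[of _ "len k" "stage f k" n])
        fix r assume "r \<in> {r\<in>F. kk r = k}"
        then have "P r k" using kk[of r] by simp
        then have *: "length r = len k" "\<exists>s. prefix s r \<and> dn k n s"
          "\<forall>i<k. case f i of None \<Rightarrow> True | Some b \<Rightarrow> \<not> prefix b r"
          unfolding P_def n by simp_all
        have "\<not> prefix b r" if b: "b \<in> stage f k" for b
        proof -
          from b obtain i where "i < k" "f i = Some b" unfolding stage_def by (elim CollectE exE conjE)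
          then show ?thesis using *(3)[rule_format, of i] by simp
        qed
        then show "length r = len k \<and> \<not> (\<exists>b\<in>stage f k. prefix b r) \<and> (\<exists>s. prefix s r \<and> dense n (len k) (stage f k) s)"
          using *(1,2) unfolding dn_def by simp
      qed (use F in simp)
      then show "(\<Sum>r\<in>{r\<in>F. kk r = k}. (1/2 :: real) ^ length r) \<le> (1/2) ^ the (h k)" by (simp add: n)
    qed
    also have "\<dots> = (\<Sum>n\<in>(\<lambda>k. the (h k)) ` kk ` F. (1/2) ^ n)"
    proof -
      have "inj_on (\<lambda>k. the (h k)) (kk ` F)"
      proof (rule inj_onI)
        fix x y assume "x \<in> kk ` F" "y \<in> kk ` F" "the (h x) = the (h y)"
        moreover from this obtain n m where "h x = Some n" "h y = Some m" using h_kk by metis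
        ultimately show "x = y" using h(3) by simp
      qed
      then show ?thesis by (simp add: sum.reindex)
    qed
    also have "\<dots> = 2 * (\<Sum>n\<in>(\<lambda>k. the (h k)) ` kk ` F. (1/2) ^ Suc n)" by (simp add: sum_distrib_left)
    also have "\<dots> \<le> 2 * 1" using F(1) by (intro mult_left_mono sum_half_powers_le) auto
    finally show ?thesis by simp
  qed
  have finS: "finite {r. S r \<and> initial r X}" by (rule Solovay[OF opt rand S_ce S_weight])
  \<comment> \<open>The stages at which a number enters too late; each puts
    \<open>X \<restriction> len k\<close> into the test, so there are finitely many.\<close>
  define T where "T = {k. \<exists>n j m. h k = Some n \<and> j \<le> k \<and> dn j n (X \<restriction> m)}"
  have "finite T"
  proof (rule inj_on_finite[OF _ _ finS])
    show "inj_on (\<lambda>k. X \<restriction> len k) T"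
      by (rule inj_onI) (metis length_initial_segment len_mono strict_mono_eq)
    show "(\<lambda>k. X \<restriction> len k) ` T \<subseteq> {r. S r \<and> initial r X}"
    proof
      fix r assume "r \<in> (\<lambda>k. X \<restriction> len k) ` T"
      then obtain k where k: "r = X \<restriction> len k" "k \<in> T" by (elim imageE)
      from k(2) obtain n j m where j: "h k = Some n" "j \<le> k" "dn j n (X \<restriction> m)"
        unfolding T_def by (elim CollectE exE conjE)
      have d: "dn k n (X \<restriction> m)" using dn_mono[OF j(3,2)] .
      then have "prefix (X \<restriction> m) r" using k(1) by (simp add: prefix_initial_segment dn_def dense_def)
      moreover have "\<not> prefix b r" if "f i = Some b" for i b
      proof
        assume "prefix b r"
        then have "initial b X" unfolding k(1) by (simp add: prefix_initial_segment)
        moreover have "V b" unfolding f(2) using that by (rule exI)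
        ultimately show False using avoid by simp
      qed
      then have "\<forall>i<k. case f i of None \<Rightarrow> True | Some b \<Rightarrow> \<not> prefix b r" by (simp split: option.split)
      ultimately have "P r k"
        unfolding P_def using j(1) d k(1) by (intro exI[of _ n] conjI exI[of _ "X \<restriction> m"]) simp_all
      then have "S r" unfolding S_def by (rule exI)
      then show "r \<in> {r. S r \<and> initial r X}" using k(1) by simp
    qed
  qed
  have "{n. \<exists>k\<in>T. h k = Some n} \<subseteq> (\<lambda>k. the (h k)) ` T"
  proof
    fix n assume "n \<in> {n. \<exists>k\<in>T. h k = Some n}"
    then obtain k where "k \<in> T" "h k = Some n" by (elim CollectE bexE)
    then show "n \<in> (\<lambda>k. the (h k)) ` T" by (intro image_eqI[of _ _ k]) simp_all
  qed
  then have "finite {n. \<exists>k\<in>T. h k = Some n}" by (rule finite_subset) (use \<open>finite T\<close> in simp)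
  then obtain N where N: "set N = {n. \<exists>k\<in>T. h k = Some n}" using finite_list by metis
  have "halting \<le>\<^sub>T X"
  proof (rule turing_leI)
    let ?S = "\<lambda>s n b. b \<and> (\<exists>k. h k = Some n) \<or> \<not> b \<and> n \<notin> set N \<and> (\<exists>k r. prefix r s \<and> dn k n r \<and> (\<forall>i<k. h i \<noteq> Some n))"
    show "ce (\<lambda>q. ?S (fst q) (fst (snd q)) (snd (snd q)))"
      by (intro ce_ex ce_conj ce_disj; (rule ce_computable)?;
          intro computable_intros h(1)[THEN computable_compose] dn_comp[THEN computable_compose3])
    show "\<exists>s. initial s X \<and> ?S s n (n \<in> halting)" for n
    proof (cases "n \<in> halting")
      case True
      then have "\<exists>k. h k = Some n" using h(2) by simp
      then show ?thesis using True by (intro exI[of _ "[]"]) (simp add: initial_iff)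
    next
      case False
      obtain k m where "dn k n (X \<restriction> m)" using ex_dn[of n] by (elim exE)
      moreover have "n \<notin> set N" "\<forall>i<k. h i \<noteq> Some n" using False h(2) N by auto
      ultimately show ?thesis using False by (intro exI[of _ "X \<restriction> m"]) auto
    qed
    show "b \<longleftrightarrow> n \<in> halting" if s: "initial s X" and S: "?S s n b" for s n b
    proof (cases b)
      case True
      then show ?thesis using S h(2) by auto
    next
      case False
      from S False have "n \<notin> set N \<and> (\<exists>k r. prefix r s \<and> dn k n r \<and> (\<forall>i<k. h i \<noteq> Some n))"
        by (simp only: simp_thms)
      then obtain k r where kr: "n \<notin> set N" "prefix r s" "dn k n r" "\<forall>i<k. h i \<noteq> Some n"
        by (elim exE conjE)
      have "r = X \<restriction> length r" using initial_prefix[OF s kr(2)] by (simp add: initial_def)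
      have "n \<notin> halting"
      proof
        assume "n \<in> halting"
        then obtain i where i: "h i = Some n" unfolding h(2) by (elim exE)
        then have "k \<le> i" using kr(4) not_less by metis
        moreover have "dn k n (X \<restriction> length r)" using kr(3) \<open>r = X \<restriction> length r\<close> by simp
        ultimately have "i \<in> T" unfolding T_def using i by (intro CollectI exI conjI)
        then show False using N i kr(1) by auto
      qed
      then show ?thesis using False by simp
    qed
  qed
  then show False using incomplete by simp
qed

subsection \<open>Bits killed by too many oracles\<close>

lemma computable_concat [computable_intros]:
  assumes "computable xs" shows "computable (\<lambda>x. concat (xs x))"
proof -
  have *: "concat zs = foldr (@) zs []" for zs :: "'z list list"
    by (induction zs) auto
  show ?thesis unfolding * by (intro computable_intros assms[THEN computable_compose])
qed

lemma initial_segment_Suc: "Z \<restriction> Suc n = (Z \<restriction> n) @ [n \<in> Z]"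
  by (simp add: initial_segment_def)

lemma initial_segment_nth_list: "i < n \<Longrightarrow> take (Suc 0) (drop i (Z \<restriction> n)) = [i \<in> Z]"
  by (simp add: take_Suc_0_drop)

lemma prefix_segment_mono: "m \<le> n \<Longrightarrow> prefix (Z \<restriction> m) (Z \<restriction> n)"
  by (simp add: prefix_initial_segment)

text \<open>Entries are taken as sublists of length at most one, so nothing undefined arises if
  \<open>b\<close> is shorter than \<open>a\<close>.\<close>

definition interleave :: "bool list \<Rightarrow> bool list \<Rightarrow> bool list" where
  "interleave a b = concat (map (\<lambda>i. take (Suc 0) (drop i a) @ take (Suc 0) (drop i b)) [0..<length a])"

lemma mem_join: "2 * n \<in> A \<oplus>\<^sub>T B \<longleftrightarrow> n \<in> A" "Suc (2 * n) \<in> A \<oplus>\<^sub>T B \<longleftrightarrow> n \<in> B"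
  unfolding join_def by (auto; presburger)+

lemma interleave_initial: "interleave (Z \<restriction> m) (Y \<restriction> m) = (Z \<oplus>\<^sub>T Y) \<restriction> (2 * m)"
proof -
  have "interleave (Z \<restriction> m) (Y \<restriction> m) = concat (map (\<lambda>i. [i \<in> Z, i \<in> Y]) [0..<m])"
    unfolding interleave_def by (rule arg_cong[where f = concat]) (simp add: initial_segment_nth_list)
  also have "\<dots> = (Z \<oplus>\<^sub>T Y) \<restriction> (2 * m)"
    by (induction m) (simp_all add: initial_segment_Suc mem_join, simp add: initial_segment_def)
  finally show ?thesis .
qed

definition evens :: "bool list \<Rightarrow> bool list" where
  "evens s = concat (map (\<lambda>i. take (Suc 0) (drop (2 * i) s)) [0..<length s div 2])"

lemma evens_initial: "evens ((Z \<oplus>\<^sub>T Y) \<restriction> n) = Z \<restriction> (n div 2)"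
proof -
  have "evens ((Z \<oplus>\<^sub>T Y) \<restriction> n) = concat (map (\<lambda>i. [i \<in> Z]) [0..<n div 2])"
    unfolding evens_def by (rule arg_cong[where f = concat]) (simp add: initial_segment_nth_list mem_join)
  also have "\<dots> = Z \<restriction> (n div 2)" by (simp add: initial_segment_def)
  finally show ?thesis .
qed

lemma computable_interleave [computable_intros]:
  "computable f \<Longrightarrow> computable g \<Longrightarrow> computable (\<lambda>x. interleave (f x) (g x))"
  unfolding interleave_def
  by (intro computable_intros; erule computable_compose; intro computable_intros)

lemma computable_evens [computable_intros]:
  "computable f \<Longrightarrow> computable (\<lambda>x. evens (f x))"
  unfolding evens_def
  by (intro computable_intros; erule computable_compose; intro computable_intros)

definition Ev_enum :: "nat \<Rightarrow> (bool list \<times> prog \<times> nat \<times> nat) option" where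
  "Ev_enum = (SOME f. computable f \<and>
     (\<forall>q. Ev (fst q) (fst (snd q)) (fst (snd (snd q))) (snd (snd (snd q))) \<longleftrightarrow> (\<exists>n. f n = Some q)))"

lemma Ev_enum: "computable Ev_enum" "Ev s p x y \<longleftrightarrow> (\<exists>n. Ev_enum n = Some (s, p, x, y))"
proof -
  have ex: "\<exists>f :: nat \<Rightarrow> (bool list \<times> prog \<times> nat \<times> nat) option. computable f \<and>
     (\<forall>q. Ev (fst q) (fst (snd q)) (fst (snd (snd q))) (snd (snd (snd q))) \<longleftrightarrow> (\<exists>n. f n = Some q))"
    by (rule ce_enumeration[OF ce_Ev]) blast
  from someI_ex[OF this, folded Ev_enum_def]
  have *: "computable Ev_enum \<and> (\<forall>q. Ev (fst q) (fst (snd q)) (fst (snd (snd q))) (snd (snd (snd q))) \<longleftrightarrow> (\<exists>n. Ev_enum n = Some q))" .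
  show "computable Ev_enum" using * by (rule conjunct1)
  show "Ev s p x y \<longleftrightarrow> (\<exists>n. Ev_enum n = Some (s, p, x, y))"
    using conjunct2[OF *, rule_format, of "(s, p, x, y)"] by simp
qed

text \<open>The length of \<open>a\<close> bounds both the known part of the oracle and the stage of
  the enumeration, so that the relation is decidable and monotone in the level.\<close>

definition conv :: "prog \<Rightarrow> nat \<Rightarrow> bool list \<Rightarrow> bool list \<Rightarrow> bool" where
  "conv e c a r \<longleftrightarrow> (\<exists>i<length a. case Ev_enum i of None \<Rightarrow> False | Some q \<Rightarrow> prefix (fst q) (interleave a r) \<and>
     fst (snd q) = e \<and> fst (snd (snd q)) = c \<and> snd (snd (snd q)) = 0)"

lemma computable_conv [computable_intros]:
  assumes "computable e" "computable c" "computable a" "computable r"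
  shows "computable (\<lambda>x. conv (e x) (c x) (a x) (r x))"
  unfolding conv_def
  by (intro computable_intros assms[THEN computable_compose] Ev_enum(1)[THEN computable_compose])

lemma conv_initial:
  "conv e c (Z \<restriction> m) (Y \<restriction> m) \<longleftrightarrow> (\<exists>i<m. \<exists>s. Ev_enum i = Some (s, e, c, 0) \<and> prefix s ((Z \<oplus>\<^sub>T Y) \<restriction> (2 * m)))"
  unfolding conv_def interleave_initial
  by (auto split: option.splits) fastforce

lemma conv_mono:
  assumes "conv e c (Z \<restriction> m) (Y \<restriction> m)" "m \<le> n" shows "conv e c (Z \<restriction> n) (Y \<restriction> n)"
proof -
  from assms(1) obtain i s where i: "i < m" "Ev_enum i = Some (s, e, c, 0)" "prefix s ((Z \<oplus>\<^sub>T Y) \<restriction> (2 * m))"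
    unfolding conv_initial by (elim exE conjE)
  have "prefix s ((Z \<oplus>\<^sub>T Y) \<restriction> (2 * n))"
    by (rule prefix_order.trans[OF i(3) prefix_segment_mono]) (use assms(2) in simp)
  then show ?thesis unfolding conv_initial using i assms(2) by (intro exI[of _ i] exI[of _ s]) simp
qed

lemma conv_sound:
  assumes "conv e c (Z \<restriction> m) (Y \<restriction> m)" shows "eval (Z \<oplus>\<^sub>T Y) e c = Some 0"
proof -
  from assms obtain i s where i: "Ev_enum i = Some (s, e, c, 0)" "prefix s ((Z \<oplus>\<^sub>T Y) \<restriction> (2 * m))"
    unfolding conv_initial by (elim exE conjE)
  have "Ev s e c 0" unfolding Ev_enum(2) using i(1) by (rule exI)
  moreover have "initial s (Z \<oplus>\<^sub>T Y)" using i(2) by (simp add: prefix_initial_segment)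
  ultimately show ?thesis by (rule Ev_sound)
qed

lemma conv_complete:
  assumes "eval (Z \<oplus>\<^sub>T Y) e c = Some 0" shows "\<exists>m. \<forall>n\<ge>m. conv e c (Z \<restriction> n) (Y \<restriction> n)"
proof -
  from Ev_complete[OF assms] obtain k where "Ev ((Z \<oplus>\<^sub>T Y) \<restriction> k) e c 0" by (elim exE)
  then obtain i where i: "Ev_enum i = Some ((Z \<oplus>\<^sub>T Y) \<restriction> k, e, c, 0)" unfolding Ev_enum(2) by (elim exE)
  have "conv e c (Z \<restriction> n) (Y \<restriction> n)" if "Suc (i + k) \<le> n" for n
    unfolding conv_initial using i that
    by (intro exI[of _ i] exI[of _ "(Z \<oplus>\<^sub>T Y) \<restriction> k"]) (simp add: prefix_segment_mono)
  then show ?thesis by blast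
qed

lemma ex_initial_segment: "\<exists>Z. s = Z \<restriction> length s"
  using ex_initial_of_string[of s] by (simp add: initial_def)

text \<open>
  The bit \<open>(e, t, s)\<close> is killed along \<open>A\<close> when the oracles \<open>r\<close> above \<open>s\<close> for which \<open>e\<close> claims, using \<open>A \<oplus>\<^sub>T r\<close>, that
  it is not killed have relative measure above \<open>1 - (1/2) ^ t\<close>.
\<close>

type_synonym bit = "prog \<times> nat \<times> bool list"

definition hits :: "bool list \<Rightarrow> bit \<Rightarrow> bool list set" where
  "hits a b = {r. length r = length a \<and> prefix (snd (snd b)) r \<and> conv (fst b) (enc b) a r}"

text \<open>The measure condition is counted at level \<open>length a\<close>, as in
  \<open>dense\<close>. The condition on \<open>enc b\<close> admits finitely many bits per level,
  so that errors at a level can be found by a bounded search.\<close>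

definition overfull :: "bool list \<Rightarrow> bit \<Rightarrow> bool" where
  "overfull a b \<longleftrightarrow> enc b \<le> length a \<and> length (snd (snd b)) \<le> length a \<and>
     (2 ^ fst (snd b) - 1) * 2 ^ (length a - length (snd (snd b))) < card (hits a b) * 2 ^ fst (snd b)"

text \<open>Only the first overfull level counts, so along any set each bit is killed at most once
  and the requests can be given weight \<open>(1/2) ^ Suc (enc b)\<close>.\<close>

definition kill :: "bool list \<Rightarrow> bit \<Rightarrow> bool" where
  "kill a b \<longleftrightarrow> overfull a b \<and> (\<forall>m<length a. \<not> overfull (take m a) b)"

definition killed :: "nat set \<Rightarrow> nat set" where
  "killed A = {enc b | b. \<exists>s. overfull (A \<restriction> s) b}"

lemma enc_in_killed: "enc b \<in> killed A \<longleftrightarrow> (\<exists>s. overfull (A \<restriction> s) b)"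
  by (simp only: killed_def mem_Collect_eq enc_inject ex_simps simp_thms)

lemma card_hits: "card (hits a b) = length (filter (\<lambda>r. prefix (snd (snd b)) r \<and> conv (fst b) (enc b) a r) (strings (length a)))"
proof -
  have "card (hits a b) = card (set (filter (\<lambda>r. prefix (snd (snd b)) r \<and> conv (fst b) (enc b) a r) (strings (length a))))"
    unfolding hits_def by (rule arg_cong[where f = card]) (auto simp: set_strings)
  then show ?thesis using distinct_card[OF distinct_filter[OF distinct_strings]] by metis
qed

lemma computable_overfull [computable_intros]:
  assumes "computable a" "computable b" shows "computable (\<lambda>x. overfull (a x) (b x))"
  unfolding overfull_def card_hits by (intro computable_intros assms[THEN computable_compose])

lemma computable_kill [computable_intros]:
  assumes "computable a" "computable b" shows "computable (\<lambda>x. kill (a x) (b x))"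
  unfolding kill_def by (intro computable_intros assms[THEN computable_compose])

lemma kill_overfull: "kill a b \<Longrightarrow> overfull a b"
  by (simp add: kill_def)

lemma ex_kill:
  assumes "overfull (A \<restriction> s) b" shows "\<exists>n. kill (A \<restriction> n) b"
proof -
  have "\<exists>n. overfull (A \<restriction> n) b" using assms by (rule exI)
  from least_witness[OF this] obtain n where n: "overfull (A \<restriction> n) b" "\<forall>m<n. \<not> overfull (A \<restriction> m) b"
    by (elim exE conjE)
  have "kill (A \<restriction> n) b" unfolding kill_def using n by (simp add: min_def)
  then show ?thesis by (rule exI)
qed

lemma kill_unique:
  assumes "kill (A \<restriction> n) b" "kill (A \<restriction> m) b" shows "n = m"
proof -
  have *: False if "k < l" "kill (A \<restriction> k) b" "kill (A \<restriction> l) b" for k l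
    using that by (simp add: kill_def min_def)
  show ?thesis using *[of n m] *[of m n] assms by (metis linorder_neqE_nat)
qed

section \<open>Deciding the killed bits\<close>

lemma sum_enc_le:
  assumes "finite F" "inj_on g F"
  shows "(\<Sum>x\<in>F. (1/2 :: real) ^ Suc (enc (g x :: 'b::enc))) \<le> 1"
proof -
  have "inj_on (\<lambda>x. enc (g x)) F" using assms(2) by (simp add: inj_on_def)
  then have "(\<Sum>x\<in>F. (1/2 :: real) ^ Suc (enc (g x))) = (\<Sum>n\<in>(\<lambda>x. enc (g x)) ` F. (1/2) ^ Suc n)"
    by (simp only: sum.reindex o_def)
  also have "\<dots> \<le> 1" using assms(1) by (intro sum_half_powers_le) simp
  finally show ?thesis .
qed

text \<open>Infinitely many requests of equal weight would exceed every bound.\<close>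

lemma covers_finite_fibre:
  assumes "covers W tau r A V B" "\<And>x. P x \<Longrightarrow> r x = k"
  shows "finite {x. V x \<and> P x}"
proof (rule ccontr)
  assume inf: "infinite {x. V x \<and> P x}"
  obtain n :: nat where n: "B * 2 ^ k < real n" using reals_Archimedean2 by blast
  obtain T where T: "finite T" "card T = n" "T \<subseteq> {x. V x \<and> P x}"
    using infinite_arbitrarily_large[OF inf] by blast
  have "(\<Sum>x\<in>T. (1/2 :: real) ^ r x) \<le> B"
    using assms(1) T unfolding covers_def by blast
  moreover have "(\<Sum>x\<in>T. (1/2 :: real) ^ r x) = (\<Sum>x\<in>T. (1/2) ^ k)"
    by (rule sum.cong) (use T(3) assms(2) in auto)
  ultimately have "real n * (1/2) ^ k \<le> B" using T(2) by simp
  then have "real n \<le> B * 2 ^ k" by (simp add: field_simps power_one_over)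
  then show False using n by simp
qed

text \<open>Since along any set a bit has at most one kill, the covering lemma applies and leaves
  finitely many candidates \<open>a\<close> for each bit. The halting set confirms that a list of
  candidates is complete, after which \<open>A\<close> decides whether one of them lies along
  it.\<close>

lemma killed_turing_le:
  assumes opt: "optimal_machine U" and triv: "K_trivial U A" and h: "halting \<le>\<^sub>T A \<oplus>\<^sub>T X"
  shows "killed A \<le>\<^sub>T A \<oplus>\<^sub>T X"
proof -
  let ?W = "\<lambda>x :: bool list \<times> bit. kill (fst x) (snd x)"
  have W_ce: "ce ?W" by (intro ce_computable computable_intros)
  have W_weight: "\<forall>Z F. finite F \<and> (\<forall>x\<in>F. ?W x \<and> initial (fst x) Z) \<longrightarrow>
    (\<Sum>x\<in>F. (1/2 :: real) ^ Suc (enc (snd x))) \<le> 1"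
  proof (intro allI impI, elim conjE)
    fix Z and F :: "(bool list \<times> bit) set" assume F1: "finite F" and F2: "\<forall>x\<in>F. ?W x \<and> initial (fst x) Z"
    note F = F1 bspec[OF F2]
    show "(\<Sum>x\<in>F. (1/2 :: real) ^ Suc (enc (snd x))) \<le> 1"
    proof (rule sum_enc_le[OF F(1)], rule inj_onI)
      fix x y assume xy: "x \<in> F" "y \<in> F" "snd x = snd y"
      have "kill (Z \<restriction> length (fst x)) (snd x)" "kill (Z \<restriction> length (fst y)) (snd x)"
        using F(2)[OF xy(1)] F(2)[OF xy(2)] xy(3) unfolding initial_def by metis+
      then have "length (fst x) = length (fst y)" by (rule kill_unique)
      then have "fst x = fst y" using F(2)[OF xy(1)] F(2)[OF xy(2)] unfolding initial_def by metis
      then show "x = y" using xy(3) by (simp add: prod_eq_iff)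
    qed
  qed
  have tau: "computable (\<lambda>x :: bool list \<times> bit. fst x)" and r: "computable (\<lambda>x :: bool list \<times> bit. Suc (enc (snd x)))"
    by (intro computable_intros)+
  obtain V B where V: "covers ?W fst (\<lambda>x. Suc (enc (snd x))) A V B"
    using covering[OF opt triv W_ce tau r W_weight] by (elim exE)
  have V_ce: "ce V" and V_kill: "\<And>a b. V (a, b) \<Longrightarrow> kill a b"
    and V_cov: "\<And>a b. kill a b \<Longrightarrow> initial a A \<Longrightarrow> V (a, b)"
    using V unfolding covers_def by auto
  have V_fin: "finite {a. V (a, b)}" for b
  proof -
    have "finite {x. V x \<and> snd x = b}" by (rule covers_finite_fibre[OF V, where k = "Suc (enc b)"]) simp
    then have "finite (fst ` {x. V x \<and> snd x = b})" by (rule finite_imageI)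
    moreover have "{a. V (a, b)} \<subseteq> fst ` {x. V x \<and> snd x = b}" by force
    ultimately show ?thesis by (rule finite_subset[rotated])
  qed
  \<comment> \<open>\<open>Q (b, L)\<close> says that the list \<open>L\<close> misses a candidate
    for \<open>b\<close>. It is c.e., so the program \<open>p\<close> for the halting set can refute
    it.\<close>
  define Q where "Q x \<longleftrightarrow> (\<exists>a. V (a, fst x) \<and> a \<notin> set (snd x))" for x :: "bit \<times> bool list list"
  have "ce (\<lambda>x. \<exists>a. V (a, fst x) \<and> a \<notin> set (snd x))"
    by (intro ce_ex ce_conj ce_compose[OF V_ce]; (rule ce_computable)?; intro computable_intros)
  then have "ce Q" unfolding Q_def .
  then obtain f where f: "computable f" "\<And>x. Q x \<longleftrightarrow> f x \<in> halting" using halting_reduction by metis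
  obtain p where p: "\<And>n. eval (A \<oplus>\<^sub>T X) p n = Some (of_bool (n \<in> halting))"
    using h unfolding turing_le_def by metis
  \<comment> \<open>A positive answer exhibits a kill along \<open>A\<close>. A negative one needs a
    complete list all of whose members are off \<open>A\<close>, or a number that is not the code of
    a bit.\<close>
  let ?S = "\<lambda>s c y. y \<and> (\<exists>a b. c = enc b \<and> kill a b \<and> prefix a (evens s))
    \<or> \<not> y \<and> (c \<noteq> enc (dec c :: bit) \<or> (\<exists>L. Ev s p (f (dec c, L)) 0 \<and>
        (\<forall>a\<in>set L. length a \<le> length (evens s) \<and> \<not> prefix a (evens s))))"
  show ?thesis
  proof (rule turing_leI[where S = ?S])
    show "ce (\<lambda>q. ?S (fst q) (fst (snd q)) (snd (snd q)))"
      by (intro ce_ex ce_conj ce_disj ce_Ev_compose; (rule ce_computable)?;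
          intro computable_intros f(1)[THEN computable_compose])
    show "\<exists>s. initial s (A \<oplus>\<^sub>T X) \<and> ?S s c (c \<in> killed A)" for c
    proof (cases "c \<in> killed A")
      case True
      then obtain b s where b: "c = enc b" "overfull (A \<restriction> s) b" unfolding killed_def by blast
      obtain n where "kill (A \<restriction> n) b" using ex_kill[OF b(2)] by (elim exE)
      moreover have "evens ((A \<oplus>\<^sub>T X) \<restriction> (2 * n)) = A \<restriction> n" by (simp add: evens_initial)
      ultimately have "\<exists>a b. c = enc b \<and> kill a b \<and> prefix a (evens ((A \<oplus>\<^sub>T X) \<restriction> (2 * n)))"
        using b(1) by (intro exI[of _ "A \<restriction> n"] exI[of _ b]) simp
      then show ?thesis using True by (intro exI[of _ "(A \<oplus>\<^sub>T X) \<restriction> (2 * n)"]) simp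
    next
      case False
      define b where "b = (dec c :: bit)"
      show ?thesis
      proof (cases "c = enc b")
        case True
        obtain L where L: "set L = {a. V (a, b)}" using finite_list[OF V_fin] by metis
        have "\<not> Q (b, L)" unfolding Q_def using L by simp
        then have "f (b, L) \<notin> halting" using f(2) by simp
        then have "eval (A \<oplus>\<^sub>T X) p (f (b, L)) = Some 0" using p by simp
        then obtain k where k: "Ev ((A \<oplus>\<^sub>T X) \<restriction> k) p (f (b, L)) 0" using Ev_complete by metis
        \<comment> \<open>Only half of the bits of the join belong to \<open>A\<close>; hence the
          factor 2 for deciding all members of \<open>L\<close>.\<close>
        define n where "n = max k (2 * Max (insert 0 (length ` set L)))"
        have len: "length a \<le> n div 2" if "a \<in> set L" for a
        proof -
          have "length a \<le> Max (insert 0 (length ` set L))" using that by simp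
          then show ?thesis unfolding n_def by linarith
        qed
        have "\<not> prefix a (A \<restriction> (n div 2))" if "a \<in> set L" for a
        proof
          assume "prefix a (A \<restriction> (n div 2))"
          then have "a = A \<restriction> length a" by (simp add: prefix_initial_segment initial_def)
          moreover have "overfull a b" using that L V_kill kill_overfull by auto
          ultimately have "overfull (A \<restriction> length a) b" by simp
          then have "enc b \<in> killed A" unfolding enc_in_killed by (rule exI)
          then show False using False True by simp
        qed
        moreover have "Ev ((A \<oplus>\<^sub>T X) \<restriction> n) p (f (b, L)) 0" by (rule Ev_mono_initial[OF k]) (simp add: n_def)
        ultimately have "\<exists>L. Ev ((A \<oplus>\<^sub>T X) \<restriction> n) p (f (dec c, L)) 0 \<and>
          (\<forall>a\<in>set L. length a \<le> length (evens ((A \<oplus>\<^sub>T X) \<restriction> n)) \<and> \<not> prefix a (evens ((A \<oplus>\<^sub>T X) \<restriction> n)))"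
          unfolding evens_initial b_def[symmetric] using len by (intro exI[of _ L]) simp
        then show ?thesis using False by (intro exI[of _ "(A \<oplus>\<^sub>T X) \<restriction> n"]) simp
      next
        case ne: False
        then show ?thesis using False unfolding b_def by (intro exI[of _ "[]"]) (simp add: initial_iff)
      qed
    qed
    show "y \<longleftrightarrow> c \<in> killed A" if s: "initial s (A \<oplus>\<^sub>T X)" and S: "?S s c y" for s c y
    proof -
      have ev: "evens s = A \<restriction> (length s div 2)" using s evens_initial unfolding initial_def by metis
      show ?thesis
      proof (cases y)
        case True
        then have "\<exists>a b. c = enc b \<and> kill a b \<and> prefix a (evens s)" using S by simp
        then obtain a b where b: "c = enc b" "kill a b" "prefix a (evens s)" by (elim exE conjE)
        have "a = A \<restriction> length a" using b(3) unfolding ev by (simp add: prefix_initial_segment initial_def)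
        then have "overfull (A \<restriction> length a) b" using kill_overfull[OF b(2)] by simp
        then have "c \<in> killed A" unfolding b(1) enc_in_killed by (rule exI)
        then show ?thesis using True by simp
      next
        case False
        then have *: "c \<noteq> enc (dec c :: bit) \<or> (\<exists>L. Ev s p (f (dec c, L)) 0 \<and>
          (\<forall>a\<in>set L. length a \<le> length (evens s) \<and> \<not> prefix a (evens s)))" using S by simp
        have "c \<notin> killed A"
        proof
          assume "c \<in> killed A"
          then obtain b m where b: "c = enc b" "overfull (A \<restriction> m) b" unfolding killed_def by blast
          then have dec: "dec c = b" by simp
          with * b(1) obtain L where L: "Ev s p (f (b, L)) 0"
            "\<forall>a\<in>set L. length a \<le> length (evens s) \<and> \<not> prefix a (evens s)" by auto
          have "eval (A \<oplus>\<^sub>T X) p (f (b, L)) = Some 0" by (rule Ev_sound[OF L(1) s])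
          then have "f (b, L) \<notin> halting" using p[of "f (b, L)"] by auto
          then have nQ: "\<not> Q (b, L)" using f(2) by simp
          obtain n where "kill (A \<restriction> n) b" using ex_kill[OF b(2)] by (elim exE)
          then have "V (A \<restriction> n, b)" by (rule V_cov) simp
          then have "A \<restriction> n \<in> set L" using nQ unfolding Q_def by auto
          then have "n \<le> length s div 2" "\<not> prefix (A \<restriction> n) (A \<restriction> (length s div 2))"
            using L(2) unfolding ev by auto
          then show False using prefix_segment_mono by blast
        qed
        then show ?thesis using False by simp
      qed
    qed
  qed
qed

text \<open>This removes the oracle from a Solovay test relative to \<open>A\<close>. The covering
  lemma yields a c.e. family of pairs with bounded weight that keeps all pairs along
  \<open>A\<close>. Projecting it chooses one \<open>a\<close> per \<open>r\<close>, so its weight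
  bounds that of the plain test \<open>S\<close>.\<close>

lemma ex_projected_covering:
  fixes W :: "bool list \<times> bool list \<Rightarrow> bool"
  assumes opt: "optimal_machine U" and triv: "K_trivial U A" and rand: "martin_loef_random U X"
    and W: "ce W" and len: "\<forall>x. W x \<longrightarrow> length (fst x) = length (snd x)"
    and weight: "\<forall>Z F. finite F \<and> (\<forall>r\<in>F. W (Z \<restriction> length r, r)) \<longrightarrow> (\<Sum>r\<in>F. (1/2 :: real) ^ length r) \<le> 2 ^ k"
  shows "\<exists>S. ce S \<and> (\<forall>r. S r \<longrightarrow> (\<exists>a. W (a, r))) \<and> (\<forall>r. W (A \<restriction> length r, r) \<longrightarrow> S r) \<and>
    finite {r. S r \<and> initial r X}"
proof -
  \<comment> \<open>The shift by \<open>k\<close> scales weights bounded by \<open>2 ^ k\<close>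
    down to 1.\<close>
  let ?r = "\<lambda>x :: bool list \<times> bool list. length (snd x) + k"
  have tau: "computable (\<lambda>x :: bool list \<times> bool list. fst x)" and r: "computable ?r"
    by (intro computable_intros)+
  have W_weight: "\<forall>Z F. finite F \<and> (\<forall>x\<in>F. W x \<and> initial (fst x) Z) \<longrightarrow> (\<Sum>x\<in>F. (1/2 :: real) ^ ?r x) \<le> 1"
  proof (intro allI impI, elim conjE)
    fix Z and F :: "(bool list \<times> bool list) set"
    assume F: "finite F" "\<forall>x\<in>F. W x \<and> initial (fst x) Z"
    have fst: "fst x = Z \<restriction> length (snd x)" if "x \<in> F" for x
      using bspec[OF F(2) that] len unfolding initial_def by metis
    have inj: "inj_on snd F" by (rule inj_onI) (metis fst prod_eqI)
    have "\<forall>r\<in>snd ` F. W (Z \<restriction> length r, r)"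
    proof
      fix r assume "r \<in> snd ` F"
      then obtain x where x: "x \<in> F" "r = snd x" by (elim imageE)
      have "(Z \<restriction> length r, r) = x" using fst[OF x(1)] x(2) by (simp add: prod_eq_iff)
      then show "W (Z \<restriction> length r, r)" using bspec[OF F(2) x(1)] by simp
    qed
    then have le: "(\<Sum>r\<in>snd ` F. (1/2 :: real) ^ length r) \<le> 2 ^ k"
      using weight F(1) by (metis finite_imageI)
    have "(\<Sum>x\<in>F. (1/2 :: real) ^ ?r x) = (1/2) ^ k * (\<Sum>x\<in>F. (1/2) ^ length (snd x))"
      by (simp add: power_add sum_distrib_left mult.commute)
    also have "\<dots> = (1/2) ^ k * (\<Sum>r\<in>snd ` F. (1/2) ^ length r)"
      by (simp add: sum.reindex[OF inj])
    also have "\<dots> \<le> (1/2) ^ k * 2 ^ k" using le by (intro mult_left_mono) simp_all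
    also have "\<dots> = (1 :: real)" by (simp add: power_one_over)
    finally show "(\<Sum>x\<in>F. (1/2 :: real) ^ ?r x) \<le> 1" .
  qed
  obtain V B where V: "covers W fst ?r A V B"
    using covering[OF opt triv W tau r W_weight] by (elim exE)
  note V' = V[unfolded covers_def]
  note V_ce = conjunct1[OF V'] and V_W = V'[THEN conjunct2, THEN conjunct1, THEN spec, THEN mp]
    and V_cov = V'[THEN conjunct2, THEN conjunct2, THEN conjunct1, THEN spec, THEN mp, OF conjI]
    and V_weight = V'[THEN conjunct2, THEN conjunct2, THEN conjunct2, THEN spec, THEN mp, OF conjI]
  define S where "S r \<longleftrightarrow> (\<exists>a. V (a, r))" for r
  have "ce (\<lambda>r. \<exists>a. V (a, r))"
    by (intro ce_ex ce_compose[OF V_ce]; intro computable_intros)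
  then have S_ce: "ce S" unfolding S_def .
  have "finite {r. S r \<and> initial r X}"
  proof (rule Solovay[OF opt rand S_ce])
    fix F :: "bool list set" assume F: "finite F" "\<And>s. s \<in> F \<Longrightarrow> S s"
    have "\<forall>r\<in>F. \<exists>a. V (a, r)" using F(2) unfolding S_def by blast
    then obtain h where h: "\<And>r. r \<in> F \<Longrightarrow> V (h r, r)" by metis
    have "(\<Sum>r\<in>F. (1/2 :: real) ^ (length r + k)) = (\<Sum>x\<in>(\<lambda>r. (h r, r)) ` F. (1/2) ^ ?r x)"
      by (subst sum.reindex) (simp_all add: inj_on_def)
    also have "\<dots> \<le> B" using h F(1) by (intro V_weight) auto
    finally have "(\<Sum>r\<in>F. (1/2 :: real) ^ length r) * (1/2) ^ k \<le> B"
      by (simp add: power_add sum_distrib_right)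
    then show "(\<Sum>r\<in>F. (1/2 :: real) ^ length r) \<le> B * 2 ^ k" by (simp add: field_simps power_one_over)
  qed
  moreover have "\<forall>r. S r \<longrightarrow> (\<exists>a. W (a, r))" using V_W unfolding S_def by blast
  moreover have "\<forall>r. W (A \<restriction> length r, r) \<longrightarrow> S r"
  proof (intro allI impI)
    fix r assume "W (A \<restriction> length r, r)"
    then have "V (A \<restriction> length r, r)" by (rule V_cov) simp
    then show "S r" unfolding S_def by (rule exI)
  qed
  ultimately show ?thesis using S_ce by (intro exI[of _ S]) simp
qed

section \<open>Oracles on which a program errs about a killed bit\<close>

definition wrong :: "prog \<Rightarrow> bool list \<Rightarrow> bool list \<Rightarrow> bool" where
  "wrong e a r \<longleftrightarrow> (\<exists>c<Suc (length a). fst (dec c :: bit) = e \<and> kill a (dec c) \<and> r \<in> hits a (dec c))"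

text \<open>Restricted to first errors, so that along any fixed set they form an antichain and weigh
  at most 1.\<close>

definition first_wrong :: "prog \<Rightarrow> bool list \<Rightarrow> bool list \<Rightarrow> bool" where
  "first_wrong e a r \<longleftrightarrow> wrong e a r \<and> (\<forall>m<length a. \<not> wrong e (take m a) (take m r))"

lemma computable_wrong [computable_intros]:
  assumes "computable e" "computable a" "computable r" shows "computable (\<lambda>x. wrong (e x) (a x) (r x))"
  unfolding wrong_def hits_def mem_Collect_eq by (intro computable_intros assms[THEN computable_compose])

lemma computable_first_wrong:
  assumes "computable e" "computable a" "computable r" shows "computable (\<lambda>x. first_wrong (e x) (a x) (r x))"
  unfolding first_wrong_def by (intro computable_intros assms[THEN computable_compose])

lemma wrong_length: "wrong e a r \<Longrightarrow> length a = length r"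
  unfolding wrong_def hits_def by auto

lemma wrong_iff: "wrong e a r \<longleftrightarrow> (\<exists>b. fst b = e \<and> kill a b \<and> r \<in> hits a b)"
proof
  assume "wrong e a r" then show "\<exists>b. fst b = e \<and> kill a b \<and> r \<in> hits a b" unfolding wrong_def by blast
next
  assume "\<exists>b. fst b = e \<and> kill a b \<and> r \<in> hits a b"
  then obtain b where b: "fst b = e" "kill a b" "r \<in> hits a b" by (elim exE conjE)
  have "enc b < Suc (length a)" using kill_overfull[OF b(2)] unfolding overfull_def by simp
  then show "wrong e a r" unfolding wrong_def using b by (intro exI[of _ "enc b"]) (simp del: enc_Pair)
qed

lemma ex_first_wrong:
  assumes "wrong e (Z \<restriction> n) r" shows "\<exists>m\<le>n. first_wrong e (Z \<restriction> m) (take m r)"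
proof -
  have len: "length r = n" using wrong_length[OF assms] by simp
  define P where "P m \<longleftrightarrow> m \<le> n \<and> wrong e (Z \<restriction> m) (take m r)" for m
  have "P n" using assms len by (simp add: P_def)
  then have "\<exists>m. P m" by (rule exI)
  from least_witness[OF this] obtain m where m: "P m" "\<forall>l<m. \<not> P l" by (elim exE conjE)
  have "m \<le> n" "wrong e (Z \<restriction> m) (take m r)" using m(1) by (simp_all add: P_def)
  moreover have "\<not> wrong e (Z \<restriction> l) (take l r)" if "l < m" for l
    using m(2) that \<open>m \<le> n\<close> by (simp add: P_def)
  ultimately show ?thesis unfolding first_wrong_def by (intro exI[of _ m]) (simp add: min_def)
qed

lemma first_wrong_antichain: "antichain {r. first_wrong e (Z \<restriction> length r) r}"
  unfolding antichain_def mem_Collect_eq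
proof (intro ballI impI, unfold mem_Collect_eq)
  fix r r' assume r: "first_wrong e (Z \<restriction> length r) r" "first_wrong e (Z \<restriction> length r') r'" "prefix r r'"
  have take: "take (length r) r' = r" using r(3) by (metis append_eq_conv_conj prefix_def)
  have "length r \<le> length r'" using r(3) by (rule prefix_length_le)
  moreover have False if "length r < length r'"
    using r(1,2) that take unfolding first_wrong_def by (auto simp: min_def dest: spec[of _ "length r"])
  ultimately have "length r = length r'" by force
  then show "r = r'" using take by simp
qed

lemma first_wrong_not_initial:
  assumes e: "\<forall>c. eval (A \<oplus>\<^sub>T X) e c = Some (of_bool (c \<in> killed A))"
    and r: "first_wrong e (A \<restriction> length r) r"
  shows "\<not> initial r X"
proof
  assume "initial r X"
  have "wrong e (A \<restriction> length r) r" using r by (simp add: first_wrong_def)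
  then obtain b where b: "fst b = e" "kill (A \<restriction> length r) b" "r \<in> hits (A \<restriction> length r) b"
    unfolding wrong_iff by (elim exE conjE)
  have "enc b \<in> killed A" unfolding enc_in_killed using kill_overfull[OF b(2)] by (rule exI)
  then have "eval (A \<oplus>\<^sub>T X) e (enc b) = Some 1" using e by simp
  moreover have "conv e (enc b) (A \<restriction> length r) (X \<restriction> length r)"
    using b(1,3) \<open>initial r X\<close> unfolding hits_def initial_def by simp
  from conv_sound[OF this] have "eval (A \<oplus>\<^sub>T X) e (enc b) = Some 0" .
  ultimately show False by simp
qed

lemma overfull_dense:
  assumes over: "overfull (A \<restriction> s) b" and B: "\<And>r. r \<in> hits (A \<restriction> s) b \<Longrightarrow> \<exists>u\<in>B. prefix u r"
  shows "dense (fst (snd b)) s B (snd (snd b))"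
proof -
  have "hits (A \<restriction> s) b \<subseteq> covered s B (snd (snd b))"
    using B unfolding hits_def covered_def by auto
  moreover have "finite (covered s B (snd (snd b)))"
    by (rule finite_subset[OF _ finite_strings_length[of s]]) (auto simp: covered_def)
  ultimately have "card (hits (A \<restriction> s) b) \<le> card (covered s B (snd (snd b)))" by (metis card_mono)
  then have le: "card (hits (A \<restriction> s) b) * 2 ^ fst (snd b) \<le> card (covered s B (snd (snd b))) * 2 ^ fst (snd b)"
    by (rule mult_le_mono1)
  have less: "(2 ^ fst (snd b) - 1) * 2 ^ (s - length (snd (snd b))) < card (hits (A \<restriction> s) b) * 2 ^ fst (snd b)"
    and len: "length (snd (snd b)) \<le> s"
    using over unfolding overfull_def by simp_all
  show ?thesis unfolding dense_def using len less_le_trans[OF less le] by (rule conjI)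
qed

lemma ex_never_overfull:
  assumes opt: "optimal_machine U" and triv: "K_trivial U A" and rand: "martin_loef_random U X"
    and incomplete: "\<not> halting \<le>\<^sub>T X"
    and e: "\<forall>c. eval (A \<oplus>\<^sub>T X) e c = Some (of_bool (c \<in> killed A))"
  shows "\<exists>t::nat. \<forall>n. enc (e, t, X \<restriction> n) \<notin> killed A"
proof -
  let ?W = "\<lambda>x. first_wrong e (fst x) (snd x)"
  have W: "ce ?W" by (rule ce_computable, rule computable_first_wrong; intro computable_intros)
  have len: "\<forall>x. ?W x \<longrightarrow> length (fst x) = length (snd x)"
    using wrong_length unfolding first_wrong_def by blast
  have weight: "\<forall>Z F. finite F \<and> (\<forall>r\<in>F. ?W (Z \<restriction> length r, r)) \<longrightarrow> (\<Sum>r\<in>F. (1/2 :: real) ^ length r) \<le> 2 ^ 0"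
  proof (intro allI impI, elim conjE)
    fix Z F assume F: "finite F" "\<forall>r\<in>F. ?W (Z \<restriction> length r, r)"
    have "antichain F" by (rule antichain_subset[OF first_wrong_antichain[of e Z]]) (use F(2) in auto)
    from Kraft[OF F(1) this] show "(\<Sum>r\<in>F. (1/2 :: real) ^ length r) \<le> 2 ^ 0" by simp
  qed
  from ex_projected_covering[OF opt triv rand W len weight]
  obtain S where S: "ce S" "\<forall>r. ?W (A \<restriction> length r, r) \<longrightarrow> S r" "finite {r. S r \<and> initial r X}"
    by (elim exE conjE)
  obtain P where P: "set P = {r. S r \<and> initial r X}" using finite_list[OF S(3)] by (elim exE)
  \<comment> \<open>Removing the finitely many initial segments of \<open>X\<close> loses no first
    error along \<open>A\<close>, because the program is right on \<open>X\<close>.\<close>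
  define V where "V r \<longleftrightarrow> S r \<and> r \<notin> set P" for r
  have "ce (\<lambda>r. S r \<and> r \<notin> set P)"
    by (intro ce_conj S(1); (rule ce_computable)?; intro computable_intros)
  then have V_ce: "ce V" unfolding V_def .
  have V_avoid: "\<not> initial r X" if "V r" for r using that P unfolding V_def by simp
  have V_wrong: "V r" if "first_wrong e (A \<restriction> length r) r" for r
    using first_wrong_not_initial[OF e that] S(2) that P unfolding V_def by simp
  have "\<exists>t. \<forall>n L B. \<not> (finite B \<and> (\<forall>s\<in>B. V s) \<and> dense t L B (X \<restriction> n))"
    by (rule density_bound[OF opt rand V_ce]) (erule V_avoid, rule incomplete)
  then obtain t where t: "\<forall>n L B. \<not> (finite B \<and> (\<forall>s\<in>B. V s) \<and> dense t L B (X \<restriction> n))"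
    by (elim exE)
  have "enc (e, t, X \<restriction> n) \<notin> killed A" for n
  proof
    let ?b = "(e, t, X \<restriction> n)"
    assume "enc ?b \<in> killed A"
    then obtain s' where s': "overfull (A \<restriction> s') ?b" unfolding enc_in_killed by (elim exE)
    obtain s where s: "kill (A \<restriction> s) ?b" using ex_kill[OF s'] by (elim exE)
    define B where "B = {u. V u \<and> length u \<le> s}"
    have "finite B"
      unfolding B_def by (rule finite_subset[OF _ finite_lists_length_le[of UNIV s]]) auto
    moreover have "\<forall>u\<in>B. V u" by (simp add: B_def)
    moreover have "dense (fst (snd ?b)) s B (snd (snd ?b))"
    proof (rule overfull_dense[OF kill_overfull[OF s]])
      fix r assume r: "r \<in> hits (A \<restriction> s) ?b"
      have "wrong e (A \<restriction> s) r" unfolding wrong_iff using s r by (intro exI[of _ ?b]) simp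
      from ex_first_wrong[OF this] obtain m where m: "m \<le> s" "first_wrong e (A \<restriction> m) (take m r)"
        by (elim exE conjE)
      have "length r = s" using r unfolding hits_def by simp
      then have lm: "length (take m r) = m" using m(1) by simp
      have "V (take m r)" by (rule V_wrong) (use m(2) lm in simp)
      then have "take m r \<in> B" unfolding B_def using lm m(1) by simp
      then show "\<exists>u\<in>B. prefix u r" by (rule bexI[rotated]) (rule take_is_prefix)
    qed
    ultimately have "finite B \<and> (\<forall>u\<in>B. V u) \<and> dense t s B (X \<restriction> n)" by simp
    then show False using t by blast
  qed
  then have "\<forall>n. enc (e, t, X \<restriction> n) \<notin> killed A" by (rule allI)
  then show ?thesis by (rule exI)
qed

subsection \<open>The tree of settled bits\<close>

text \<open>Strict growth makes the tree progress. The condition on the code ensures that failing to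
  be overfull at this level can only be due to the measure.\<close>

definition settles :: "prog \<Rightarrow> nat \<Rightarrow> bool list \<Rightarrow> bool list \<Rightarrow> bool list \<Rightarrow> bool" where
  "settles e t s a r \<longleftrightarrow> length s < length a \<and> enc (e, t, s) \<le> length a \<and> r \<in> hits a (e, t, s)"

text \<open>Minimality gives an antichain along any set; the condition on \<open>overfull\<close>
  gives the shrinking factor for oracles other than \<open>A\<close> as well.\<close>

definition child :: "prog \<Rightarrow> nat \<Rightarrow> bool list \<Rightarrow> bool list \<Rightarrow> bool list \<Rightarrow> bool" where
  "child e t s a r \<longleftrightarrow> settles e t s a r \<and> \<not> overfull a (e, t, s) \<and>
     (\<forall>m<length a. \<not> settles e t s (take m a) (take m r))"

lemma settles_length: "settles e t s a r \<Longrightarrow> length a = length r \<and> length s < length r"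
  unfolding settles_def hits_def by auto

lemma child_settles: "child e t s a r \<Longrightarrow> settles e t s a r"
  by (simp add: child_def)

lemma computable_child [computable_intros]:
  assumes "computable s" "computable a" "computable r" shows "computable (\<lambda>x. child e t (s x) (a x) (r x))"
  unfolding child_def settles_def hits_def mem_Collect_eq
  by (intro computable_intros assms[THEN computable_compose])

lemma child_antichain: "antichain {r. child e t s (Z \<restriction> length r) r}"
  unfolding antichain_def mem_Collect_eq
proof (intro ballI impI, unfold mem_Collect_eq)
  fix r r' assume r: "child e t s (Z \<restriction> length r) r" "child e t s (Z \<restriction> length r') r'" "prefix r r'"
  have take: "take (length r) r' = r" using r(3) by (metis append_eq_conv_conj prefix_def)
  have "length r \<le> length r'" using r(3) by (rule prefix_length_le)
  moreover have False if "length r < length r'"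
    using r(1,2) that take unfolding child_def by (auto simp: min_def dest: spec[of _ "length r"])
  ultimately have "length r = length r'" by force
  then show "r = r'" using take by simp
qed

lemma hits_mono:
  assumes "r \<in> hits (Z \<restriction> length r) b" "prefix r q"
  shows "q \<in> hits (Z \<restriction> length q) b"
proof -
  obtain Y where Y: "q = Y \<restriction> length q" using ex_initial_segment[of q] by (elim exE)
  have le: "length r \<le> length q" using assms(2) by (rule prefix_length_le)
  have r: "r = Y \<restriction> length r"
    using assms(2) Y by (metis initial_def prefix_initial_segment)
  have "conv (fst b) (enc b) (Z \<restriction> length r) (Y \<restriction> length r)" using assms(1) r unfolding hits_def by simp
  from conv_mono[OF this le] have "conv (fst b) (enc b) (Z \<restriction> length q) q" using Y by simp
  moreover have "prefix (snd (snd b)) q"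
    by (rule prefix_order.trans[OF _ assms(2)]) (use assms(1) in \<open>simp add: hits_def\<close>)
  ultimately show ?thesis unfolding hits_def by simp
qed

text \<open>Extending all of \<open>F\<close> to the level of its longest member stays among the
  hits at that level. There the bit is not overfull, since that member is a child.\<close>

lemma child_weight:
  assumes F: "finite F" "\<forall>r\<in>F. child e t s (Z \<restriction> length r) r"
  shows "(\<Sum>r\<in>F. (1/2 :: real) ^ length r) \<le> (1 - (1/2) ^ t) * (1/2) ^ length s"
proof (cases "F = {}")
  case True
  then show ?thesis by (simp add: power_le_one)
next
  case False
  define M where "M = Max (length ` F)"
  have "M \<in> length ` F" unfolding M_def using False F(1) by (intro Max_in) auto
  then obtain u where u: "u \<in> F" "M = length u" by (elim imageE)
  have M: "length r \<le> M" if "r \<in> F" for r using that F(1) by (simp add: M_def)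
  have child: "child e t s (Z \<restriction> M) u" using F(2) u by simp
  then have sM: "length s < M" "enc (e, t, s) \<le> M" "\<not> overfull (Z \<restriction> M) (e, t, s)"
    unfolding child_def settles_def by simp_all
  have card: "card (hits (Z \<restriction> M) (e, t, s)) * 2 ^ t \<le> (2 ^ t - 1) * 2 ^ (M - length s)"
    using sM unfolding overfull_def by (simp del: enc_Pair)
  have "cover M F \<subseteq> hits (Z \<restriction> M) (e, t, s)"
  proof
    fix q assume "q \<in> cover M F"
    then obtain r where r: "r \<in> F" "prefix r q" "length q = M" unfolding cover_def by auto
    have "r \<in> hits (Z \<restriction> length r) (e, t, s)"
      using child_settles[OF bspec[OF F(2) r(1)]] unfolding settles_def by simp
    from hits_mono[OF this r(2)] show "q \<in> hits (Z \<restriction> M) (e, t, s)" using r(3) by simp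
  qed
  moreover have "finite (hits (Z \<restriction> M) (e, t, s))"
    by (rule finite_subset[OF _ finite_strings_length[of M]]) (auto simp: hits_def)
  ultimately have "card (cover M F) \<le> card (hits (Z \<restriction> M) (e, t, s))" by (metis card_mono)
  then have "card (cover M F) * 2 ^ t \<le> card (hits (Z \<restriction> M) (e, t, s)) * 2 ^ t" by (rule mult_le_mono1)
  from order_trans[OF this card] have "real (card (cover M F) * 2 ^ t) \<le> real ((2 ^ t - 1) * 2 ^ (M - length s))"
    by (simp only: of_nat_le_iff)
  then have le: "real (card (cover M F)) * 2 ^ t \<le> (2 ^ t - 1) * 2 ^ (M - length s)"
    by (simp add: of_nat_diff)
  have "antichain F" by (rule antichain_subset[OF child_antichain[of e t s Z]]) (use F(2) in auto)
  from card_cover_antichain[OF F(1) this M]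
  have "real (card (cover M F)) = 2 ^ M * (\<Sum>r\<in>F. (1/2) ^ length r)" by simp
  with le have "2 ^ M * (\<Sum>r\<in>F. (1/2) ^ length r) * 2 ^ t \<le> (2 ^ t - 1) * (2 ^ (M - length s) :: real)"
    by simp
  moreover have "(2 :: real) ^ (M - length s) = 2 ^ M * (1/2) ^ length s"
    using sM(1) by (simp add: power_diff power_one_over)
  ultimately have "2 ^ M * ((\<Sum>r\<in>F. (1/2) ^ length r) * 2 ^ t) \<le> 2 ^ M * ((2 ^ t - 1) * (1/2 :: real) ^ length s)"
    by (simp add: mult_ac)
  then have "(\<Sum>r\<in>F. (1/2) ^ length r) * 2 ^ t \<le> (2 ^ t - 1) * (1/2 :: real) ^ length s"
    by (rule mult_left_le_imp_le) simp
  then have "(\<Sum>r\<in>F. (1/2) ^ length r) \<le> (2 ^ t - 1) * (1/2 :: real) ^ length s / 2 ^ t"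
    by (simp add: pos_le_divide_eq)
  also have "\<dots> = (1 - (1/2) ^ t) * (1/2) ^ length s"
    by (simp add: diff_divide_distrib power_one_over left_diff_distrib)
  finally show ?thesis .
qed

lemma rtranclp_length_mono:
  assumes "C\<^sup>*\<^sup>* s r" "\<forall>s r. C s r \<longrightarrow> length s < length r" shows "length s \<le> length r"
  using assms(1)
proof (induction rule: rtranclp_induct)
  case (step y z)
  then show ?case using assms(2) by (metis less_imp_le order_trans)
qed simp

text \<open>
  Each generation weighs at most \<open>q\<close> times the preceding one, hence the bound \<open>1 / (1 - q)\<close> for \<open>k\<close>.
\<close>

lemma tree_weight:
  fixes C :: "'a list \<Rightarrow> 'a list \<Rightarrow> bool" and q k :: real
  assumes len: "\<forall>s r. C s r \<longrightarrow> length s < length r"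
    and child: "\<forall>s F. finite F \<and> (\<forall>r\<in>F. C s r) \<longrightarrow> (\<Sum>r\<in>F. (1/2 :: real) ^ length r) \<le> q * (1/2) ^ length s"
    and k: "1 + k * q \<le> k" "0 \<le> k"
  shows "finite F \<Longrightarrow> \<forall>r\<in>F. C\<^sup>*\<^sup>* s r \<and> length r < length s + n \<Longrightarrow>
    (\<Sum>r\<in>F. (1/2 :: real) ^ length r) \<le> k * (1/2) ^ length s"
proof (induction n arbitrary: s F)
  case 0
  have "F = {}"
  proof (rule equals0I)
    fix r assume "r \<in> F"
    with 0(2) have "C\<^sup>*\<^sup>* s r" "length r < length s" by simp_all
    then show False using rtranclp_length_mono[OF _ len] by (metis not_less)
  qed
  then show ?case using k(2) by simp
next
  case (Suc n)
  \<comment> \<open>Proper descendants are grouped by their ancestor in the first generation.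
    Lengths grow strictly, so below such an ancestor the bound \<open>n\<close> suffices.\<close>
  let ?G = "F - {s}"
  have "\<forall>r\<in>?G. \<exists>c. C s c \<and> C\<^sup>*\<^sup>* c r"
  proof
    fix r assume r: "r \<in> ?G"
    then have "C\<^sup>*\<^sup>* s r" using Suc.prems(2) by simp
    then show "\<exists>c. C s c \<and> C\<^sup>*\<^sup>* c r"
      using r by (cases rule: converse_rtranclpE) auto
  qed
  then obtain g where g: "\<And>r. r \<in> ?G \<Longrightarrow> C s (g r) \<and> C\<^sup>*\<^sup>* (g r) r" by metis
  have fin: "finite ?G" using Suc.prems(1) by simp
  have fibre: "(\<Sum>r | r \<in> ?G \<and> g r = c. (1/2 :: real) ^ length r) \<le> k * (1/2) ^ length c" if "c \<in> g ` ?G" for c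
  proof (rule Suc.IH)
    show "finite {r \<in> ?G. g r = c}" using fin by simp
    have "length s < length c" using that g len by auto
    show "\<forall>r\<in>{r \<in> ?G. g r = c}. C\<^sup>*\<^sup>* c r \<and> length r < length c + n"
    proof
      fix r assume "r \<in> {r \<in> ?G. g r = c}"
      then have r: "r \<in> ?G" "r \<in> F" "g r = c" by simp_all
      have "length r < length s + Suc n" using Suc.prems(2) r(2) by simp
      with g[OF r(1)] r(3) \<open>length s < length c\<close> show "C\<^sup>*\<^sup>* c r \<and> length r < length c + n" by simp
    qed
  qed
  have "(\<Sum>r\<in>?G. (1/2 :: real) ^ length r) = (\<Sum>c\<in>g ` ?G. \<Sum>r | r \<in> ?G \<and> g r = c. (1/2) ^ length r)"
    by (rule sum.group[symmetric]) (use fin in auto)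
  also have "\<dots> \<le> (\<Sum>c\<in>g ` ?G. k * (1/2) ^ length c)" by (rule sum_mono) (rule fibre)
  also have "\<dots> = k * (\<Sum>c\<in>g ` ?G. (1/2) ^ length c)" by (simp only: sum_distrib_left)
  also have "\<dots> \<le> k * (q * (1/2) ^ length s)"
  proof (rule mult_left_mono[OF _ k(2)])
    have "finite (g ` ?G) \<and> (\<forall>c\<in>g ` ?G. C s c)" using fin g by auto
    then show "(\<Sum>c\<in>g ` ?G. (1/2 :: real) ^ length c) \<le> q * (1/2) ^ length s"
      by (rule child[THEN spec, THEN spec, THEN mp])
  qed
  finally have G: "(\<Sum>r\<in>?G. (1/2 :: real) ^ length r) \<le> k * q * (1/2) ^ length s" by simp
  have "(\<Sum>r\<in>F. (1/2 :: real) ^ length r) \<le> (\<Sum>r\<in>insert s ?G. (1/2) ^ length r)"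
    using fin by (intro sum_mono2) auto
  also have "\<dots> = (1/2) ^ length s + (\<Sum>r\<in>?G. (1/2) ^ length r)"
    by (rule sum.insert) (use fin in simp_all)
  finally have "(\<Sum>r\<in>F. (1/2 :: real) ^ length r) \<le> (1/2) ^ length s + (\<Sum>r\<in>?G. (1/2) ^ length r)" .
  with G have "(\<Sum>r\<in>F. (1/2 :: real) ^ length r) \<le> (1 + k * q) * (1/2) ^ length s"
    by (simp add: distrib_right)
  moreover have "(1 + k * q) * (1/2) ^ length s \<le> k * (1/2 :: real) ^ length s"
    using k(1) by (intro mult_right_mono) simp_all
  ultimately show ?case by linarith
qed

text \<open>Pairs carry the oracle string. The parent of \<open>(a, r)\<close> sits on a truncation
  of \<open>a\<close>, so a branch follows a single oracle while the tree itself is c.e. without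
  \<open>A\<close>.\<close>

definition tree_rule :: "prog \<Rightarrow> nat \<Rightarrow> (bool list \<times> bool list) list \<times> bool list \<times> bool list \<Rightarrow> bool" where
  "tree_rule e t q \<longleftrightarrow> snd q = ([], []) \<or>
     (\<exists>s. (take (length s) (fst (snd q)), s) \<in> set (fst q) \<and> child e t s (fst (snd q)) (snd (snd q)))"

definition tree :: "prog \<Rightarrow> nat \<Rightarrow> bool list \<times> bool list \<Rightarrow> bool" where
  "tree e t = closure (tree_rule e t)"

lemma ce_tree: "ce (tree e t)"
proof -
  have "ce (\<lambda>q :: (bool list \<times> bool list) list \<times> bool list \<times> bool list. snd q = ([], []) \<or>
     (\<exists>s. (take (length s) (fst (snd q)), s) \<in> set (fst q) \<and> child e t s (fst (snd q)) (snd (snd q))))"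
    by (intro ce_disj ce_ex; (rule ce_computable)?; intro computable_intros)
  then have "ce (tree_rule e t)" unfolding tree_rule_def .
  then show ?thesis unfolding tree_def by (rule ce_closure)
qed

lemma tree_root: "tree e t ([], [])"
  unfolding tree_def by (rule closureI[of _ "[]"]) (simp_all add: tree_rule_def)

lemma tree_child:
  assumes "tree e t (A \<restriction> length s, s)" "child e t s (A \<restriction> n) r" shows "tree e t (A \<restriction> n, r)"
  unfolding tree_def
proof (rule closureI[of _ "[(A \<restriction> length s, s)]"])
  have "length s < n" using settles_length[OF child_settles[OF assms(2)]] by simp
  then show "tree_rule e t ([(A \<restriction> length s, s)], A \<restriction> n, r)"
    unfolding tree_rule_def using assms(2) by (intro disjI2 exI[of _ s]) simp
qed (use assms(1) in \<open>simp add: tree_def\<close>)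

lemma tree_descendant:
  assumes "tree e t x"
  shows "length (fst x) = length (snd x) \<and>
    (\<forall>Z. initial (fst x) Z \<longrightarrow> (\<lambda>s r. child e t s (Z \<restriction> length r) r)\<^sup>*\<^sup>* [] (snd x))"
  using assms unfolding tree_def
proof (induction rule: closure.induct)
  case (closureI ys x)
  show ?case
  proof (cases "x = ([], [])")
    case False
    then obtain s where s: "(take (length s) (fst x), s) \<in> set ys" "child e t s (fst x) (snd x)"
      using closureI(1) unfolding tree_rule_def by auto
    have len: "length (fst x) = length (snd x)" "length s < length (snd x)"
      using settles_length[OF child_settles[OF s(2)]] by simp_all
    have IH: "\<forall>Z. initial (take (length s) (fst x)) Z \<longrightarrow> (\<lambda>s r. child e t s (Z \<restriction> length r) r)\<^sup>*\<^sup>* [] s"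
      using closureI(2) s(1) by fastforce
    have "(\<lambda>s r. child e t s (Z \<restriction> length r) r)\<^sup>*\<^sup>* [] (snd x)" if Z: "initial (fst x) Z" for Z
    proof (rule rtranclp.rtrancl_into_rtrancl)
      have "initial (take (length s) (fst x)) Z" by (rule initial_prefix[OF Z]) (rule take_is_prefix)
      then show "(\<lambda>s r. child e t s (Z \<restriction> length r) r)\<^sup>*\<^sup>* [] s" using IH by simp
      show "child e t s (Z \<restriction> length (snd x)) (snd x)" using s(2) Z len(1) unfolding initial_def by simp
    qed
    then show ?thesis using len(1) by simp
  qed simp
qed

lemma tree_weight_along:
  assumes "finite F" "\<forall>r\<in>F. tree e t (Z \<restriction> length r, r)"
  shows "(\<Sum>r\<in>F. (1/2 :: real) ^ length r) \<le> 2 ^ t"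
proof -
  let ?C = "\<lambda>s r. child e t s (Z \<restriction> length r) r"
  have len: "\<forall>s r. ?C s r \<longrightarrow> length s < length r" using settles_length child_settles by blast
  have child: "\<forall>s F. finite F \<and> (\<forall>r\<in>F. ?C s r) \<longrightarrow>
    (\<Sum>r\<in>F. (1/2 :: real) ^ length r) \<le> (1 - (1/2) ^ t) * (1/2) ^ length s"
    by (intro allI impI, elim conjE) (rule child_weight)
  \<comment> \<open>\<open>2 ^ t\<close> is the sum of the geometric series with ratio
    \<open>1 - (1/2) ^ t\<close>.\<close>
  have k: "1 + 2 ^ t * (1 - (1/2) ^ t) \<le> (2 ^ t :: real)" "(0 :: real) \<le> 2 ^ t"
    by (simp_all add: right_diff_distrib power_one_over)
  have "\<forall>r\<in>F. ?C\<^sup>*\<^sup>* [] r \<and> length r < length ([] :: bool list) + Suc (Max (length ` F))"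
  proof
    fix r assume r: "r \<in> F"
    have "?C\<^sup>*\<^sup>* [] r" using tree_descendant[OF bspec[OF assms(2) r]] by (simp add: initial_def)
    moreover have "length r \<le> Max (length ` F)" using assms(1) r by simp
    ultimately show "?C\<^sup>*\<^sup>* [] r \<and> length r < length ([] :: bool list) + Suc (Max (length ` F))" by simp
  qed
  from tree_weight[OF len child k assms(1) this] show ?thesis by simp
qed

lemma ex_child:
  assumes e: "\<forall>c. eval (A \<oplus>\<^sub>T X) e c = Some (of_bool (c \<in> killed A))"
    and never: "enc (e, t :: nat, X \<restriction> n) \<notin> killed A"
  shows "\<exists>m>n. child e t (X \<restriction> n) (A \<restriction> m) (X \<restriction> m)"
proof -
  let ?b = "(e, t, X \<restriction> n)"
  have "eval (A \<oplus>\<^sub>T X) e (enc ?b) = Some 0" using e never by simp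
  from conv_complete[OF this] obtain k where k: "\<forall>m\<ge>k. conv e (enc ?b) (A \<restriction> m) (X \<restriction> m)" by (elim exE)
  define P where "P m \<longleftrightarrow> settles e t (X \<restriction> n) (A \<restriction> m) (X \<restriction> m)" for m
  \<comment> \<open>Large enough for convergence of \<open>e\<close>, for proper extension, and for
    the code of the bit.\<close>
  define m0 where "m0 = k + Suc n + enc ?b"
  have "P m0" unfolding P_def settles_def hits_def
    using k by (simp add: m0_def prefix_segment_mono del: enc_Pair)
  then have "\<exists>m. P m" by (rule exI)
  from least_witness[OF this] obtain m where m: "P m" "\<forall>l<m. \<not> P l" by (elim exE conjE)
  have "\<not> overfull (A \<restriction> m) ?b" using never unfolding enc_in_killed by simp
  moreover have "\<forall>l<m. \<not> settles e t (X \<restriction> n) (take l (A \<restriction> m)) (take l (X \<restriction> m))"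
    using m(2) unfolding P_def by (simp add: min_def)
  ultimately have "child e t (X \<restriction> n) (A \<restriction> m) (X \<restriction> m)"
    unfolding child_def using m(1) unfolding P_def by simp
  moreover have "n < m" using m(1) unfolding P_def settles_def by simp
  ultimately show ?thesis by (intro exI[of _ m]) simp
qed

theorem halting_turing_le:
  assumes opt: "optimal_machine U" and triv: "K_trivial U A" and rand: "martin_loef_random U X"
    and cup: "halting \<le>\<^sub>T A \<oplus>\<^sub>T X"
  shows "halting \<le>\<^sub>T X"
proof (rule ccontr)
  assume incomplete: "\<not> halting \<le>\<^sub>T X"
  obtain e where e: "\<forall>c. eval (A \<oplus>\<^sub>T X) e c = Some (of_bool (c \<in> killed A))"
    using killed_turing_le[OF opt triv cup] unfolding turing_le_def by (elim exE)
  obtain t :: nat where t: "\<forall>n. enc (e, t, X \<restriction> n) \<notin> killed A"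
    using ex_never_overfull[OF opt triv rand incomplete e] by (elim exE)
  have len: "\<forall>x. tree e t x \<longrightarrow> length (fst x) = length (snd x)" using tree_descendant by blast
  have weight: "\<forall>Z F. finite F \<and> (\<forall>r\<in>F. tree e t (Z \<restriction> length r, r)) \<longrightarrow> (\<Sum>r\<in>F. (1/2 :: real) ^ length r) \<le> 2 ^ t"
    by (intro allI impI, elim conjE) (rule tree_weight_along)
  from ex_projected_covering[OF opt triv rand ce_tree len weight]
  obtain S where S: "\<forall>r. tree e t (A \<restriction> length r, r) \<longrightarrow> S r" "finite {r. S r \<and> initial r X}"
    by (elim exE conjE)
  \<comment> \<open>Each member has a larger one by \<open>ex_child\<close>, so infinitely many
    initial segments of \<open>X\<close> lie in the Solovay test \<open>S\<close>.\<close>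
  define N where "N = {n. tree e t (A \<restriction> n, X \<restriction> n)}"
  have "0 \<in> N" using tree_root by (simp add: N_def initial_segment_def)
  moreover have "\<exists>m\<in>N. n < m" if n: "n \<in> N" for n
  proof -
    obtain m where m: "n < m" "child e t (X \<restriction> n) (A \<restriction> m) (X \<restriction> m)"
      using ex_child[OF e t[THEN spec, of n]] by (elim exE conjE)
    have "tree e t (A \<restriction> m, X \<restriction> m)" by (rule tree_child[OF _ m(2)]) (use n in \<open>simp add: N_def\<close>)
    then show ?thesis using m(1) unfolding N_def by (intro bexI[of _ m]) simp_all
  qed
  ultimately have "infinite N" by (metis Max_ge Max_in empty_iff leD)
  moreover have "inj_on (\<lambda>n. X \<restriction> n) N" by (rule inj_onI) (metis length_initial_segment)
  moreover have "(\<lambda>n. X \<restriction> n) ` N \<subseteq> {r. S r \<and> initial r X}"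
    using S(1) by (auto simp: N_def)
  ultimately show False using S(2) by (metis finite_imageD finite_subset)
qed

theorem theorem2p1:
  fixes U :: "bool list \<Rightarrow> bool list option" and A :: "nat set"
  assumes "optimal_machine U"
    and "K_trivial U A"
  shows "\<not> weakly_ML_cuppable U A \<and>
    (\<forall>X. martin_loef_random U X \<and> halting \<le>\<^sub>T A \<oplus>\<^sub>T X \<longrightarrow> halting \<le>\<^sub>T X)"
  unfolding weakly_ML_cuppable_def using halting_turing_le[OF assms] by blast

end
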